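(* Let $D\in\mathbb{N}$, $0<p\le1$, and let $\{v^{(d)}_n\}_{n\in\mathbb{Z}_+}$, $d=1,\dots,D$, be bounded Vilenkin systems (possibly different for different $d$). Then there exists a constant $C$ such that the following holds. Let $I_k=I_k^1\times\dots\times I_k^D$, $k\in\mathbb{N}$, be a family of pairwise disjoint rectangles in $\mathbb{Z}_+^D$, where $I_k^d=[a_k^{(d)},b_k^{(d)})$, and let $f_k:[0,1)^D\to\mathbb{R}$ be functions with Vilenkin–Fourier spectrum in $I_k$, i.e. $f_k=\sum_{n\in I_k}\langle f_k,v_n\rangle v_n$. Then $$\Big\|\sum_kf_k\Big\|_{L^p}\le C\sum_{a=1}^{2^D}\Big\|\big\{v_{\tau_{a,k}}^{-1}f_k\big\}_{k\in\mathbb{N}}\Big\|_{\mathfrak{H}^p(l^2_{\mathbb{N}})},$$ where $\tau_{a,k}$, $a=1,\dots,2^D$, is the $a$-th corner of the rectangle $I_k$. The constant $C$ does not depend on the choice of the rectangles $\{I_k\}$ or of the functions $\{f_k\}$.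
   Context: $\mathbb{Z}_+=\{0,1,2,\dots\}$; $[a,b)=\{x\in\mathbb{Z}_+:a\le x<b\}$ for $a,b\in\mathbb{Z}_+$; a rectangle in $\mathbb{Z}_+^D$ is a product of such intervals. The corners of $I_k=\prod_d[a_k^{(d)},b_k^{(d)})$ are the $2^D$ points of $\prod_{d=1}^D\{a_k^{(d)},b_k^{(d)}\}$, enumerated in the same order for all $k$ (each $a$ corresponds to a fixed choice, for every $d$, of the left endpoint $a_k^{(d)}$ or the right endpoint $b_k^{(d)}$). If infinitely many $f_k$ are nonzero and the right-hand side is finite, $\sum_kf_k$ is understood as a series converging in $L^p$. Vilenkin system of a sequence $\mathbf{p}=\{p_n\}_{n\in\mathbb{N}}$ of integers $p_n\ge2$: put $P_0=1$, $P_n=p_1\cdots p_n$. Write $x\in[0,1)$ as $x=\sum_{k\ge1}x_k/P_k$ with integers $0\le x_k<p_k$ (if there are two representations, the one with $x_k\to0$), and $n\in\mathbb{Z}_+$ as $n=\sum_{k\ge1}n_kP_{k-1}$ with integers $0\le n_k<p_k$. Then $v_n(x)=\prod_{k\ge1}\exp(2\pi i x_k/p_k)^{n_k}$. The system is bounded if $\sup_np_n<\infty$. Let $\{v_n^{(d)}\}$ correspond to the bounded sequence $\mathbf{p}_d=\{p^{(d)}_n\}$, with products $P^{(d)}_n$. For $n\in\mathbb{Z}_+^D$, $v_n(x)=v^{(1)}_{n_1}(x_1)\cdots v^{(D)}_{n_D}(x_D)$; $\langle\cdot,\cdot\rangle$ is the inner product of $L^2[0,1)^D$. Martingale Hardy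 space: $\mathcal{F}_n$, $n\in\mathbb{Z}_+^D$, is the $\sigma$-algebra on $[0,1)^D$ generated by the rectangles $\prod_{d=1}^D[l_d/P^{(d)}_{n_d},(l_d+1)/P^{(d)}_{n_d})$, $0\le l_d<P^{(d)}_{n_d}$; $\mathbb{E}_n$ is the conditional expectation onto $\mathcal{F}_n$; $\Delta_ng=\sum_{\varepsilon\in\{0,1\}^D}(-1)^{\varepsilon_1+\dots+\varepsilon_D}\mathbb{E}_{n-\varepsilon}g$, terms with some index $-1$ being zero. An integrable function $g$ is identified with the martingale $\{\mathbb{E}_ng\}_n$. For a sequence $g=\{g_k\}_{k\in\mathbb{N}}$, $$\|g\|_{\mathfrak{H}^p(l^2_{\mathbb{N}})}=\Big\|\Big(\sum_{n\in\mathbb{Z}_+^D}\sum_{k\in\mathbb{N}}|\Delta_ng_k|^2\Big)^{1/2}\Big\|_{L^p([0,1)^D)}.$$ *)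

theory Defs
  imports "HOL-Probability.Probability"
begin

section \<open>Vilenkin systems\<close>

text \<open>
  A generating sequence \<open>(p\<^sub>n)\<close>, \<open>n \<ge> 1\<close>, is a function \<open>m :: nat \<Rightarrow> nat\<close> with
  \<open>m k = p\<^sub>k\<^sub>+\<^sub>1\<close>; digit sequences are shifted in the same way.
\<close>

definition bounded_generators :: "(nat \<Rightarrow> nat) \<Rightarrow> bool" where
  "bounded_generators m \<longleftrightarrow> (\<forall>k. 2 \<le> m k) \<and> bdd_above (range m)"

definition vil_prod :: "(nat \<Rightarrow> nat) \<Rightarrow> nat \<Rightarrow> nat" where
  "vil_prod m n = (\<Prod>k<n. m k)"

definition vil_expansion :: "(nat \<Rightarrow> nat) \<Rightarrow> real \<Rightarrow> (nat \<Rightarrow> nat) \<Rightarrow> bool" where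
  "vil_expansion m x t \<longleftrightarrow>
     (\<forall>k. t k < m k) \<and> (\<lambda>k. real (t k) / real (vil_prod m (Suc k))) sums x"

definition vil_digit :: "(nat \<Rightarrow> nat) \<Rightarrow> real \<Rightarrow> nat \<Rightarrow> nat" where
  "vil_digit m x =
     (THE t. vil_expansion m x t \<and> ((\<exists>s. vil_expansion m x s \<and> s \<noteq> t) \<longrightarrow> t \<longlonglongrightarrow> 0))"

definition vil_nat_expansion :: "(nat \<Rightarrow> nat) \<Rightarrow> nat \<Rightarrow> (nat \<Rightarrow> nat) \<Rightarrow> bool" where
  "vil_nat_expansion m n t \<longleftrightarrow>
     (\<forall>k. t k < m k) \<and> finite {k. t k \<noteq> 0} \<and> n = (\<Sum>k | t k \<noteq> 0. t k * vil_prod m k)"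

definition vil_nat_digit :: "(nat \<Rightarrow> nat) \<Rightarrow> nat \<Rightarrow> nat \<Rightarrow> nat" where
  "vil_nat_digit m n = (THE t. vil_nat_expansion m n t)"

definition vilenkin :: "(nat \<Rightarrow> nat) \<Rightarrow> nat \<Rightarrow> real \<Rightarrow> complex" where
  "vilenkin m n x =
     (\<Prod>k | vil_nat_digit m n k \<noteq> 0.
        exp (2 * of_real pi * \<i> * of_nat (vil_digit m x k) / of_nat (m k)) ^ vil_nat_digit m n k)"


subsection \<open>Well-definedness of the digits\<close>

lemma vil_prod_0 [simp]: "vil_prod m 0 = 1"
  and vil_prod_Suc: "vil_prod m (Suc n) = vil_prod m n * m n"
  by (simp_all add: vil_prod_def)

lemma vil_prod_ge:
  assumes "\<And>k. 2 \<le> m k"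
  shows "2 ^ n \<le> vil_prod m n"
proof (induction n)
  case (Suc n)
  show ?case using mult_le_mono[OF Suc assms[of n]] by (simp add: vil_prod_Suc mult.commute)
qed simp

lemma vil_prod_pos:
  assumes "\<And>k. 2 \<le> m k"
  shows "0 < vil_prod m n"
proof -
  have "0 < m k" for k using assms[of k] by simp
  then show ?thesis by (simp add: vil_prod_def prod_pos)
qed

lemma vil_prod_dvd: "n \<le> k \<Longrightarrow> vil_prod m n dvd vil_prod m k"
  unfolding vil_prod_def by (rule prod_dvd_prod_subset) auto

lemma vil_prod_inverse_LIMSEQ:
  assumes "\<And>k. 2 \<le> m k"
  shows "(\<lambda>n. 1 / real (vil_prod m n)) \<longlonglongrightarrow> 0"
proof (rule real_tendsto_sandwich)
  show "\<forall>\<^sub>F n in sequentially. 0 \<le> 1 / real (vil_prod m n)"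
    by simp
  show "\<forall>\<^sub>F n in sequentially. 1 / real (vil_prod m n) \<le> (1 / 2) ^ n"
  proof (intro always_eventually allI)
    fix n
    have "real (2 ^ n) \<le> real (vil_prod m n)"
      using vil_prod_ge[of m n, OF assms] by (simp only: of_nat_le_iff)
    then have "2 ^ n \<le> real (vil_prod m n)" by simp
    then have "1 / real (vil_prod m n) \<le> 1 / 2 ^ n"
      by (intro frac_le) auto
    then show "1 / real (vil_prod m n) \<le> (1 / 2) ^ n"
      by (simp add: power_one_over)
  qed
  show "(\<lambda>n. (1 / 2 :: real) ^ n) \<longlonglongrightarrow> 0"
    by (rule LIMSEQ_power_zero) simp
qed simp

lemma vil_digit_eq:
  assumes m: "\<And>k. 2 \<le> m k" and x: "0 \<le> x" "x < 1"
  shows "vil_expansion m x (vil_digit m x)" (is ?th1)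
    and "vil_digit m x k = nat \<lfloor>x * real (vil_prod m (Suc k))\<rfloor> mod m k" (is ?th2)
proof -
  define P where "P = vil_prod m"
  define F where "F n = nat \<lfloor>x * real (P n)\<rfloor>" for n
  define u where "u k = F (Suc k) mod m k" for k
  have P_pos: "0 < P n" for n unfolding P_def by (rule vil_prod_pos[OF m])
  have P_Suc: "P (Suc n) = P n * m n" for n by (simp add: P_def vil_prod_Suc)
  have m_pos: "0 < m k" for k using m[of k] by simp
  have P_lim: "(\<lambda>n. 1 / real (P n)) \<longlonglongrightarrow> 0"
    unfolding P_def by (rule vil_prod_inverse_LIMSEQ[OF m])
  have F_div: "F (Suc n) div m n = F n" for n
  proof -
    have "\<lfloor>x * real (P n)\<rfloor> = \<lfloor>x * real (P (Suc n)) / of_int (int (m n))\<rfloor>"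
      using m_pos[of n] by (simp add: P_Suc)
    also have "\<dots> = \<lfloor>x * real (P (Suc n))\<rfloor> div int (m n)"
      by (rule floor_divide_real_eq_div) simp
    finally show ?thesis
      by (simp add: F_def nat_div_distrib')
  qed
  have F_Suc: "F (Suc n) = m n * F n + u n" for n
    using div_mult_mod_eq[of "F (Suc n)" "m n"] by (simp add: F_div u_def mult.commute)
  have F0: "F 0 = 0" using x by (simp add: F_def P_def floor_eq_iff)
  have partial: "(\<Sum>k<n. real (t k) / real (P (Suc k))) = real (G n) / real (P n)"
    if "G 0 = 0" "\<And>n. G (Suc n) = m n * G n + t n" for G t :: "nat \<Rightarrow> nat" and n
  proof (induction n)
    case (Suc n)
    have "(\<Sum>k<Suc n. real (t k) / real (P (Suc k))) =
        real (G n) / real (P n) + real (t n) / real (P (Suc n))"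
      by (simp only: sum.lessThan_Suc Suc)
    also have "\<dots> = real (G (Suc n)) / real (P (Suc n))"
      using P_pos[of n] m_pos[of n] by (simp add: that(2) P_Suc field_simps)
    finally show ?case .
  qed (simp add: that(1))
  have u_exp: "vil_expansion m x u"
    unfolding vil_expansion_def
  proof (intro conjI allI)
    show "u k < m k" for k using m_pos by (simp add: u_def)
    have "(\<lambda>n. x - real (F n) / real (P n)) \<longlonglongrightarrow> 0"
    proof (rule tendsto_sandwich[OF _ _ tendsto_const P_lim])
      show "\<forall>\<^sub>F n in sequentially. 0 \<le> x - real (F n) / real (P n)"
        using P_pos x by (intro always_eventually allI) (simp add: F_def field_simps)
      show "\<forall>\<^sub>F n in sequentially. x - real (F n) / real (P n) \<le> 1 / real (P n)"
      proof (intro always_eventually allI)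
        fix n
        have "x * real (P n) \<le> real (F n) + 1"
          using x P_pos[of n] by (simp add: F_def)
        then have "x \<le> (real (F n) + 1) / real (P n)"
          using P_pos[of n] by (simp add: pos_le_divide_eq)
        then show "x - real (F n) / real (P n) \<le> 1 / real (P n)"
          by (simp add: add_divide_distrib)
      qed
    qed
    from tendsto_diff[OF tendsto_const[of x] this]
    have "(\<lambda>n. real (F n) / real (P n)) \<longlonglongrightarrow> x" by simp
    then show "(\<lambda>k. real (u k) / real (vil_prod m (Suc k))) sums x"
      unfolding sums_def P_def[symmetric] by (simp add: partial[OF F0 F_Suc])
  qed
  have other: "u \<longlonglongrightarrow> 0 \<and> \<not> t \<longlonglongrightarrow> 0" if t: "vil_expansion m x t" and ne: "t \<noteq> u" for t
  proof -
    define G where "G = rec_nat 0 (\<lambda>n g. m n * g + t n)"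
    have G0: "G 0 = 0" and G_Suc: "G (Suc n) = m n * G n + t n" for n by (simp_all add: G_def)
    have t_less: "t k < m k" for k using t by (simp add: vil_expansion_def)
    have lim: "(\<lambda>n. real (G n) / real (P n)) \<longlonglongrightarrow> x"
      using t unfolding vil_expansion_def sums_def P_def[symmetric]
      by (simp add: partial[OF G0 G_Suc])
    have inc: "incseq (\<lambda>n. real (G n) / real (P n))"
      using P_pos m_pos by (intro incseq_SucI) (simp add: G_Suc P_Suc field_simps)
    have G_le: "real (G n) / real (P n) \<le> x" for n
      by (rule incseq_le[OF inc lim])
    have step: "(real (G (Suc n)) + 1) / real (P (Suc n)) =
        (real (G n) + 1) / real (P n) - real (m n - 1 - t n) / real (P (Suc n))" for n
      using P_pos[of n] m_pos[of n] t_less[of n]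
      by (simp add: G_Suc P_Suc field_simps of_nat_diff)
    have dec: "decseq (\<lambda>n. (real (G n) + 1) / real (P n))"
      by (intro decseq_SucI) (simp add: step)
    have lim': "(\<lambda>n. (real (G n) + 1) / real (P n)) \<longlonglongrightarrow> x"
      using tendsto_add[OF lim P_lim] by (simp add: add_divide_distrib)
    have le_G: "x \<le> (real (G n) + 1) / real (P n)" for n
      by (rule decseq_ge[OF dec lim'])
    have "\<exists>K. \<forall>k\<ge>K. t k = m k - 1"
    proof (rule ccontr)
      assume no: "\<not> (\<exists>K. \<forall>k\<ge>K. t k = m k - 1)"
      have "F n = G n" for n
      proof -
        obtain k where k: "k \<ge> n" "t k \<noteq> m k - 1" using no by blast
        then have "t k < m k - 1" using t_less[of k] by simp
        then have pos: "0 < real (m k - 1 - t k) / real (P (Suc k))" using P_pos by simp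
        have "x \<le> (real (G (Suc k)) + 1) / real (P (Suc k))" by (rule le_G)
        also have "\<dots> < (real (G k) + 1) / real (P k)" using pos by (simp only: step)
        also have "\<dots> \<le> (real (G n) + 1) / real (P n)" using decseqD[OF dec k(1)] .
        finally have "x * real (P n) < real (G n) + 1" using P_pos[of n] by (simp add: field_simps)
        moreover have "real (G n) \<le> x * real (P n)"
          using G_le[of n] P_pos[of n] by (simp add: field_simps)
        ultimately have "\<lfloor>x * real (P n)\<rfloor> = int (G n)" by (simp add: floor_eq_iff)
        then show ?thesis by (simp add: F_def)
      qed
      then have "t = u" using t_less by (auto simp: u_def G_Suc)
      with ne show False by simp
    qed
    then obtain K where K: "\<And>k. k \<ge> K \<Longrightarrow> t k = m k - 1" by blast
    have "(real (G n) + 1) / real (P n) = (real (G K) + 1) / real (P K)" if "n \<ge> K" for n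
      using that by (induction n rule: dec_induct) (simp_all add: step K)
    then have "\<forall>\<^sub>F n in sequentially. (real (G n) + 1) / real (P n) = (real (G K) + 1) / real (P K)"
      by (rule eventually_sequentiallyI)
    then have "(\<lambda>n. (real (G n) + 1) / real (P n)) \<longlonglongrightarrow> (real (G K) + 1) / real (P K)"
      by (rule tendsto_eventually)
    then have xK: "x = (real (G K) + 1) / real (P K)" using lim' LIMSEQ_unique by blast
    have "u k = 0" if "K \<le> k" for k
    proof -
      from that have "P K dvd P k" unfolding P_def by (rule vil_prod_dvd)
      then obtain c where c: "P k = P K * c" by (rule dvdE)
      have "x * real (P (Suc k)) = real ((G K + 1) * c * m k)"
        using P_pos[of K] by (simp add: xK P_Suc c field_simps)
      then have "F (Suc k) = (G K + 1) * c * m k" unfolding F_def by (metis floor_of_nat nat_int)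
      then show ?thesis by (simp add: u_def)
    qed
    then have "u \<longlonglongrightarrow> 0" by (intro tendsto_eventually eventually_sequentiallyI)
    moreover have "\<not> t \<longlonglongrightarrow> 0"
    proof
      assume "t \<longlonglongrightarrow> 0"
      then have "\<forall>\<^sub>F k in sequentially. t k = 0" by (simp add: tendsto_discrete)
      then obtain N where N: "\<And>k. k \<ge> N \<Longrightarrow> t k = 0" by (auto simp: eventually_sequentially)
      have "t (max N K) = 0" by (rule N) simp
      moreover have "t (max N K) = m (max N K) - 1" by (rule K) simp
      ultimately show False using m[of "max N K"] by linarith
    qed
    ultimately show ?thesis by blast
  qed
  have "vil_digit m x = u"
    unfolding vil_digit_def
  proof (rule the_equality)
    show "vil_expansion m x u \<and> ((\<exists>s. vil_expansion m x s \<and> s \<noteq> u) \<longrightarrow> u \<longlonglongrightarrow> 0)"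
      using u_exp other by blast
  qed (use u_exp other in blast)
  then show ?th1 and ?th2 using u_exp by (simp_all add: u_def F_def P_def)
qed

lemma vil_nat_digit_eq:
  assumes m: "\<And>k. 2 \<le> m k"
  shows "vil_nat_expansion m n (vil_nat_digit m n)" (is ?th1)
    and "vil_nat_digit m n k = n div vil_prod m k mod m k" (is ?th2)
proof -
  define P where "P = vil_prod m"
  define u where "u k = n div P k mod m k" for k
  have P_pos: "0 < P n" for n unfolding P_def by (rule vil_prod_pos[OF m])
  have P_Suc: "P (Suc n) = P n * m n" for n by (simp add: P_def vil_prod_Suc)
  have m_pos: "0 < m k" for k using m[of k] by simp
  have big: "n < P k" if "n \<le> k" for k
    unfolding P_def using that less_exp vil_prod_ge[of m k, OF m]
    by (rule le_less_trans[OF _ less_le_trans])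
  have sum_eq: "(\<Sum>k | t k \<noteq> 0. t k * P k) = (\<Sum>k<N. t k * P k)"
    if "{k. t k \<noteq> 0} \<subseteq> {..<N}" for t :: "nat \<Rightarrow> nat" and N
    using that by (intro sum.mono_neutral_left) auto
  have u_sum: "(\<Sum>k<N. u k * P k) = n mod P N" for N
  proof (induction N)
    case (Suc N)
    then show ?case by (simp add: u_def P_Suc mod_mult2_eq mult.commute)
  qed (simp add: P_def)
  have supp: "{k. u k \<noteq> 0} \<subseteq> {..<n}"
  proof
    fix k assume "k \<in> {k. u k \<noteq> 0}"
    then have "\<not> n < P k" by (auto simp: u_def)
    then show "k \<in> {..<n}" using big[of k] by force
  qed
  have u_exp: "vil_nat_expansion m n u"
    unfolding vil_nat_expansion_def P_def[symmetric]
  proof (intro conjI allI)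
    show "u k < m k" for k using m_pos by (simp add: u_def)
    show "finite {k. u k \<noteq> 0}" using supp finite_subset by blast
    show "n = (\<Sum>k | u k \<noteq> 0. u k * P k)"
      using big[of n] by (simp only: sum_eq[OF supp] u_sum) simp
  qed
  have "t = u" if t: "vil_nat_expansion m n t" for t
  proof
    fix k
    have t_less: "t j < m j" for j using t by (simp add: vil_nat_expansion_def)
    obtain B where B: "{j. t j \<noteq> 0} \<subseteq> {..<B}"
      using t finite_nat_bounded unfolding vil_nat_expansion_def by blast
    then have "{j. t j \<noteq> 0} \<subseteq> {..<Suc k + B}" by force
    then have "n = (\<Sum>j<Suc k + B. t j * P j)"
      using t sum_eq by (simp add: vil_nat_expansion_def P_def)
    also have "\<dots> = (\<Sum>j<Suc k. t j * P j) + (\<Sum>j=Suc k..<Suc k + B. t j * P j)"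
      unfolding lessThan_atLeast0 by (rule sum.atLeastLessThan_concat[symmetric]) simp_all
    finally have n_eq: "n = (\<Sum>j<k. t j * P j) + t k * P k + (\<Sum>j=Suc k..<Suc k + B. t j * P j)"
      by simp
    have "P (Suc k) dvd (\<Sum>j=Suc k..<Suc k + B. t j * P j)"
      using vil_prod_dvd[of "Suc k" _ m] unfolding P_def by (intro dvd_sum) auto
    then obtain r where "(\<Sum>j=Suc k..<Suc k + B. t j * P j) = P (Suc k) * r" by blast
    then have n_eq': "n = (\<Sum>j<k. t j * P j) + P k * (t k + m k * r)"
      using n_eq by (simp add: P_Suc algebra_simps)
    have "(\<Sum>j<k. t j * P j) < P k"
    proof (induction k)
      case (Suc k)
      have "(\<Sum>j<Suc k. t j * P j) < P k * Suc (t k)" using Suc by simp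
      also have "\<dots> \<le> P (Suc k)" using t_less[of k] unfolding P_Suc by (intro mult_le_mono) simp_all
      finally show ?case .
    qed (simp add: P_def)
    then have "n div P k = t k + m k * r" using n_eq' P_pos[of k] by simp
    then show "t k = u k" using t_less[of k] by (simp add: u_def)
  qed
  then have "vil_nat_digit m n = u"
    unfolding vil_nat_digit_def using u_exp by (rule_tac the_equality)
  then show ?th1 and ?th2 using u_exp by (simp_all add: u_def P_def)
qed


section \<open>The multiple system on the unit cube\<close>

text \<open>The dimension \<open>D\<close> is \<open>CARD('d)\<close>; multi-indices are functions \<open>'d \<Rightarrow> nat\<close>.\<close>

definition cube :: "(real ^ 'd::finite) set" where
  "cube = {x. \<forall>d. 0 \<le> x $ d \<and> x $ d < 1}"

abbreviation cubeM :: "(real ^ 'd::finite) measure" where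
  "cubeM \<equiv> lebesgue_on cube"

definition vilenkinD :: "('d::finite \<Rightarrow> nat \<Rightarrow> nat) \<Rightarrow> ('d \<Rightarrow> nat) \<Rightarrow> real ^ 'd \<Rightarrow> complex" where
  "vilenkinD m n x = (\<Prod>d\<in>UNIV. vilenkin (m d) (n d) (x $ d))"

definition L2_inner :: "(real ^ 'd::finite \<Rightarrow> complex) \<Rightarrow> (real ^ 'd \<Rightarrow> complex) \<Rightarrow> complex" where
  "L2_inner f g = (\<integral>x. f x * cnj (g x) \<partial>cubeM)"

definition rectangle :: "('d \<Rightarrow> nat) \<Rightarrow> ('d \<Rightarrow> nat) \<Rightarrow> ('d \<Rightarrow> nat) set" where
  "rectangle a b = Pi UNIV (\<lambda>d. {a d..<b d})"

text \<open>A corner is selected by \<open>c\<close>: the right endpoint is taken exactly in the directions with \<open>c d\<close>.\<close>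

definition corner :: "('d \<Rightarrow> bool) \<Rightarrow> ('d \<Rightarrow> nat) \<Rightarrow> ('d \<Rightarrow> nat) \<Rightarrow> 'd \<Rightarrow> nat" where
  "corner c a b d = (if c d then b d else a d)"

text \<open>Functions on the cube are identified when they agree almost everywhere.\<close>

definition spectrum_in ::
  "('d::finite \<Rightarrow> nat \<Rightarrow> nat) \<Rightarrow> ('d \<Rightarrow> nat) set \<Rightarrow> (real ^ 'd \<Rightarrow> real) \<Rightarrow> bool" where
  "spectrum_in m R f \<longleftrightarrow>
     f \<in> borel_measurable cubeM \<and> integrable cubeM (\<lambda>x. (f x)\<^sup>2) \<and>
     (AE x in cubeM. complex_of_real (f x) =
        (\<Sum>n\<in>R. L2_inner (\<lambda>y. complex_of_real (f y)) (vilenkinD m n) * vilenkinD m n x))"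


section \<open>Martingale Hardy space\<close>

definition vil_cell :: "('d::finite \<Rightarrow> nat \<Rightarrow> nat) \<Rightarrow> ('d \<Rightarrow> nat) \<Rightarrow> ('d \<Rightarrow> nat) \<Rightarrow> (real ^ 'd) set" where
  "vil_cell m n l =
     {x. \<forall>d. real (l d) / real (vil_prod (m d) (n d)) \<le> x $ d \<and>
             x $ d < (real (l d) + 1) / real (vil_prod (m d) (n d))}"

definition vil_algebra :: "('d::finite \<Rightarrow> nat \<Rightarrow> nat) \<Rightarrow> ('d \<Rightarrow> nat) \<Rightarrow> (real ^ 'd) measure" where
  "vil_algebra m n = sigma cube {vil_cell m n l | l. \<forall>d. l d < vil_prod (m d) (n d)}"

lemma subalgebra_vil_algebra:
  fixes m :: "'d::finite \<Rightarrow> nat \<Rightarrow> nat"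
  assumes "\<And>d k. 2 \<le> m d k"
  shows "subalgebra cubeM (vil_algebra m n)"
proof -
  let ?A = "{vil_cell m n l | l. \<forall>d. l d < vil_prod (m d) (n d)}"
  have cube_borel: "cube \<in> sets (borel :: (real ^ 'd) measure)"
    unfolding cube_def by measurable
  have cell_borel: "vil_cell m n l \<in> sets borel" for l
    unfolding vil_cell_def by measurable
  have cell_cube: "vil_cell m n l \<subseteq> cube" if l: "\<forall>d. l d < vil_prod (m d) (n d)" for l
  proof
    fix x assume x: "x \<in> vil_cell m n l"
    have "0 \<le> x $ d \<and> x $ d < 1" for d
    proof -
      have "0 \<le> real (l d) / real (vil_prod (m d) (n d))" by simp
      moreover have "(real (l d) + 1) / real (vil_prod (m d) (n d)) \<le> 1"
        using l[rule_format, of d] by simp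
      moreover have "real (l d) / real (vil_prod (m d) (n d)) \<le> x $ d"
        "x $ d < (real (l d) + 1) / real (vil_prod (m d) (n d))"
        using x by (simp_all add: vil_cell_def)
      ultimately show ?thesis by linarith
    qed
    then show "x \<in> cube" by (simp add: cube_def)
  qed
  have sub: "?A \<subseteq> Pow cube" using cell_cube by blast
  have "?A \<subseteq> sets cubeM"
    using cell_cube cell_borel cube_borel
    by (auto simp: sets_restrict_space_iff)
  then have "sigma_sets cube ?A \<subseteq> sets cubeM"
    using sets.sigma_sets_subset[of ?A cubeM] by (simp add: space_restrict_space)
  then show ?thesis
    using sub by (simp add: subalgebra_def vil_algebra_def space_measure_of_conv space_restrict_space)
qed

text \<open>The library's conditional expectation is for real-valued functions; it is applied to the
  real and imaginary parts.\<close>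

definition vil_exp ::
  "('d::finite \<Rightarrow> nat \<Rightarrow> nat) \<Rightarrow> ('d \<Rightarrow> nat) \<Rightarrow> (real ^ 'd \<Rightarrow> complex) \<Rightarrow> real ^ 'd \<Rightarrow> complex" where
  "vil_exp m n g x =
     Complex (real_cond_exp cubeM (vil_algebra m n) (\<lambda>y. Re (g y)) x)
             (real_cond_exp cubeM (vil_algebra m n) (\<lambda>y. Im (g y)) x)"

definition vil_diff ::
  "('d::finite \<Rightarrow> nat \<Rightarrow> nat) \<Rightarrow> ('d \<Rightarrow> nat) \<Rightarrow> (real ^ 'd \<Rightarrow> complex) \<Rightarrow> real ^ 'd \<Rightarrow> complex" where
  "vil_diff m n g x =
     (\<Sum>e \<in> Pi UNIV (\<lambda>_. {0, 1}).
        if \<forall>d. e d \<le> n d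
        then (- 1) ^ (\<Sum>d\<in>UNIV. e d) * vil_exp m (\<lambda>d. n d - e d) g x
        else 0)"

text \<open>Powers with a positive exponent on \<open>[0, \<infinity>]\<close>.\<close>

definition ennpow :: "ennreal \<Rightarrow> real \<Rightarrow> ennreal" where
  "ennpow t r = (if t = \<infinity> then \<infinity> else ennreal (enn2real t powr r))"

definition Lp_norm :: "real \<Rightarrow> (real ^ 'd::finite \<Rightarrow> ennreal) \<Rightarrow> ennreal" where
  "Lp_norm p F = ennpow (\<integral>\<^sup>+x. ennpow (F x) p \<partial>cubeM) (1 / p)"

definition hardy_norm ::
  "('d::finite \<Rightarrow> nat \<Rightarrow> nat) \<Rightarrow> real \<Rightarrow> (nat \<Rightarrow> real ^ 'd \<Rightarrow> complex) \<Rightarrow> ennreal" where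
  "hardy_norm m p g =
     Lp_norm p (\<lambda>x. ennpow (\<Sum>\<^sub>\<infinity>n. \<Sum>\<^sub>\<infinity>k. ennreal ((cmod (vil_diff m n (g k) x))\<^sup>2)) (1 / 2))"

definition Lp_sums :: "real \<Rightarrow> (nat \<Rightarrow> real ^ 'd::finite \<Rightarrow> real) \<Rightarrow> (real ^ 'd \<Rightarrow> real) \<Rightarrow> bool" where
  "Lp_sums p f S \<longleftrightarrow>
     S \<in> borel_measurable cubeM \<and> Lp_norm p (\<lambda>x. ennreal \<bar>S x\<bar>) < \<infinity> \<and>
     (\<lambda>N. Lp_norm p (\<lambda>x. ennreal \<bar>(\<Sum>k<N. f k x) - S x\<bar>)) \<longlonglongrightarrow> 0"

end

theory Submission
  imports Defs
begin

text \<open>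
  Every rectangle is divided among its \<open>2\<^sup>D\<close> corners, one direction at a time. If \<open>s\<close> is the
  highest digit position at which \<open>a\<close> and \<open>b\<close> differ, then a frequency of \<open>[a, b)\<close> is assigned to
  \<open>b\<close> if its digits from position \<open>s\<close> upwards are those of \<open>b\<close>, and to \<open>a\<close> otherwise. The depth
  of a frequency \<open>\<nu>\<close> relative to the endpoint \<open>t\<close> is the least \<open>j\<close> such that \<open>\<nu>\<close> and \<open>t\<close> have the same
  digits from position \<open>j\<close> upwards. For a corner \<open>\<tau>\<close> of a rectangle and a polynomial \<open>f\<close>, the function
  \<open>v\<^sub>\<tau> \<Delta>\<^sub>n(v\<^sub>\<tau>\<^sup>-\<^sup>1 f)\<close> consists of the frequencies of \<open>f\<close> whose depth relative to \<open>\<tau>\<close> is exactly \<open>n\<close>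
  (\<open>vil_diff_modulated\<close>).

  The arithmetic core is \<open>endpoint_part_closed\<close>: whether a frequency of depth \<open>j\<close> belongs to the part
  of its endpoint is decided by its digits from position \<open>j - 1\<close> upwards. Let \<open>F\<^sub>k\<^sub>,\<^sub>n\<close> be the part
  of \<open>v\<^sub>\<tau> \<Delta>\<^sub>n(v\<^sub>\<tau>\<^sup>-\<^sup>1 f\<^sub>k)\<close> with frequencies assigned to \<open>\<tau>\<close>. Since two characters are orthogonal on a
  cell of generation \<open>j\<close> as soon as they differ in a digit from position \<open>j\<close> upwards, this has two
  consequences for the cells of generation \<open>n - 1\<close> (with \<open>0 - 1 = 0\<close>). On such a cell \<open>F\<^sub>k\<^sub>,\<^sub>n\<close> has at
  most the energy of \<open>\<Delta>\<^sub>n(v\<^sub>\<tau>\<^sup>-\<^sup>1 f\<^sub>k)\<close>. And the functions \<open>F\<^sub>k\<^sub>,\<^sub>n\<close> remain orthogonal to each other when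
  each of them is multiplied by the indicator of a union of its own cells, because the rectangles
  are disjoint (\<open>corner_bound\<close>).

  These two facts and the square function \<open>S\<close> of the \<open>\<Delta>\<^sub>n(v\<^sub>\<tau>\<^sup>-\<^sup>1 f\<^sub>k)\<close> suffice for an atomic
  decomposition in the manner of Chang and Fefferman (\<open>square_function_bound\<close>). With
  \<open>W\<^sub>i = {S > \<epsilon> 2\<^sup>i}\<close>, each cell of generation \<open>n - 1\<close> is given the largest \<open>i\<close> for which \<open>W\<^sub>i\<close> fills
  a fixed proportion of it, and the \<open>F\<^sub>k\<^sub>,\<^sub>n\<close> cut off to the cells of index \<open>i\<close> are added up.
  The sum is supported in the set where the strong maximal function of \<open>W\<^sub>i\<close> is not small, whose
  measure is at most a constant times that of \<open>W\<^sub>i\<close> (\<open>card_halo\<close>). Its squared \<open>L\<^sup>2\<close> norm is at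
  most a constant times \<open>(\<epsilon> 2\<^sup>i)\<^sup>2\<close> times this measure, because at most half of any cell of
  generation \<open>n\<close> inside a cell of index \<open>i\<close> lies in \<open>W\<^sub>i\<^sub>+\<^sub>1\<close>; this is where the
  generators have to be bounded, so that a cell of generation \<open>n\<close> fills a fixed proportion of the
  cell of generation \<open>n - 1\<close> around it. So the \<open>p\<close>-th power of the sum has
  integral at most a constant times \<open>(\<epsilon> 2\<^sup>i)\<^sup>p |W\<^sub>i|\<close>, and summation over \<open>i\<close> is possible because
  \<open>p \<le> 1\<close>.

  For finitely many rectangles all functions are constant on the cells of one fine generation \<open>N\<close>,
  so this argument is carried out with finite sums over a grid (\<open>rectangles_bound\<close>). Averages over
  cells are the conditional expectations on the cube, which transfers the estimate. For infinitely
  many rectangles it is applied to blocks of indices: dominated convergence shows that the partial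
  sums are Cauchy in \<open>L\<^sup>p\<close>, and completeness gives the sum together with its bound.
\<close>

section \<open>Sums over partitions and elementary inequalities\<close>

text \<open>
  A partition of a subset of \<open>A\<close> is given by the map that sends a point to its block; this is the form in which
  cells of a filtration occur below, where the generation of the block may vary from point to point.
\<close>
lemma sum_by_cells:
  fixes cell :: "'a \<Rightarrow> 'a set" and f :: "'a \<Rightarrow> 'b::comm_monoid_add"
  assumes "finite A" and self: "\<And>x. x \<in> A \<Longrightarrow> x \<in> cell x" and sub: "\<And>x. x \<in> A \<Longrightarrow> cell x \<subseteq> A"
    and eq: "\<And>x y. x \<in> A \<Longrightarrow> y \<in> cell x \<Longrightarrow> cell y = cell x"
  shows "sum f A = (\<Sum>B\<in>cell ` A. sum f B)"
proof -
  have "A = \<Union>(cell ` A)" using self sub by blast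
  then have "sum f A = sum f (\<Union>(cell ` A))" by simp
  also have "\<dots> = (sum \<circ> sum) f (cell ` A)"
  proof (rule sum.Union_disjoint)
    show "\<forall>B\<in>cell ` A. finite B" using sub finite_subset[OF _ \<open>finite A\<close>] by blast
    show "\<forall>B\<in>cell ` A. \<forall>C\<in>cell ` A. B \<noteq> C \<longrightarrow> B \<inter> C = {}" using eq by blast
  qed
  finally show ?thesis by simp
qed

lemma sum_le_by_cells:
  fixes cell :: "'a \<Rightarrow> 'a set" and f :: "'a \<Rightarrow> 'b::ordered_comm_monoid_add"
  assumes "finite A" and self: "\<And>x. x \<in> A \<Longrightarrow> x \<in> cell x" and sub: "\<And>x. x \<in> A \<Longrightarrow> cell x \<subseteq> A"
    and eq: "\<And>x y. x \<in> A \<Longrightarrow> y \<in> cell x \<Longrightarrow> cell y = cell x"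
    and le: "\<And>x. x \<in> A \<Longrightarrow> sum f (cell x) \<le> sum g (cell x)"
  shows "sum f A \<le> sum g A"
proof -
  have "(\<Sum>B\<in>cell ` A. sum f B) \<le> (\<Sum>B\<in>cell ` A. sum g B)"
    by (rule sum_mono) (use le in auto)
  then show ?thesis
    by (simp add: sum_by_cells[OF assms(1-4)])
qed

text \<open>
  This replaces Hoelder's inequality: a bound of \<open>\<integral> u\<^sup>2\<close> by \<open>l\<^sup>2\<close> times the measure of the
  support of \<open>u\<close> turns into a bound of \<open>\<integral> u\<^sup>p\<close> by \<open>l\<^sup>p\<close> times that measure.
\<close>
lemma powr_le_cutoff:
  fixes u l p :: real
  assumes "0 \<le> u" "0 < l" "0 < p" "p \<le> 2"
  shows "u powr p \<le> l powr p + l powr (p - 2) * u\<^sup>2"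
proof (cases "u \<le> l")
  case True
  then have "u powr p \<le> l powr p" using assms by (intro powr_mono2) auto
  then show ?thesis by (simp add: add_increasing2)
next
  case False
  then have u: "0 < u" using assms by simp
  have "u powr p = u powr (p - 2) * u powr 2" by (simp add: powr_add[symmetric])
  also have "\<dots> = u powr (p - 2) * u\<^sup>2" using u by simp
  also have "\<dots> \<le> l powr (p - 2) * u\<^sup>2"
    using False assms by (intro mult_right_mono powr_mono2') auto
  finally show ?thesis by (simp add: add_increasing)
qed

text \<open>
  With \<open>t = u + v\<close>, the fractions \<open>u / t\<close> and \<open>v / t\<close> add up to \<open>1\<close> and increase when
  they are raised to the power \<open>p \<le> 1\<close>.
\<close>
lemma powr_add_le:
  fixes u v p :: real
  assumes "0 \<le> u" "0 \<le> v" "0 < p" "p \<le> 1"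
  shows "(u + v) powr p \<le> u powr p + v powr p"
proof (cases "u + v = 0")
  case False
  define t where "t = u + v"
  have t: "0 < t" using False assms by (simp add: t_def)
  have *: "t powr p * (w / t) \<le> w powr p" if "0 \<le> w" "w \<le> t" for w
  proof (cases "w = 0")
    case False
    have "w / t = (w / t) powr 1" using that t by simp
    also have "\<dots> \<le> (w / t) powr p"
      using that t assms False by (intro powr_mono') auto
    finally have "w / t \<le> w powr p / t powr p" using that t by (simp add: powr_divide)
    then show ?thesis using t by (simp add: field_simps)
  qed simp
  have "t powr p = t powr p * (u / t) + t powr p * (v / t)"
    using t by (simp add: t_def add_divide_distrib[symmetric] distrib_left[symmetric])
  also have "\<dots> \<le> u powr p + v powr p"
    using assms by (intro add_mono *) (auto simp: t_def)
  finally show ?thesis by (simp add: t_def)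
qed (use assms in auto)

lemma norm_sum_powr_le:
  fixes f :: "'a \<Rightarrow> 'b::real_normed_vector"
  assumes "0 < p" "p \<le> 1"
  shows "norm (\<Sum>i\<in>A. f i) powr p \<le> (\<Sum>i\<in>A. norm (f i) powr p)"
proof (induction A rule: infinite_finite_induct)
  case (insert i A)
  have "norm (f i + (\<Sum>i\<in>A. f i)) powr p \<le> (norm (f i) + norm (\<Sum>i\<in>A. f i)) powr p"
    using assms by (intro powr_mono2 norm_triangle_ineq) auto
  also have "\<dots> \<le> norm (f i) powr p + norm (\<Sum>i\<in>A. f i) powr p"
    using assms by (intro powr_add_le) auto
  finally show ?case using insert by simp
qed (use assms in auto)

lemma norm_sq_sum_orthogonal:
  fixes f :: "'i \<Rightarrow> 'a \<Rightarrow> complex"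
  assumes "finite I"
    and orth: "\<And>i j. i \<in> I \<Longrightarrow> j \<in> I \<Longrightarrow> i \<noteq> j \<Longrightarrow> (\<Sum>x\<in>X. f i x * cnj (f j x)) = 0"
  shows "(\<Sum>x\<in>X. (cmod (\<Sum>i\<in>I. f i x))\<^sup>2) = (\<Sum>i\<in>I. \<Sum>x\<in>X. (cmod (f i x))\<^sup>2)"
proof -
  have "complex_of_real (\<Sum>x\<in>X. (cmod (\<Sum>i\<in>I. f i x))\<^sup>2)
      = (\<Sum>x\<in>X. (\<Sum>i\<in>I. f i x) * cnj (\<Sum>j\<in>I. f j x))"
    unfolding of_real_sum by (intro sum.cong refl complex_norm_square)
  also have "\<dots> = (\<Sum>x\<in>X. \<Sum>i\<in>I. \<Sum>j\<in>I. f i x * cnj (f j x))"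
    by (simp add: sum_product)
  also have "\<dots> = (\<Sum>i\<in>I. \<Sum>x\<in>X. \<Sum>j\<in>I. f i x * cnj (f j x))"
    by (rule sum.swap)
  also have "\<dots> = (\<Sum>i\<in>I. \<Sum>j\<in>I. \<Sum>x\<in>X. f i x * cnj (f j x))"
    by (intro sum.cong refl sum.swap)
  also have "\<dots> = (\<Sum>i\<in>I. \<Sum>x\<in>X. f i x * cnj (f i x))"
  proof (rule sum.cong[OF refl])
    fix i assume i: "i \<in> I"
    have "(\<Sum>j\<in>I. \<Sum>x\<in>X. f i x * cnj (f j x))
        = (\<Sum>j\<in>I. if j = i then \<Sum>x\<in>X. f i x * cnj (f i x) else 0)"
      using orth i by (intro sum.cong) auto
    then show "(\<Sum>j\<in>I. \<Sum>x\<in>X. f i x * cnj (f j x)) = (\<Sum>x\<in>X. f i x * cnj (f i x))"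
      using i \<open>finite I\<close> by simp
  qed
  also have "\<dots> = complex_of_real (\<Sum>i\<in>I. \<Sum>x\<in>X. (cmod (f i x))\<^sup>2)"
    unfolding of_real_sum by (intro sum.cong refl complex_norm_square[symmetric])
  finally show ?thesis using of_real_eq_iff by blast
qed

section \<open>Cells of a product of filtrations and the strong maximal bound\<close>

text \<open>
  A finite product set whose factors carry a filtration each: \<open>addr d j s\<close> names the cell of generation \<open>j\<close>
  in direction \<open>d\<close> that contains \<open>s\<close>. Measure is counting measure.
\<close>
locale product_cells =
  fixes Y :: "'d::finite \<Rightarrow> 'b set" and addr :: "'d \<Rightarrow> nat \<Rightarrow> 'b \<Rightarrow> 'c"
  assumes finite_Y: "finite (Y d)"
    and refine_Suc: "addr d (Suc j) s = addr d (Suc j) t \<Longrightarrow> addr d j s = addr d j t"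
begin

definition points :: "('d \<Rightarrow> 'b) set" where
  "points = Pi UNIV Y"

text \<open>
  The directions outside \<open>E\<close> are frozen. This makes an induction over the set of directions
  possible; the cells of the product are the slices with \<open>E = UNIV\<close>.
\<close>
definition slice :: "'d set \<Rightarrow> ('d \<Rightarrow> nat) \<Rightarrow> ('d \<Rightarrow> 'b) \<Rightarrow> ('d \<Rightarrow> 'b) set" where
  "slice E n x = {y \<in> points. (\<forall>d\<in>E. addr d (n d) (y d) = addr d (n d) (x d)) \<and> (\<forall>d. d \<notin> E \<longrightarrow> y d = x d)}"

abbreviation "cell \<equiv> slice UNIV"

lemma finite_points: "finite points"
  unfolding points_def PiE_UNIV_domain[symmetric] by (intro finite_PiE finite_Y) auto

lemma slice_subset: "slice E n x \<subseteq> points"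
  by (auto simp: slice_def)

lemma finite_slice: "finite (slice E n x)"
  by (rule finite_subset[OF slice_subset finite_points])

lemma slice_self: "x \<in> points \<Longrightarrow> x \<in> slice E n x"
  by (simp add: slice_def)

lemma slice_eq: "y \<in> slice E n x \<Longrightarrow> slice E n y = slice E n x"
  by (auto simp: slice_def)

lemma card_slice_pos: "x \<in> points \<Longrightarrow> 0 < card (slice E n x)"
  using slice_self finite_slice card_gt_0_iff by blast

lemma refine:
  assumes "i \<le> j" "addr d j s = addr d j t"
  shows "addr d i s = addr d i t"
  using assms by (induction j rule: dec_induct) (auto dest: refine_Suc)

lemma slice_antimono: "(\<And>d. n d \<le> n' d) \<Longrightarrow> slice E n' x \<subseteq> slice E n x"
  unfolding slice_def using refine by blast

definition dense :: "'d set \<Rightarrow> real \<Rightarrow> ('d \<Rightarrow> 'b) set \<Rightarrow> ('d \<Rightarrow> nat) \<Rightarrow> ('d \<Rightarrow> 'b) \<Rightarrow> bool" where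
  "dense E \<theta> W n x \<longleftrightarrow> \<theta> * card (slice E n x) \<le> card (slice E n x \<inter> W)"

text \<open>
  The set where the maximal function of the indicator of \<open>W\<close>, taken over the slices in the directions \<open>E\<close>, is at
  least \<open>\<theta>\<close>.
\<close>
definition halo :: "'d set \<Rightarrow> real \<Rightarrow> ('d \<Rightarrow> 'b) set \<Rightarrow> ('d \<Rightarrow> 'b) set" where
  "halo E \<theta> W = {x \<in> points. \<exists>n. dense E \<theta> W n x}"

lemma finite_halo: "finite (halo E \<theta> W)"
  unfolding halo_def using finite_points by simp

text \<open>
  In one direction the cells are nested, so the maximal cells in which \<open>W\<close> has density at
  least \<open>\<theta>\<close> are disjoint, and they cover the halo. Here \<open>J x\<close> is the generation of the maximal cell
  around \<open>x\<close>.
\<close>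
lemma card_halo_single:
  assumes W: "W \<subseteq> points"
  shows "\<theta> * card (halo {e} \<theta> W) \<le> card W"
proof -
  define D where "D j x \<longleftrightarrow> dense {e} \<theta> W (\<lambda>_. j) x" for j x
  define J where "J x = (LEAST j. D j x)" for x
  let ?U = "halo {e} \<theta> W"
  let ?c = "\<lambda>x. slice {e} (\<lambda>_. J x) x"
  have single: "slice {e} n x = slice {e} (\<lambda>_. n e) x" for n x
    by (simp add: slice_def)
  have U_D: "x \<in> ?U \<longleftrightarrow> x \<in> points \<and> (\<exists>j. D j x)" for x
    unfolding halo_def D_def dense_def mem_Collect_eq by (metis single)
  have DJ: "D (J x) x" if "x \<in> ?U" for x
    unfolding J_def using that U_D LeastI_ex[of "\<lambda>j. D j x"] by blast
  have same: "J y = J x" "y \<in> ?U" if x: "x \<in> ?U" and y: "y \<in> ?c x" for x y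
  proof -
    have y': "y \<in> points" using y slice_subset by blast
    have D_eq: "D j y = D j x" if "j \<le> J x" for j
    proof -
      have "y \<in> slice {e} (\<lambda>_. j) x" using y slice_antimono[of "\<lambda>_. j" "\<lambda>_. J x"] that by blast
      then show ?thesis by (simp add: D_def dense_def slice_eq)
    qed
    have "D (J x) y" using D_eq DJ[OF x] by simp
    then show "y \<in> ?U" using U_D y' by blast
    show "J y = J x"
      unfolding J_def[of y]
    proof (rule Least_equality)
      show "D (J x) y" by fact
      fix j assume "D j y"
      then show "J x \<le> j" using D_eq[of j] unfolding J_def by (metis Least_le linorder_le_cases)
    qed
  qed
  have "(\<Sum>x\<in>?U. \<theta>) \<le> (\<Sum>x\<in>?U. if x \<in> W then 1 else 0)"
  proof (rule sum_le_by_cells[where cell = ?c])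
    show "finite ?U" by (rule finite_halo)
    show "x \<in> ?c x" if "x \<in> ?U" for x using that by (auto simp: halo_def slice_self)
    show "?c x \<subseteq> ?U" if "x \<in> ?U" for x using same(2)[OF that] by blast
    show "?c y = ?c x" if "x \<in> ?U" "y \<in> ?c x" for x y
      using slice_eq[OF that(2)] same(1)[OF that] by simp
    show "(\<Sum>y\<in>?c x. \<theta>) \<le> (\<Sum>y\<in>?c x. if y \<in> W then 1 else 0)" if "x \<in> ?U" for x
      using DJ[OF that] by (simp add: D_def dense_def sum.If_cases finite_slice Int_def mult.commute)
  qed
  also have "\<dots> \<le> card W"
    using card_mono[OF finite_subset[OF W finite_points], of "?U \<inter> W"]
    by (simp add: sum.If_cases finite_halo)
  finally show ?thesis by (simp add: mult.commute)
qed

lemma slice_insert: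
  assumes "e \<notin> E" "x \<in> points"
  shows "slice (insert e E) n x = (\<Union>z\<in>slice E n x. slice {e} n z)"
proof (intro set_eqI iffI)
  fix y assume y: "y \<in> slice (insert e E) n x"
  have "y(e := x e) \<in> slice E n x" using y assms by (auto simp: slice_def points_def Pi_iff)
  moreover have "y \<in> slice {e} n (y(e := x e))" using y by (auto simp: slice_def)
  ultimately show "y \<in> (\<Union>z\<in>slice E n x. slice {e} n z)" by blast
next
  fix y assume "y \<in> (\<Union>z\<in>slice E n x. slice {e} n z)"
  then obtain z where z: "z \<in> slice E n x" "y \<in> slice {e} n z" by blast
  have "y d = z d" if "d \<noteq> e" for d using z that by (auto simp: slice_def)
  moreover have "d \<noteq> e" if "d \<in> E" for d using that assms(1) by blast
  ultimately show "y \<in> slice (insert e E) n x"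
    using z assms by (auto simp: slice_def)
qed

lemma card_slice_single:
  assumes "x \<in> points"
  shows "card (slice {e} n x) = card {b \<in> Y e. addr e (n e) b = addr e (n e) (x e)}"
proof -
  have "bij_betw (\<lambda>b. x(e := b)) {b \<in> Y e. addr e (n e) b = addr e (n e) (x e)} (slice {e} n x)"
  proof (rule bij_betwI[where g = "\<lambda>y. y e"])
    show "(\<lambda>b. x(e := b)) \<in> {b \<in> Y e. addr e (n e) b = addr e (n e) (x e)} \<rightarrow> slice {e} n x"
      using assms by (auto simp: slice_def points_def Pi_iff)
    show "(\<lambda>y. y e) \<in> slice {e} n x \<rightarrow> {b \<in> Y e. addr e (n e) b = addr e (n e) (x e)}"
      by (auto simp: slice_def points_def Pi_iff)
    show "x(e := y e) = y" if "y \<in> slice {e} n x" for y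
      using that by (auto simp: slice_def)
  qed auto
  then show ?thesis by (rule bij_betw_same_card[symmetric])
qed

text \<open>
  If \<open>W\<close> has density at least \<open>\<theta>\<close> in a slice, then the lines in direction \<open>e\<close> on which the
  density is at least \<open>\<theta> / 2\<close> make up a proportion at least \<open>\<theta> / 2\<close> of all lines, since the other lines
  contribute less than \<open>\<theta> / 2\<close>. This iterates the maximal operators of single directions at the
  level of sets.
\<close>
lemma halo_insert_subset:
  assumes e: "e \<notin> E" and \<theta>: "0 < \<theta>"
  shows "halo (insert e E) \<theta> W \<subseteq> halo E (\<theta> / 2) (halo {e} (\<theta> / 2) W)"
proof
  fix x assume "x \<in> halo (insert e E) \<theta> W"
  then obtain n where x: "x \<in> points" and d: "dense (insert e E) \<theta> W n x" by (auto simp: halo_def)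
  define B where "B = slice E n x"
  define V where "V = halo {e} (\<theta> / 2) W"
  define L where "L = card {b \<in> Y e. addr e (n e) b = addr e (n e) (x e)}"
  have finB: "finite B" by (simp add: B_def finite_slice)
  have ze: "z \<in> points" "z e = x e" if "z \<in> B" for z using that e by (auto simp: B_def slice_def)
  have cardL: "card (slice {e} n z) = L" if "z \<in> B" for z
    using card_slice_single[OF ze(1)[OF that]] ze(2)[OF that] by (simp add: L_def)
  have disj: "slice {e} n z \<inter> slice {e} n z' = {}" if "z \<in> B" "z' \<in> B" "z \<noteq> z'" for z z'
  proof (rule ccontr)
    assume "slice {e} n z \<inter> slice {e} n z' \<noteq> {}"
    then obtain y where "y \<in> slice {e} n z" "y \<in> slice {e} n z'" by blast
    then have "z d = z' d" if "d \<noteq> e" for d using that by (auto simp: slice_def)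
    then have "z = z'" using ze(2)[OF \<open>z \<in> B\<close>] ze(2)[OF \<open>z' \<in> B\<close>] by (metis ext)
    then show False using that by blast
  qed
  have "L > 0" using cardL[of x] card_slice_pos[OF x, of "{e}" n] slice_self[OF x] by (simp add: B_def)
  have split: "slice (insert e E) n x = (\<Union>z\<in>B. slice {e} n z)"
    using slice_insert[OF e x] by (simp add: B_def)
  have c1: "card (slice (insert e E) n x) = card B * L"
    unfolding split using disj by (subst card_UN_disjoint) (auto simp: finB finite_slice cardL)
  have "card (slice (insert e E) n x \<inter> W) = card (\<Union>z\<in>B. slice {e} n z \<inter> W)"
    unfolding split by (rule arg_cong[where f = card]) blast
  also have "\<dots> = (\<Sum>z\<in>B. card (slice {e} n z \<inter> W))"
    using disj by (intro card_UN_disjoint) (auto simp: finB finite_slice)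
  finally have c2: "real (card (slice (insert e E) n x \<inter> W)) = (\<Sum>z\<in>B. real (card (slice {e} n z \<inter> W)))"
    by simp
  have "(\<Sum>z\<in>B. real (card (slice {e} n z \<inter> W))) \<le> (\<Sum>z\<in>B. \<theta> / 2 * L + (if z \<in> V then real L else 0))"
  proof (rule sum_mono)
    fix z assume z: "z \<in> B"
    show "real (card (slice {e} n z \<inter> W)) \<le> \<theta> / 2 * L + (if z \<in> V then real L else 0)"
    proof (cases "z \<in> V")
      case True
      have "card (slice {e} n z \<inter> W) \<le> L"
        using card_mono[OF finite_slice, of "slice {e} n z \<inter> W" "{e}" n z] cardL[OF z] by simp
      then show ?thesis using True \<theta> by (simp add: add_increasing)
    next
      case False
      then have "\<not> dense {e} (\<theta> / 2) W n z" using ze[OF z] by (auto simp: V_def halo_def)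
      then show ?thesis using False cardL[OF z] by (simp add: dense_def)
    qed
  qed
  also have "\<dots> = \<theta> / 2 * (card B * L) + card (B \<inter> V) * L"
    by (simp add: sum.distrib sum.If_cases finB)
  finally have "\<theta> * (card B * L) \<le> \<theta> / 2 * (card B * L) + card (B \<inter> V) * L"
    using d unfolding dense_def c1 c2 by simp
  then have "(\<theta> / 2 * card B) * L \<le> card (B \<inter> V) * L" by (simp add: field_simps)
  then have "\<theta> / 2 * card B \<le> card (B \<inter> V)" using \<open>L > 0\<close> by simp
  then show "x \<in> halo E (\<theta> / 2) (halo {e} (\<theta> / 2) W)"
    using x unfolding halo_def[of E] dense_def B_def V_def by blast
qed

text \<open>
  Each direction costs a factor \<open>2 / \<theta>\<close>, and the density threshold is halved before the next one.
\<close>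
lemma card_halo:
  assumes "0 < \<theta>" "\<theta> \<le> 1" "W \<subseteq> points"
  shows "card (halo E \<theta> W) \<le> (2 ^ card E / \<theta>) ^ card E * card W"
  using finite[of E] assms
proof (induction E arbitrary: \<theta> W rule: finite_induct)
  case empty
  have "halo {} \<theta> W \<subseteq> W"
  proof
    fix x assume "x \<in> halo {} \<theta> W"
    then obtain n where x: "x \<in> points" "dense {} \<theta> W n x" by (auto simp: halo_def)
    have "slice {} n x = {x}" using x(1) by (auto simp: slice_def)
    then show "x \<in> W" using x(2) empty(1) by (cases "x \<in> W") (auto simp: dense_def)
  qed
  then show ?case using card_mono[OF finite_subset[OF empty(3) finite_points]] by simp
next
  case (insert e E)
  let ?r = "card E" and ?V = "halo {e} (\<theta> / 2) W"
  have "card (halo (insert e E) \<theta> W) \<le> card (halo E (\<theta> / 2) ?V)"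
    using halo_insert_subset[OF insert(2,4)] by (intro card_mono finite_halo)
  then have "real (card (halo (insert e E) \<theta> W)) \<le> real (card (halo E (\<theta> / 2) ?V))" by simp
  also have "\<dots> \<le> (2 ^ ?r / (\<theta> / 2)) ^ ?r * card ?V"
    using insert(4,5) by (intro insert.IH) (auto simp: halo_def)
  also have "\<dots> \<le> (2 ^ Suc ?r / \<theta>) ^ ?r * (2 ^ Suc ?r / \<theta> * card W)"
  proof (intro mult_mono)
    have "real (card ?V) \<le> 2 / \<theta> * card W"
      using card_halo_single[OF insert(6), of "\<theta> / 2" e] insert(4) by (simp add: field_simps)
    also have "\<dots> \<le> 2 ^ Suc ?r / \<theta> * card W"
      using insert(4) by (intro mult_right_mono divide_right_mono) auto
    finally show "real (card ?V) \<le> 2 ^ Suc ?r / \<theta> * card W" .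
  qed (use insert(4) in \<open>auto simp: mult.commute\<close>)
  finally show ?case using insert by (simp add: mult_ac)
qed

section \<open>Atomic decomposition by level sets of the square function\<close>

text \<open>
  An abstract form of the inequality. The functions \<open>G i\<close> play the role of martingale differences
  of generation \<open>lev i\<close>, and \<open>F i\<close> that of a local transform of \<open>G i\<close>: it does not increase the energy on
  cells of the preceding generation, and different \<open>F i\<close> remain orthogonal on every intersection
  of such cells. Locality is what keeps each layer of the decomposition inside the halo of its level set.
\<close>
theorem square_function_bound:
  fixes I :: "'i set" and lev :: "'i \<Rightarrow> 'd \<Rightarrow> nat" and F G :: "'i \<Rightarrow> ('d \<Rightarrow> 'b) \<Rightarrow> complex"
    and p B :: real
  defines "lev' \<equiv> (\<lambda>i d. lev i d - 1)"
  assumes I: "finite I" and p: "0 < p" "p \<le> 1" and B: "1 \<le> B"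
    and regular: "\<And>i x. i \<in> I \<Longrightarrow> x \<in> points \<Longrightarrow> card (cell (lev' i) x) \<le> B * card (cell (lev i) x)"
    and const: "\<And>i x y. i \<in> I \<Longrightarrow> x \<in> points \<Longrightarrow> y \<in> cell (lev i) x \<Longrightarrow> cmod (G i y) = cmod (G i x)"
    and dominated: "\<And>i x. i \<in> I \<Longrightarrow> x \<in> points \<Longrightarrow>
       (\<Sum>y\<in>cell (lev' i) x. (cmod (F i y))\<^sup>2) \<le> (\<Sum>y\<in>cell (lev' i) x. (cmod (G i y))\<^sup>2)"
    and orth: "\<And>i j x. i \<in> I \<Longrightarrow> j \<in> I \<Longrightarrow> i \<noteq> j \<Longrightarrow> x \<in> points \<Longrightarrow>
       (\<Sum>y\<in>cell (\<lambda>d. max (lev' i d) (lev' j d)) x. F i y * cnj (F j y)) = 0"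
  shows "(\<Sum>x\<in>points. cmod (\<Sum>i\<in>I. F i x) powr p)
     \<le> 9 * (2 ^ CARD('d) * (2 * B)) ^ CARD('d) / (1 - 2 powr - p)
        * (\<Sum>x\<in>points. (\<Sum>i\<in>I. (cmod (G i x))\<^sup>2) powr (p / 2))"
proof -
  define \<theta> where "\<theta> = 1 / (2 * B)"
  have \<theta>: "0 < \<theta>" "\<theta> \<le> 1" using B by (simp_all add: \<theta>_def)
  define s where "s x = sqrt (\<Sum>i\<in>I. (cmod (G i x))\<^sup>2)" for x
  have s_nonneg: "0 \<le> s x" for x by (simp add: s_def sum_nonneg)
  have s_sq: "(s x)\<^sup>2 = (\<Sum>i\<in>I. (cmod (G i x))\<^sup>2)" for x by (simp add: s_def sum_nonneg)
  have s_powr: "(\<Sum>i\<in>I. (cmod (G i x))\<^sup>2) powr (p / 2) = s x powr p" for x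
    by (simp add: s_def sum_nonneg powr_half_sqrt[symmetric] powr_powr)
  obtain \<epsilon> where \<epsilon>: "0 < \<epsilon>" and \<epsilon>_less: "\<And>x. x \<in> points \<Longrightarrow> 0 < s x \<Longrightarrow> \<epsilon> < s x"
  proof -
    let ?T = "insert 1 (s ` {x \<in> points. 0 < s x})"
    have fin: "finite ?T" using finite_points by simp
    have "0 < Min ?T" using fin by (subst Min_gr_iff) auto
    moreover have "Min ?T \<le> s x" if "x \<in> points" "0 < s x" for x
      using fin that by (intro Min_le) auto
    ultimately show ?thesis by (intro that[of "Min ?T / 2"]) fastforce+
  qed
  define lam where "lam i = \<epsilon> * 2 ^ i" for i :: nat
  have lam_pos: "0 < lam i" for i using \<epsilon> by (simp add: lam_def)
  have lam_mono: "lam i \<le> lam j" if "i \<le> j" for i j using \<epsilon> that by (simp add: lam_def)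
  define W where "W i = {x \<in> points. lam i < s x}" for i
  have W_sub: "W i \<subseteq> points" for i by (auto simp: W_def)
  \<comment> \<open>The square function takes finitely many values, so finitely many levels cover it.\<close>
  obtain L where L: "W L = {}"
  proof -
    define Mx where "Mx = (\<Sum>x\<in>points. s x)"
    obtain L where "Mx / \<epsilon> < 2 ^ L" using real_arch_pow[of 2 "Mx / \<epsilon>"] by auto
    then have "Mx < lam L" using \<epsilon> by (simp add: lam_def field_simps)
    moreover have "s x \<le> Mx" if "x \<in> points" for x
      unfolding Mx_def using that finite_points s_nonneg by (intro member_le_sum) auto
    ultimately have "W L = {}" by (force simp: W_def)
    then show ?thesis by (rule that)
  qed
  define dns where "dns u i x \<longleftrightarrow> dense UNIV \<theta> (W i) (lev' u) x" for u i x
  have dns_mono: "dns u i x" if "dns u j x" "i \<le> j" for u i j x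
  proof -
    have "W j \<subseteq> W i" using lam_mono[OF that(2)] by (auto simp: W_def)
    then have "card (cell (lev' u) x \<inter> W j) \<le> card (cell (lev' u) x \<inter> W i)"
      by (intro card_mono) (auto simp: finite_slice)
    then show ?thesis using that(1) unfolding dns_def dense_def by linarith
  qed
  have not_dns_L: "\<not> dns u L x" if "x \<in> points" for u x
    using card_slice_pos[OF that, of UNIV "lev' u"] \<theta>(1) by (auto simp: dns_def dense_def L not_le)
  define A where "A u i = {x \<in> points. dns u i x \<and> \<not> dns u (Suc i) x}" for u i
  have finA: "finite (A u i)" for u i using finite_points by (simp add: A_def)
  have A_cell: "y \<in> A u i" if "x \<in> A u i" "y \<in> cell (lev' u) x" for x y u i
    using that(1) slice_eq[OF that(2)] subsetD[OF slice_subset that(2)]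
    by (auto simp: A_def dns_def dense_def)
  have A_halo: "A u i \<subseteq> halo UNIV \<theta> (W i)" for u i
    by (auto simp: A_def dns_def halo_def)
  have child: "cell (lev u) x \<subseteq> cell (lev' u) x" for u x
    by (rule slice_antimono) (simp add: lev'_def)
  \<comment> \<open>The density threshold is chosen so that a sparse parent cell leaves each of its children at most half full.\<close>
  have few: "2 * card (cell (lev u) x \<inter> W i) < card (cell (lev u) x)"
    if "u \<in> I" "x \<in> points" "\<not> dns u i x" for u x i
  proof -
    have "card (cell (lev u) x \<inter> W i) \<le> card (cell (lev' u) x \<inter> W i)"
      using child by (intro card_mono) (auto simp: finite_slice)
    then have "real (card (cell (lev u) x \<inter> W i)) \<le> card (cell (lev' u) x \<inter> W i)"
      by simp
    also have "\<dots> < \<theta> * card (cell (lev' u) x)" using that by (simp add: dns_def dense_def)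
    also have "\<dots> \<le> \<theta> * (B * card (cell (lev u) x))"
      using regular[OF that(1,2)] \<theta> by (intro mult_left_mono) auto
    also have "\<dots> = card (cell (lev u) x) / 2" using B by (simp add: \<theta>_def)
    finally show ?thesis by simp
  qed
  have G_le_s: "cmod (G u x) \<le> s x" if "u \<in> I" for u x
    unfolding s_def using that I by (intro real_le_rsqrt member_le_sum) auto
  have F_zero: "F u x = 0" if u: "u \<in> I" and x: "x \<in> points" and nd: "\<not> dns u 0 x" for u x
  proof -
    have G0: "G u y = 0" if y: "y \<in> cell (lev' u) x" for y
    proof -
      have y': "y \<in> points" using y slice_subset by blast
      have "\<not> dns u 0 y" using nd slice_eq[OF y] by (simp add: dns_def dense_def)
      from few[OF u y' this] have "cell (lev u) y \<inter> W 0 \<noteq> cell (lev u) y" by auto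
      then obtain z where z: "z \<in> cell (lev u) y" "z \<notin> W 0" by blast
      then have "z \<in> points" using slice_subset by blast
      then have "s z = 0" using z(2) \<epsilon>_less[of z] s_nonneg[of z] by (force simp: W_def lam_def)
      then have "cmod (G u z) = 0" using G_le_s[OF u, of z] by simp
      then show "G u y = 0" using const[OF u y' z(1)] by simp
    qed
    have "(\<Sum>y\<in>cell (lev' u) x. (cmod (F u y))\<^sup>2) \<le> 0"
      using dominated[OF u x] G0 by simp
    then have "(\<Sum>y\<in>cell (lev' u) x. (cmod (F u y))\<^sup>2) = 0" by (simp add: order.antisym sum_nonneg)
    then show ?thesis
      using slice_self[OF x] by (subst (asm) sum_nonneg_eq_0_iff) (auto simp: finite_slice)
  qed
  \<comment> \<open>The layer \<open>i\<close> of the piece \<open>F u\<close>.\<close>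
  define f where "f i u x = (if x \<in> A u i then F u x else 0)" for i u x
  have F_split: "F u x = (\<Sum>i<L. f i u x)" if u: "u \<in> I" and x: "x \<in> points" for u x
  proof -
    \<comment> \<open>The indicators of the layers telescope because density decreases with the level.\<close>
    have "f i u x = (of_bool (dns u i x) - of_bool (dns u (Suc i) x)) * F u x" for i
      using dns_mono[of u "Suc i" x i] x by (auto simp: f_def A_def)
    then have "(\<Sum>i<L. f i u x) = (of_bool (dns u 0 x) - of_bool (dns u L x)) * F u x"
      using sum_lessThan_telescope'[of "\<lambda>i. of_bool (dns u i x) :: complex" L]
      by (simp only: sum_distrib_right[symmetric])
    also have "\<dots> = F u x" using F_zero[OF u x] not_dns_L[OF x] by auto
    finally show ?thesis by simp
  qed
  let ?H = "\<lambda>i. halo UNIV \<theta> (W i)"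
  have energy: "(\<Sum>x\<in>points. (cmod (\<Sum>u\<in>I. f i u x))\<^sup>2) \<le> 8 * (lam i)\<^sup>2 * card (?H i)" for i
  proof -
    have "(\<Sum>x\<in>points. (cmod (\<Sum>u\<in>I. f i u x))\<^sup>2) = (\<Sum>u\<in>I. \<Sum>x\<in>points. (cmod (f i u x))\<^sup>2)"
    proof (rule norm_sq_sum_orthogonal[OF I])
      fix u v assume uv: "u \<in> I" "v \<in> I" "u \<noteq> v"
      let ?n = "\<lambda>d. max (lev' u d) (lev' v d)"
      have "(\<Sum>x\<in>points. f i u x * cnj (f i v x)) = (\<Sum>x\<in>A u i \<inter> A v i. F u x * cnj (F v x))"
        unfolding f_def using finite_points
        by (intro sum.mono_neutral_cong_right) (auto simp: A_def)
      also have "\<dots> = (\<Sum>Q\<in>cell ?n ` (A u i \<inter> A v i). \<Sum>x\<in>Q. F u x * cnj (F v x))"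
      proof (rule sum_by_cells)
        show "finite (A u i \<inter> A v i)" using finA by blast
        show "x \<in> cell ?n x" if "x \<in> A u i \<inter> A v i" for x
          using that by (intro slice_self) (auto simp: A_def)
        show "cell ?n x \<subseteq> A u i \<inter> A v i" if x: "x \<in> A u i \<inter> A v i" for x
        proof
          fix y assume y: "y \<in> cell ?n x"
          have "y \<in> cell (lev' u) x" "y \<in> cell (lev' v) x"
            using slice_antimono[of "lev' u" ?n UNIV x] slice_antimono[of "lev' v" ?n UNIV x] y by auto
          then show "y \<in> A u i \<inter> A v i" using A_cell x by blast
        qed
      qed (rule slice_eq)
      also have "\<dots> = 0" using orth[OF uv] by (intro sum.neutral) (auto simp: A_def)
      finally show "(\<Sum>x\<in>points. f i u x * cnj (f i v x)) = 0" .
    qed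
    also have "\<dots> = (\<Sum>u\<in>I. \<Sum>x\<in>A u i. (cmod (F u x))\<^sup>2)"
      unfolding f_def using finite_points
      by (intro sum.cong refl sum.mono_neutral_cong_right) (auto simp: A_def)
    also have "\<dots> \<le> (\<Sum>u\<in>I. \<Sum>x\<in>A u i. (cmod (G u x))\<^sup>2)"
    proof (rule sum_mono, rule sum_le_by_cells[where cell = "cell (lev' u)" for u])
      fix u x assume u: "u \<in> I" and x: "x \<in> A u i"
      then have x': "x \<in> points" by (simp add: A_def)
      show "x \<in> cell (lev' u) x" using x' by (rule slice_self)
      show "cell (lev' u) x \<subseteq> A u i" using A_cell[OF x] by blast
      show "(\<Sum>x\<in>cell (lev' u) x. (cmod (F u x))\<^sup>2) \<le> (\<Sum>x\<in>cell (lev' u) x. (cmod (G u x))\<^sup>2)"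
        by (rule dominated[OF u x'])
    qed (simp_all only: finA slice_eq)
    \<comment> \<open>Since \<open>G u\<close> has constant modulus on the children, the half of each child outside the next level set carries at least half of the energy.\<close>
    also have "\<dots> \<le> (\<Sum>u\<in>I. \<Sum>x\<in>A u i. if x \<in> W (Suc i) then 0 else 2 * (cmod (G u x))\<^sup>2)"
    proof (rule sum_mono, rule sum_le_by_cells[where cell = "cell (lev u)" for u])
      fix u x assume u: "u \<in> I" and x: "x \<in> A u i"
      let ?Q = "cell (lev u) x"
      have x': "x \<in> points" using x by (simp add: A_def)
      show "x \<in> ?Q" using x' by (rule slice_self)
      show "?Q \<subseteq> A u i" using A_cell[OF x] child by blast
      have "2 * card (?Q \<inter> W (Suc i)) < card ?Q" using x by (intro few u x') (simp add: A_def)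
      moreover have "card ?Q = card (?Q \<inter> W (Suc i)) + card (?Q \<inter> - W (Suc i))"
        using card_Un_disjoint[of "?Q \<inter> W (Suc i)" "?Q \<inter> - W (Suc i)"]
        by (simp add: finite_slice Int_Un_distrib[symmetric] disjoint_iff)
      ultimately have *: "card ?Q \<le> 2 * card (?Q \<inter> - W (Suc i))" by linarith
      then have *: "real (card ?Q) \<le> 2 * real (card (?Q \<inter> - W (Suc i)))" by linarith
      have "(\<Sum>y\<in>?Q. (cmod (G u y))\<^sup>2) = (\<Sum>y\<in>?Q. (cmod (G u x))\<^sup>2)"
        using const[OF u x'] by (intro sum.cong) auto
      also have "\<dots> \<le> (2 * card (?Q \<inter> - W (Suc i))) * (cmod (G u x))\<^sup>2"
        using * by (simp add: mult_right_mono)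
      also have "\<dots> = (\<Sum>y\<in>?Q. if y \<in> W (Suc i) then 0 else 2 * (cmod (G u x))\<^sup>2)"
        by (simp add: sum.If_cases finite_slice Compl_eq)
      also have "\<dots> = (\<Sum>y\<in>?Q. if y \<in> W (Suc i) then 0 else 2 * (cmod (G u y))\<^sup>2)"
        using const[OF u x'] by (intro sum.cong) auto
      finally show "(\<Sum>y\<in>?Q. (cmod (G u y))\<^sup>2)
        \<le> (\<Sum>y\<in>?Q. if y \<in> W (Suc i) then 0 else 2 * (cmod (G u y))\<^sup>2)" .
    qed (simp_all only: finA slice_eq)
    also have "\<dots> \<le> (\<Sum>u\<in>I. \<Sum>x\<in>?H i. if x \<in> W (Suc i) then 0 else 2 * (cmod (G u x))\<^sup>2)"
      by (intro sum_mono sum_mono2 finite_halo A_halo) auto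
    also have "\<dots> = (\<Sum>x\<in>?H i. \<Sum>u\<in>I. if x \<in> W (Suc i) then 0 else 2 * (cmod (G u x))\<^sup>2)"
      by (rule sum.swap)
    also have "\<dots> \<le> (\<Sum>x\<in>?H i. 8 * (lam i)\<^sup>2)"
    proof (rule sum_mono)
      fix x assume x: "x \<in> ?H i"
      show "(\<Sum>u\<in>I. if x \<in> W (Suc i) then 0 else 2 * (cmod (G u x))\<^sup>2) \<le> 8 * (lam i)\<^sup>2"
      proof (cases "x \<in> W (Suc i)")
        case False
        then have "s x \<le> 2 * lam i" using x by (auto simp: W_def halo_def lam_def)
        then have "(s x)\<^sup>2 \<le> (2 * lam i)\<^sup>2" using s_nonneg by (intro power_mono)
        then show ?thesis using False by (simp add: sum_distrib_left[symmetric] s_sq[symmetric] power_mult_distrib)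
      qed simp
    qed
    finally show ?thesis by (simp add: mult.commute)
  qed
  define K where "K = (2 ^ CARD('d) * (2 * B)) ^ CARD('d)"
  have halo_le: "card (?H i) \<le> K * card (W i)" for i
    using card_halo[OF \<theta> W_sub, of UNIV i] by (simp add: K_def \<theta>_def)
  have "0 \<le> K" using B by (simp add: K_def)
  have layer: "(\<Sum>x\<in>points. cmod (\<Sum>u\<in>I. f i u x) powr p) \<le> 9 * K * (lam i powr p * card (W i))" for i
  proof -
    have "(\<Sum>x\<in>points. cmod (\<Sum>u\<in>I. f i u x) powr p) = (\<Sum>x\<in>?H i. cmod (\<Sum>u\<in>I. f i u x) powr p)"
    proof (rule sum.mono_neutral_right[OF finite_points])
      show "?H i \<subseteq> points" by (auto simp: halo_def)
      have "f i u x = 0" if "x \<notin> ?H i" for u x using A_halo that by (auto simp: f_def)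
      then show "\<forall>x\<in>points - ?H i. cmod (\<Sum>u\<in>I. f i u x) powr p = 0" by simp
    qed
    also have "\<dots> \<le> (\<Sum>x\<in>?H i. lam i powr p + lam i powr (p - 2) * (cmod (\<Sum>u\<in>I. f i u x))\<^sup>2)"
      using p lam_pos by (intro sum_mono powr_le_cutoff) auto
    also have "\<dots> = lam i powr p * card (?H i) + lam i powr (p - 2) * (\<Sum>x\<in>?H i. (cmod (\<Sum>u\<in>I. f i u x))\<^sup>2)"
      by (simp add: sum.distrib sum_distrib_left[symmetric])
    also have "\<dots> \<le> lam i powr p * card (?H i) + lam i powr (p - 2) * (8 * (lam i)\<^sup>2 * card (?H i))"
    proof (intro add_left_mono mult_left_mono)
      show "(\<Sum>x\<in>?H i. (cmod (\<Sum>u\<in>I. f i u x))\<^sup>2) \<le> 8 * (lam i)\<^sup>2 * card (?H i)"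
        by (rule order.trans[OF sum_mono2 energy]) (auto simp: finite_points halo_def)
    qed simp
    also have "lam i powr (p - 2) * (8 * (lam i)\<^sup>2 * card (?H i)) = 8 * (lam i powr (p - 2) * lam i powr 2) * card (?H i)"
      using lam_pos[of i] by simp
    also have "\<dots> = 8 * lam i powr p * card (?H i)" by (simp only: powr_add[symmetric]) simp
    also have "lam i powr p * card (?H i) + 8 * lam i powr p * card (?H i) = 9 * lam i powr p * card (?H i)" by simp
    also have "\<dots> \<le> 9 * lam i powr p * (K * card (W i))"
      by (intro mult_left_mono halo_le) simp
    finally show ?thesis by (simp add: mult_ac)
  qed
  define q where "q = 2 powr - p"
  have q: "0 < q" "q < 1" using p powr_less_mono[of "-p" 0 2] by (simp_all add: q_def)
  \<comment> \<open>A geometric sum: the largest level below \<open>t\<close> dominates.\<close>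
  have geom: "(\<Sum>i<L. if lam i < t then lam i powr p else 0) \<le> t powr p / (1 - q)" if "0 \<le> t" for t
  proof (induction L)
    case (Suc L)
    show ?case
    proof (cases "lam L < t")
      case True
      have lam_q: "lam i powr p = lam L powr p * q ^ (L - i)" if "i \<le> L" for i
      proof -
        have "lam L = lam i * 2 powr real (L - i)"
          using power_add[of "2 :: real" i "L - i"] powr_realpow[of 2 "L - i"] that by (simp add: lam_def del: of_nat_diff)
        then have "lam L powr p = lam i powr p * 2 powr (p * real (L - i))"
          using lam_pos[of i] by (simp add: powr_mult powr_powr mult.commute)
        moreover have "q ^ (L - i) = 2 powr (- (p * real (L - i)))"
          by (simp add: q_def powr_realpow[symmetric] powr_powr)
        ultimately show ?thesis by (simp add: powr_add[symmetric])
      qed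
      have "(\<Sum>i<Suc L. if lam i < t then lam i powr p else 0) \<le> (\<Sum>i<Suc L. lam L powr p * q ^ (L - i))"
        by (intro sum_mono) (auto simp: lam_q[symmetric])
      also have "\<dots> = lam L powr p * (\<Sum>i<Suc L. q ^ i)"
        using sum.nat_diff_reindex[of "\<lambda>i. q ^ i" "Suc L"] by (simp add: sum_distrib_left[symmetric])
      also have "\<dots> \<le> t powr p * (1 / (1 - q))"
      proof (intro mult_mono)
        show "lam L powr p \<le> t powr p" using True lam_pos[of L] p by (intro powr_mono2) auto
        have "(\<Sum>i<Suc L. q ^ i) = (1 - q ^ Suc L) / (1 - q)" using q by (subst sum_gp_strict) auto
        also have "\<dots> \<le> 1 / (1 - q)" using q by (intro divide_right_mono) auto
        finally show "(\<Sum>i<Suc L. q ^ i) \<le> 1 / (1 - q)" .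
      qed (use q in \<open>auto intro!: sum_nonneg add_nonneg_nonneg\<close>)
      finally show ?thesis by simp
    next
      case False
      then show ?thesis using Suc by simp
    qed
  qed (use q in auto)
  have "(\<Sum>x\<in>points. cmod (\<Sum>u\<in>I. F u x) powr p) = (\<Sum>x\<in>points. cmod (\<Sum>i<L. \<Sum>u\<in>I. f i u x) powr p)"
  proof (rule sum.cong[OF refl])
    fix x assume x: "x \<in> points"
    have "(\<Sum>u\<in>I. F u x) = (\<Sum>u\<in>I. \<Sum>i<L. f i u x)" using x by (intro sum.cong F_split) auto
    also have "\<dots> = (\<Sum>i<L. \<Sum>u\<in>I. f i u x)" by (rule sum.swap)
    finally show "cmod (\<Sum>u\<in>I. F u x) powr p = cmod (\<Sum>i<L. \<Sum>u\<in>I. f i u x) powr p" by simp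
  qed
  also have "\<dots> \<le> (\<Sum>x\<in>points. \<Sum>i<L. cmod (\<Sum>u\<in>I. f i u x) powr p)"
    by (intro sum_mono norm_sum_powr_le p)
  also have "\<dots> = (\<Sum>i<L. \<Sum>x\<in>points. cmod (\<Sum>u\<in>I. f i u x) powr p)" by (rule sum.swap)
  also have "\<dots> \<le> (\<Sum>i<L. 9 * K * (lam i powr p * card (W i)))" by (intro sum_mono layer)
  also have "\<dots> = 9 * K * (\<Sum>i<L. \<Sum>x\<in>points. if lam i < s x then lam i powr p else 0)"
    by (simp add: sum_distrib_left sum.If_cases finite_points W_def Int_def mult_ac)
  also have "(\<Sum>i<L. \<Sum>x\<in>points. if lam i < s x then lam i powr p else 0)
      = (\<Sum>x\<in>points. \<Sum>i<L. if lam i < s x then lam i powr p else 0)" by (rule sum.swap)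
  also have "9 * K * \<dots> \<le> 9 * K * (\<Sum>x\<in>points. s x powr p / (1 - q))"
    using \<open>0 \<le> K\<close> by (intro mult_left_mono sum_mono geom s_nonneg) auto
  also have "\<dots> = 9 * K / (1 - q) * (\<Sum>x\<in>points. (\<Sum>i\<in>I. (cmod (G i x))\<^sup>2) powr (p / 2))"
    by (simp add: s_powr sum_divide_distrib[symmetric])
  finally show ?thesis by (simp add: K_def q_def)
qed

end

section \<open>Division of an interval between its endpoints\<close>

locale generators =
  fixes m :: "nat \<Rightarrow> nat"
  assumes two_le: "2 \<le> m k"
begin

abbreviation P :: "nat \<Rightarrow> nat" where "P \<equiv> vil_prod m"

lemma m_pos: "0 < m k"
  using two_le[of k] by simp

lemma P_pos: "0 < P n"
  by (rule vil_prod_pos[OF two_le])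

lemma less_P: "n \<le> k \<Longrightarrow> n < P k"
  using vil_prod_ge[of m k, OF two_le] less_exp[of k] by linarith

lemma P_split: "j \<le> N \<Longrightarrow> P N = P j * (P N div P j)"
  using vil_prod_dvd[of j N m] by simp

lemma div_P_mono:
  assumes "i \<le> j" "a div P i = b div P i"
  shows "a div P j = b div P j"
proof -
  have "x div P j = x div P i div (P j div P i)" for x
    using P_split[OF assms(1)] by (metis div_mult2_eq)
  then show ?thesis using assms(2) by simp
qed

text \<open>
  The quotient \<open>a div P j\<close> lists the digits of \<open>a\<close> from position \<open>j\<close> upwards. If \<open>\<ominus>\<close> is digitwise
  subtraction, then \<open>depth a b\<close> is the least \<open>j\<close> with \<open>a \<ominus> b < P j\<close>, that is, the generation of the martingale
  difference to which the character \<open>v\<^sub>b\<^sup>-\<^sup>1 v\<^sub>a\<close> belongs.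
\<close>
definition depth :: "nat \<Rightarrow> nat \<Rightarrow> nat" where
  "depth a b = (LEAST j. a div P j = b div P j)"

lemma depth_le_iff: "depth a b \<le> j \<longleftrightarrow> a div P j = b div P j"
proof
  have "a div P (max a b) = b div P (max a b)" using less_P[of a "max a b"] less_P[of b "max a b"] by simp
  then have "a div P (depth a b) = b div P (depth a b)"
    unfolding depth_def by (rule LeastI[of "\<lambda>j. a div P j = b div P j"])
  then show "a div P j = b div P j" if "depth a b \<le> j" using div_P_mono[OF that] by blast
qed (simp add: depth_def Least_le)

lemma depth_le: "a < P N \<Longrightarrow> b < P N \<Longrightarrow> depth a b \<le> N"
  by (simp add: depth_le_iff)

text \<open>
  The position \<open>depth a b - 1\<close> is the highest one at which \<open>a\<close> and \<open>b\<close> differ. As for corners,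
  \<open>c\<close> selects the right endpoint.
\<close>
definition endpoint_part :: "bool \<Rightarrow> nat \<Rightarrow> nat \<Rightarrow> nat set" where
  "endpoint_part c a b = {n \<in> {a..<b}. c \<longleftrightarrow> n div P (depth a b - 1) = b div P (depth a b - 1)}"

text \<open>
  Let \<open>t\<close> be the endpoint and \<open>j + 1\<close> the depth of \<open>n\<close>, so that \<open>n\<close> and \<open>t\<close> already differ in the
  digits from \<open>j\<close> upwards. A number \<open>n'\<close> with the same digits as \<open>n\<close> from \<open>j\<close> upwards then lies on
  the same side of \<open>t\<close> as \<open>n\<close>. It lies on the correct side of the other endpoint as well, because \<open>j\<close>
  does not exceed the highest position where \<open>a\<close> and \<open>b\<close> differ. At depth \<open>0\<close> the assumption forces
  \<open>n' = n\<close>.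
\<close>
lemma endpoint_part_closed:
  assumes n: "n \<in> endpoint_part c a b"
    and eq: "n' div P (depth n (if c then b else a) - 1) = n div P (depth n (if c then b else a) - 1)"
  shows "n' \<in> endpoint_part c a b"
proof -
  define t where "t = (if c then b else a)"
  define s where "s = depth a b - 1"
  define j where "j = depth n t - 1"
  have ab: "a \<le> n" "n < b" using n by (auto simp: endpoint_part_def)
  have nj: "n' div P j = n div P j" using eq by (simp add: j_def t_def)
  show ?thesis
  proof (cases "depth n t = 0")
    case True
    then have "n' = n" using nj by (simp add: j_def)
    then show ?thesis using n by simp
  next
    case False
    then have "\<not> depth n t \<le> j" by (simp add: j_def)
    then have neq: "n div P j \<noteq> t div P j" by (simp add: depth_le_iff)
    have "0 < depth a b" using ab depth_le_iff[of a b 0] by (cases "depth a b") auto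
    then have "\<not> depth a b \<le> s" by (simp add: s_def)
    then have sab: "a div P s \<noteq> b div P s" by (simp add: depth_le_iff)
    have S: "a div P (depth a b) = b div P (depth a b)" using depth_le_iff by blast
    show ?thesis
    proof (cases c)
      case False
      then have t: "t = a" by (simp add: t_def)
      have "a div P (depth a b) \<le> n div P (depth a b)" "n div P (depth a b) \<le> b div P (depth a b)"
        using ab by (auto intro: div_le_mono)
      then have "n div P (depth a b) = a div P (depth a b)" using S by simp
      then have "depth n a \<le> depth a b" by (simp add: depth_le_iff)
      then have js: "j \<le> s" by (simp add: j_def s_def t)
      have ns: "n' div P s = n div P s" by (rule div_P_mono[OF js nj])
      have "n div P s \<noteq> b div P s" using n False by (simp add: endpoint_part_def s_def)
      moreover have "n div P s \<le> b div P s" using ab by (auto intro: div_le_mono)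
      ultimately have "n' div P s < b div P s" using ns by simp
      then have "n' < b" using div_le_mono[of b n' "P s"] by linarith
      moreover have "a div P j < n' div P j" using neq nj div_le_mono[OF ab(1), of "P j"] t by simp
      then have "a < n'" using div_le_mono[of n' a "P j"] by linarith
      ultimately show ?thesis using n ns False by (simp add: endpoint_part_def s_def)
    next
      case True
      then have t: "t = b" by (simp add: t_def)
      have bs: "n div P s = b div P s" using n True by (simp add: endpoint_part_def s_def)
      then have "depth n b \<le> s" by (simp add: depth_le_iff)
      then have js: "j \<le> s" by (simp add: j_def t)
      have ns: "n' div P s = n div P s" by (rule div_P_mono[OF js nj])
      have "n' div P j < b div P j" using neq nj div_le_mono[of n b "P j"] ab t by simp
      then have "n' < b" using div_le_mono[of b n' "P j"] by linarith
      moreover have "a div P s < n' div P s" using sab bs ns div_le_mono[of a b "P s"] ab by simp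
      then have "a < n'" using div_le_mono[of n' a "P s"] by linarith
      ultimately show ?thesis using n ns True by (simp add: endpoint_part_def s_def)
    qed
  qed
qed

section \<open>Vilenkin characters on a grid\<close>

text \<open>
  The grid point \<open>y < P N\<close> stands for \<open>y / P N\<close> in the unit interval, and \<open>addr N j y\<close> is the index of the
  interval of length \<open>1 / P j\<close> around it. For \<open>j > N\<close> the formula still gives a refining sequence of
  partitions.
\<close>
definition addr :: "nat \<Rightarrow> nat \<Rightarrow> nat \<Rightarrow> nat" where
  "addr N j y = y * P j div P N"

lemma addr_Suc_div: "addr N (Suc j) y div m j = addr N j y"
proof -
  have "addr N (Suc j) y div m j = (y * P j) * m j div (P N * m j)"
    by (simp add: addr_def vil_prod_Suc div_mult2_eq mult.assoc)
  also have "\<dots> = addr N j y" using m_pos[of j] by (simp add: addr_def)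
  finally show ?thesis .
qed

lemma addr_refine_Suc: "addr N (Suc j) y = addr N (Suc j) z \<Longrightarrow> addr N j y = addr N j z"
  using addr_Suc_div by metis

lemma addr_refine: "i \<le> j \<Longrightarrow> addr N j y = addr N j z \<Longrightarrow> addr N i y = addr N i z"
  by (induction j rule: dec_induct) (auto dest: addr_refine_Suc)

lemma addr_eq_div: "j \<le> N \<Longrightarrow> addr N j y = y div (P N div P j)"
  using P_split[of j N] P_pos[of j] unfolding addr_def
  by (metis div_mult_mult1 mult.commute not_less_zero)

lemma addr_less: "y < P N \<Longrightarrow> addr N j y < P j"
  using P_pos by (simp add: addr_def less_mult_imp_div_less mult.commute)

lemma card_addr:
  assumes "j \<le> N" "q < P j"
  shows "card {y \<in> {..<P N}. addr N j y = q} = P N div P j"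
proof -
  define R where "R = P N div P j"
  have PN: "P N = P j * R" using P_split[OF assms(1)] by (simp add: R_def)
  have R: "0 < R" using PN P_pos[of N] by (cases R) auto
  have "{y \<in> {..<P N}. addr N j y = q} = {q * R..<q * R + R}"
  proof (intro set_eqI iffI)
    fix y assume "y \<in> {q * R..<q * R + R}"
    then have y: "q * R \<le> y" "y < Suc q * R" by auto
    have "y div R = q" using y by (simp add: div_nat_eqI mult.commute)
    moreover have "Suc q * R \<le> P j * R" using assms(2) by (intro mult_right_mono) auto
    then have "y < P N" using y PN by linarith
    ultimately show "y \<in> {y \<in> {..<P N}. addr N j y = q}"
      by (simp add: addr_eq_div[OF assms(1)] R_def)
  next
    fix y assume "y \<in> {y \<in> {..<P N}. addr N j y = q}"
    then have "y div R = q" by (simp add: addr_eq_div[OF assms(1)] R_def)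
    then show "y \<in> {q * R..<q * R + R}"
      using dividend_less_div_times[OF R, of y] by (auto simp: add.commute)
  qed
  then show ?thesis by (simp add: R_def)
qed

definition unit_root :: "nat \<Rightarrow> nat \<Rightarrow> complex" where
  "unit_root k x = exp (2 * of_real pi * \<i> * of_nat x / of_nat (m k))"

lemma unit_root_eq_iff: "unit_root k x = unit_root k y \<longleftrightarrow> x mod m k = y mod m k"
  unfolding unit_root_def using two_le[of k] by (intro complex_root_unity_eq) simp

lemma unit_root_power: "unit_root k x ^ n = unit_root k (x * n)"
  unfolding unit_root_def by (simp add: exp_of_nat_mult[symmetric] mult_ac)

lemma norm_unit_root: "cmod (unit_root k x) = 1"
  unfolding unit_root_def by (simp add: norm_exp_eq_Re)

lemma unimodular_mult_cnj: "cmod z = 1 \<Longrightarrow> z * cnj z = 1"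
  by (simp add: complex_norm_square[symmetric])

definition grid_char :: "nat \<Rightarrow> nat \<Rightarrow> nat \<Rightarrow> complex" where
  "grid_char N \<nu> y = (\<Prod>k<N. unit_root k (addr N (Suc k) y) ^ (\<nu> div P k mod m k))"

lemma norm_grid_char: "cmod (grid_char N \<nu> y) = 1"
  by (simp add: grid_char_def prod_norm[symmetric] norm_power norm_unit_root)

text \<open>
  The ratio of two characters depends only on the digits of \<open>y\<close> at the positions where the
  frequencies differ, here below \<open>j\<close>.
\<close>
lemma grid_char_ratio_const:
  assumes "\<nu> div P j = \<mu> div P j" "addr N j y = addr N j z"
  shows "grid_char N \<nu> y * cnj (grid_char N \<mu> y) = grid_char N \<nu> z * cnj (grid_char N \<mu> z)"
  unfolding grid_char_def cnj_prod prod.distrib[symmetric]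
proof (rule prod.cong[OF refl])
  fix k
  show "unit_root k (addr N (Suc k) y) ^ (\<nu> div P k mod m k) * cnj (unit_root k (addr N (Suc k) y) ^ (\<mu> div P k mod m k))
    = unit_root k (addr N (Suc k) z) ^ (\<nu> div P k mod m k) * cnj (unit_root k (addr N (Suc k) z) ^ (\<mu> div P k mod m k))"
  proof (cases "k < j")
    case True
    then have "addr N (Suc k) y = addr N (Suc k) z" using addr_refine[OF _ assms(2)] by simp
    then show ?thesis by simp
  next
    case False
    then have "\<nu> div P k = \<mu> div P k" using div_P_mono[OF _ assms(1)] by simp
    then show ?thesis by (simp add: unimodular_mult_cnj norm_power norm_unit_root del: complex_cnj_power)
  qed
qed

text \<open>
  Let \<open>r\<close> be the highest position at which the frequencies differ. On a cell of generation \<open>r\<close> the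
  product of the characters is a constant times \<open>z\<^sup>t\<close>, where \<open>t\<close> runs through the digits at position \<open>r\<close>
  equally often and \<open>z \<noteq> 1\<close> is an \<open>m r\<close>-th root of unity. The cells of generation \<open>j \<le> r\<close> are unions of
  cells of generation \<open>r\<close>.
\<close>
lemma grid_char_orthogonal:
  assumes bd: "\<nu> < P N" "\<mu> < P N" and ne: "\<nu> div P j \<noteq> \<mu> div P j"
  shows "(\<Sum>y | y < P N \<and> addr N j y = q. grid_char N \<nu> y * cnj (grid_char N \<mu> y)) = 0"
proof -
  define r where "r = depth \<nu> \<mu> - 1"
  have "j < depth \<nu> \<mu>" using ne depth_le_iff[of \<nu> \<mu> j] by simp
  then have r: "depth \<nu> \<mu> = Suc r" "j \<le> r" by (simp_all add: r_def)
  have rN: "r < N" using depth_le[OF bd] r by simp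
  have above: "\<nu> div P (Suc r) = \<mu> div P (Suc r)" using depth_le_iff[of \<nu> \<mu> "Suc r"] r by simp
  have at_r: "\<nu> div P r \<noteq> \<mu> div P r" using depth_le_iff[of \<nu> \<mu> r] r by simp
  define nr where "nr = \<nu> div P r mod m r"
  define mr where "mr = \<mu> div P r mod m r"
  have nr_ne: "nr \<noteq> mr"
  proof
    assume "nr = mr"
    moreover have "\<nu> div P r div m r = \<mu> div P r div m r"
      using above by (simp add: vil_prod_Suc div_mult2_eq)
    ultimately show False using at_r div_mult_mod_eq unfolding nr_def mr_def by metis
  qed
  define w where "w k n u y = unit_root k (addr N (Suc k) y) ^ n * cnj (unit_root k (addr N (Suc k) y) ^ u)" for k n u y
  define dg where "dg \<nu> k = \<nu> div P k mod m k" for \<nu> k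
  define z where "z = unit_root r nr * cnj (unit_root r mr)"
  have z1: "z \<noteq> 1"
  proof
    assume "z = 1"
    have "unit_root r nr = unit_root r nr * (unit_root r mr * cnj (unit_root r mr))"
      by (simp only: unimodular_mult_cnj[OF norm_unit_root]) simp
    also have "\<dots> = z * unit_root r mr" by (simp add: z_def mult_ac)
    finally have "unit_root r nr = unit_root r mr" using \<open>z = 1\<close> by simp
    then show False using nr_ne m_pos[of r] by (simp add: unit_root_eq_iff nr_def mr_def)
  qed
  have root_m: "unit_root r n ^ m r = 1" for n
    using unit_root_eq_iff[of r "n * m r" 0] by (simp add: unit_root_power) (simp add: unit_root_def)
  have zm: "z ^ m r = 1" by (simp add: z_def power_mult_distrib root_m complex_cnj_power[symmetric] del: complex_cnj_power)
  have ratio: "grid_char N \<nu> y * cnj (grid_char N \<mu> y) = (\<Prod>k<r. w k (dg \<nu> k) (dg \<mu> k) y) * z ^ addr N (Suc r) y" for y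
  proof -
    have "grid_char N \<nu> y * cnj (grid_char N \<mu> y) = (\<Prod>k<N. w k (dg \<nu> k) (dg \<mu> k) y)"
      by (simp add: grid_char_def w_def dg_def prod.distrib)
    also have "\<dots> = (\<Prod>k<Suc r. w k (dg \<nu> k) (dg \<mu> k) y)"
    proof (rule prod.mono_neutral_right)
      show "\<forall>k\<in>{..<N} - {..<Suc r}. w k (dg \<nu> k) (dg \<mu> k) y = 1"
      proof
        fix k assume "k \<in> {..<N} - {..<Suc r}"
        then have "\<nu> div P k = \<mu> div P k" using div_P_mono[OF _ above, of k] by simp
        then show "w k (dg \<nu> k) (dg \<mu> k) y = 1"
          by (simp add: w_def dg_def unimodular_mult_cnj norm_power norm_unit_root del: complex_cnj_power)
      qed
    qed (use rN in auto)
    also have "\<dots> = (\<Prod>k<r. w k (dg \<nu> k) (dg \<mu> k) y) * w r nr mr y"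
      by (simp add: dg_def nr_def mr_def)
    also have "w r nr mr y = z ^ addr N (Suc r) y"
      by (simp add: w_def z_def unit_root_power power_mult_distrib complex_cnj_power[symmetric] mult.commute
          del: complex_cnj_power)
    finally show ?thesis .
  qed
  let ?g = "\<lambda>y. grid_char N \<nu> y * cnj (grid_char N \<mu> y)"
  have level_r: "(\<Sum>y | y < P N \<and> addr N r y = q. ?g y) = 0" for q
  proof (cases "q < P r")
    case False
    then have "{y. y < P N \<and> addr N r y = q} = {}" using addr_less by blast
    then show ?thesis by (simp only: sum.empty)
  next
    case True
    let ?S = "{y. y < P N \<and> addr N r y = q}"
    define R where "R = P N div P (Suc r)"
    define c where "c = (\<Prod>k<r. w k (dg \<nu> k) (dg \<mu> k) (SOME y. y \<in> ?S))"
    have g: "?g y = c * z ^ addr N (Suc r) y" if y: "y \<in> ?S" for y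
    proof -
      have s: "(SOME y. y \<in> ?S) \<in> ?S" using y by (rule someI)
      have "w k (dg \<nu> k) (dg \<mu> k) y = w k (dg \<nu> k) (dg \<mu> k) (SOME y. y \<in> ?S)" if "k < r" for k
        using addr_refine[of "Suc k" r N y "SOME y. y \<in> ?S"] that y s by (simp add: w_def)
      then show ?thesis by (simp add: ratio c_def)
    qed
    have fib: "{y \<in> ?S. addr N (Suc r) y mod m r = t} = {y \<in> {..<P N}. addr N (Suc r) y = q * m r + t}"
      if "t < m r" for t
    proof -
      have "addr N r y = q \<and> addr N (Suc r) y mod m r = t \<longleftrightarrow> addr N (Suc r) y = q * m r + t" for y
        using that addr_Suc_div[of N r y] div_mult_mod_eq[of "addr N (Suc r) y" "m r"] m_pos[of r] by auto
      then show ?thesis by blast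
    qed
    have "(\<Sum>y\<in>?S. ?g y) = (\<Sum>y\<in>?S. c * z ^ addr N (Suc r) y)" by (intro sum.cong g) auto
    also have "\<dots> = (\<Sum>t<m r. \<Sum>y\<in>{y \<in> ?S. addr N (Suc r) y mod m r = t}. c * z ^ addr N (Suc r) y)"
      using m_pos[of r] by (intro sum.group[symmetric]) auto
    also have "\<dots> = (\<Sum>t<m r. of_nat R * (c * z ^ (q * m r + t)))"
    proof (rule sum.cong[OF refl])
      fix t assume t: "t \<in> {..<m r}"
      have "q * m r + t < Suc q * m r" using t by simp
      also have "\<dots> \<le> P (Suc r)" using True by (simp only: vil_prod_Suc) (intro mult_right_mono, auto)
      finally have "card {y \<in> {..<P N}. addr N (Suc r) y = q * m r + t} = R"
        unfolding R_def using rN by (intro card_addr) auto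
      then show "(\<Sum>y\<in>{y \<in> ?S. addr N (Suc r) y mod m r = t}. c * z ^ addr N (Suc r) y)
          = of_nat R * (c * z ^ (q * m r + t))"
        using fib[of t] t by simp
    qed
    also have "\<dots> = of_nat R * c * z ^ (q * m r) * (\<Sum>t<m r. z ^ t)"
      unfolding sum_distrib_left by (intro sum.cong refl) (simp add: power_add)
    also have "(\<Sum>t<m r. z ^ t) = 0" using geometric_sum[OF z1, of "m r"] zm by simp
    finally show ?thesis by simp
  qed
  define S where "S = {y. y < P N \<and> addr N j y = q}"
  define Q where "Q x = {z. z < P N \<and> addr N r z = addr N r x}" for x
  have "(\<Sum>y\<in>S. ?g y) = (\<Sum>B\<in>Q ` S. \<Sum>y\<in>B. ?g y)"
  proof (rule sum_by_cells)
    show "Q x \<subseteq> S" if "x \<in> S" for x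
    proof
      fix z assume "z \<in> Q x"
      then have "z < P N" "addr N j z = addr N j x" by (auto simp: Q_def intro: addr_refine[OF r(2)])
      then show "z \<in> S" using that by (simp add: S_def)
    qed
  qed (auto simp: S_def Q_def)
  also have "\<dots> = 0" by (intro sum.neutral) (auto simp only: Q_def level_r)
  finally show ?thesis by (simp only: S_def)
qed

end

section \<open>The inequality for finitely many rectangles on a grid\<close>

locale vilenkin_grid =
  fixes m :: "'d::finite \<Rightarrow> nat \<Rightarrow> nat" and N :: nat
  assumes two_le: "2 \<le> m d k"
begin

sublocale dir: generators "m d" for d
  by unfold_locales (rule two_le)

sublocale product_cells "\<lambda>d. {..<dir.P d N}" "\<lambda>d. dir.addr d N"
  by unfold_locales (auto dest: dir.addr_refine_Suc)

lemma points_iff: "x \<in> points \<longleftrightarrow> (\<forall>d. x d < dir.P d N)"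
  by (auto simp: points_def)

definition grid_charD :: "('d \<Rightarrow> nat) \<Rightarrow> ('d \<Rightarrow> nat) \<Rightarrow> complex" where
  "grid_charD \<nu> x = (\<Prod>d\<in>UNIV. dir.grid_char d N (\<nu> d) (x d))"

definition grid_poly :: "(('d \<Rightarrow> nat) \<Rightarrow> complex) \<Rightarrow> ('d \<Rightarrow> nat) set \<Rightarrow> ('d \<Rightarrow> nat) \<Rightarrow> complex" where
  "grid_poly c S x = (\<Sum>\<nu>\<in>S. c \<nu> * grid_charD \<nu> x)"

lemma norm_grid_charD: "cmod (grid_charD \<nu> x) = 1"
  by (simp add: grid_charD_def prod_norm[symmetric] dir.norm_grid_char)

lemma cell_Pi:
  "cell n x = Pi UNIV (\<lambda>d. {b. b < dir.P d N \<and> dir.addr d N (n d) b = dir.addr d N (n d) (x d)})"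
  by (auto simp: slice_def points_iff)

lemma grid_charD_ratio_const:
  assumes "\<And>d. \<nu> d div dir.P d (n d) = \<mu> d div dir.P d (n d)" "y \<in> cell n x"
  shows "grid_charD \<nu> y * cnj (grid_charD \<mu> y) = grid_charD \<nu> x * cnj (grid_charD \<mu> x)"
  using assms unfolding grid_charD_def cnj_prod prod.distrib[symmetric]
  by (intro prod.cong refl dir.grid_char_ratio_const[OF assms(1)]) (simp add: slice_def)

lemma grid_charD_orthogonal:
  assumes "\<nu> \<in> points" "\<mu> \<in> points" and ne: "\<nu> d div dir.P d (n d) \<noteq> \<mu> d div dir.P d (n d)"
  shows "(\<Sum>y\<in>cell n x. grid_charD \<nu> y * cnj (grid_charD \<mu> y)) = 0"
proof -
  let ?S = "\<lambda>d. {b. b < dir.P d N \<and> dir.addr d N (n d) b = dir.addr d N (n d) (x d)}"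
  have "(\<Sum>y\<in>cell n x. grid_charD \<nu> y * cnj (grid_charD \<mu> y))
    = (\<Sum>y\<in>Pi UNIV ?S. \<Prod>d\<in>UNIV. dir.grid_char d N (\<nu> d) (y d) * cnj (dir.grid_char d N (\<mu> d) (y d)))"
    unfolding cell_Pi by (simp add: grid_charD_def prod.distrib)
  also have "\<dots> = (\<Prod>d\<in>UNIV. \<Sum>b\<in>?S d. dir.grid_char d N (\<nu> d) b * cnj (dir.grid_char d N (\<mu> d) b))"
    unfolding PiE_UNIV_domain[symmetric] by (rule prod_sum_PiE[symmetric]) auto
  also have "\<dots> = 0"
  proof (rule prod_zero)
    show "\<exists>d\<in>UNIV. (\<Sum>b\<in>?S d. dir.grid_char d N (\<nu> d) b * cnj (dir.grid_char d N (\<mu> d) b)) = 0"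
      using assms by (intro bexI[of _ d] dir.grid_char_orthogonal) (auto simp: points_iff)
  qed simp
  finally show ?thesis .
qed

lemma grid_poly_orthogonal:
  assumes "S \<subseteq> points" "T \<subseteq> points"
    and ne: "\<And>\<nu> \<mu>. \<nu> \<in> S \<Longrightarrow> \<mu> \<in> T \<Longrightarrow> \<exists>d. \<nu> d div dir.P d (n d) \<noteq> \<mu> d div dir.P d (n d)"
  shows "(\<Sum>y\<in>cell n x. grid_poly c S y * cnj (grid_poly c' T y)) = 0"
proof -
  have "(\<Sum>y\<in>cell n x. grid_poly c S y * cnj (grid_poly c' T y))
    = (\<Sum>y\<in>cell n x. \<Sum>\<nu>\<in>S. \<Sum>\<mu>\<in>T. c \<nu> * cnj (c' \<mu>) * (grid_charD \<nu> y * cnj (grid_charD \<mu> y)))"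
    by (simp add: grid_poly_def sum_product mult_ac)
  also have "\<dots> = (\<Sum>\<nu>\<in>S. \<Sum>y\<in>cell n x. \<Sum>\<mu>\<in>T. c \<nu> * cnj (c' \<mu>) * (grid_charD \<nu> y * cnj (grid_charD \<mu> y)))"
    by (rule sum.swap)
  also have "\<dots> = (\<Sum>\<nu>\<in>S. \<Sum>\<mu>\<in>T. \<Sum>y\<in>cell n x. c \<nu> * cnj (c' \<mu>) * (grid_charD \<nu> y * cnj (grid_charD \<mu> y)))"
    by (intro sum.cong refl sum.swap)
  also have "\<dots> = 0"
  proof (rule sum.neutral, rule ballI, rule sum.neutral, rule ballI)
    fix \<nu> \<mu> assume *: "\<nu> \<in> S" "\<mu> \<in> T"
    then obtain d where "\<nu> d div dir.P d (n d) \<noteq> \<mu> d div dir.P d (n d)" using ne by blast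
    then have "(\<Sum>y\<in>cell n x. grid_charD \<nu> y * cnj (grid_charD \<mu> y)) = 0"
      using assms(1,2) * by (intro grid_charD_orthogonal) auto
    then show "(\<Sum>y\<in>cell n x. c \<nu> * cnj (c' \<mu>) * (grid_charD \<nu> y * cnj (grid_charD \<mu> y))) = 0"
      by (simp add: sum_distrib_left[symmetric])
  qed
  finally show ?thesis .
qed

lemma card_cell:
  assumes "\<And>d. n d \<le> N" "x \<in> points"
  shows "card (cell n x) = (\<Prod>d\<in>UNIV. dir.P d N div dir.P d (n d))"
proof -
  have "card (cell n x) = (\<Prod>d\<in>UNIV. card {b \<in> {..<dir.P d N}. dir.addr d N (n d) b = dir.addr d N (n d) (x d)})"
    unfolding cell_Pi PiE_UNIV_domain[symmetric] by (subst card_PiE) simp_all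
  also have "\<dots> = (\<Prod>d\<in>UNIV. dir.P d N div dir.P d (n d))"
    using assms by (intro prod.cong refl dir.card_addr dir.addr_less) (auto simp: points_iff)
  finally show ?thesis .
qed

lemma card_cell_parent_le:
  assumes M: "\<And>d k. m d k \<le> M" and n: "\<And>d. n d \<le> N" and x: "x \<in> points"
  shows "card (cell (\<lambda>d. n d - 1) x) \<le> M ^ CARD('d) * card (cell n x)"
proof -
  have "dir.P d N div dir.P d (n d - 1) \<le> M * (dir.P d N div dir.P d (n d))" for d
  proof (cases "n d")
    case 0
    then show ?thesis using M[of d 0] two_le[of d 0] by simp
  next
    case (Suc j)
    have "dir.P d N = dir.P d j * (m d j * (dir.P d N div dir.P d (n d)))"
      using dir.P_split[OF n[of d]] by (simp add: Suc vil_prod_Suc mult.assoc)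
    then have "dir.P d N div dir.P d j = m d j * (dir.P d N div dir.P d (n d))"
      using dir.P_pos[of d j] by (metis nonzero_mult_div_cancel_left not_less_zero)
    then show ?thesis using M by (simp add: Suc)
  qed
  then have "(\<Prod>d\<in>UNIV. dir.P d N div dir.P d (n d - 1)) \<le> (\<Prod>d\<in>UNIV. M * (dir.P d N div dir.P d (n d)))"
    by (intro prod_mono) auto
  moreover have "n d - 1 \<le> N" for d using n[of d] by simp
  ultimately show ?thesis using n x by (simp add: card_cell prod.distrib)
qed

definition level :: "('d \<Rightarrow> nat) \<Rightarrow> ('d \<Rightarrow> nat) \<Rightarrow> 'd \<Rightarrow> nat" where
  "level \<tau> \<nu> d = dir.depth d (\<nu> d) (\<tau> d)"

definition levels :: "('d \<Rightarrow> nat) set" where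
  "levels = {n. \<forall>d. n d \<le> N}"

lemma finite_levels: "finite levels"
proof -
  have "levels = PiE UNIV (\<lambda>_. {..N})" by (auto simp: levels_def)
  then show ?thesis by (simp add: finite_PiE)
qed

lemma level_in_levels: "\<nu> \<in> points \<Longrightarrow> \<tau> \<in> points \<Longrightarrow> level \<tau> \<nu> \<in> levels"
  by (simp add: levels_def level_def points_iff dir.depth_le)

lemma finite_rectangle: "finite (rectangle a (b :: 'd \<Rightarrow> nat))"
  unfolding rectangle_def PiE_UNIV_domain[symmetric] by (intro finite_PiE) auto

definition endpoint_parts :: "('d \<Rightarrow> bool) \<Rightarrow> ('d \<Rightarrow> nat) \<Rightarrow> ('d \<Rightarrow> nat) \<Rightarrow> ('d \<Rightarrow> nat) set" where
  "endpoint_parts c a b = Pi UNIV (\<lambda>d. dir.endpoint_part d (c d) (a d) (b d))"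

lemma endpoint_parts_subset: "endpoint_parts c a b \<subseteq> rectangle a b"
  unfolding endpoint_parts_def rectangle_def dir.endpoint_part_def by (auto simp: Pi_iff)

text \<open>
  Every frequency of the rectangle belongs to the part of exactly one corner: in each direction the
  choice of the endpoint is forced by the definition of the parts.
\<close>
lemma grid_poly_rectangle: "grid_poly cf (rectangle a b) x = (\<Sum>c\<in>UNIV. grid_poly cf (endpoint_parts c a b) x)"
proof -
  let ?g = "\<lambda>\<nu> d. \<nu> d \<in> dir.endpoint_part d True (a d) (b d)"
  have "endpoint_parts c a b = {\<nu> \<in> rectangle a b. ?g \<nu> = c}" for c
    by (auto simp: endpoint_parts_def rectangle_def dir.endpoint_part_def Pi_iff fun_eq_iff)
  then have "(\<Sum>c\<in>UNIV. grid_poly cf (endpoint_parts c a b) x)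
      = (\<Sum>c\<in>UNIV. \<Sum>\<nu>\<in>{\<nu> \<in> rectangle a b. ?g \<nu> = c}. cf \<nu> * grid_charD \<nu> x)"
    by (simp only: grid_poly_def)
  also have "\<dots> = grid_poly cf (rectangle a b) x"
    unfolding grid_poly_def by (intro sum.group finite_rectangle finite) auto
  finally show ?thesis by simp
qed

lemma endpoint_parts_closed:
  assumes "\<nu> d \<in> dir.endpoint_part d (c d) (a d) (b d)"
    and "k = \<nu> d \<or> k div dir.P d (level (corner c a b) \<nu> d - 1) = \<nu> d div dir.P d (level (corner c a b) \<nu> d - 1)"
  shows "k \<in> dir.endpoint_part d (c d) (a d) (b d)"
  using assms(2)
proof
  assume "k div dir.P d (level (corner c a b) \<nu> d - 1) = \<nu> d div dir.P d (level (corner c a b) \<nu> d - 1)"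
  then show ?thesis
    using dir.endpoint_part_closed[OF assms(1), of k] by (simp add: level_def corner_def)
qed (use assms in simp)

text \<open>
  The two hypotheses on \<open>F\<close> in \<open>square_function_bound\<close> both come from \<open>endpoint_parts_closed\<close>. For the
  energy, no frequency inside the part of the corner shares its digits from \<open>n d - 1\<close> upwards in every
  direction \<open>d\<close> with one of the same depth outside. For the orthogonality of two pieces, a common digit pattern
  would allow the two frequencies to be combined, direction by direction, into one that lies in both parts.
  Then the rectangles coincide, and the depths cannot differ either.
\<close>
lemma corner_bound:
  fixes a b :: "'k \<Rightarrow> 'd \<Rightarrow> nat" and cf :: "'k \<Rightarrow> ('d \<Rightarrow> nat) \<Rightarrow> complex"
  assumes p: "0 < p" "p \<le> 1" and M: "\<And>d k. m d k \<le> M" and K: "finite K"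
    and ab: "\<And>k. k \<in> K \<Longrightarrow> a k \<in> points" "\<And>k. k \<in> K \<Longrightarrow> b k \<in> points"
    and disj: "\<And>k l. k \<in> K \<Longrightarrow> l \<in> K \<Longrightarrow> k \<noteq> l \<Longrightarrow> rectangle (a k) (b k) \<inter> rectangle (a l) (b l) = {}"
  shows "(\<Sum>x\<in>points. cmod (\<Sum>k\<in>K. grid_poly (cf k) (endpoint_parts c (a k) (b k)) x) powr p)
    \<le> 9 * (2 ^ CARD('d) * (2 * real M ^ CARD('d))) ^ CARD('d) / (1 - 2 powr - p)
      * (\<Sum>x\<in>points. (\<Sum>k\<in>K. \<Sum>n\<in>levels.
          (cmod (grid_poly (cf k) {\<nu> \<in> rectangle (a k) (b k). level (corner c (a k) (b k)) \<nu> = n} x))\<^sup>2) powr (p / 2))"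
proof -
  define \<tau> where "\<tau> k = corner c (a k) (b k)" for k
  define R where "R k = rectangle (a k) (b k)" for k
  define J where "J k = endpoint_parts c (a k) (b k)" for k
  define F where "F i = grid_poly (cf (fst i)) {\<nu> \<in> J (fst i). level (\<tau> (fst i)) \<nu> = snd i}" for i
  define G where "G i = grid_poly (cf (fst i)) {\<nu> \<in> R (fst i). level (\<tau> (fst i)) \<nu> = snd i}" for i
  let ?I = "K \<times> levels"
  have R_points: "R k \<subseteq> points" if "k \<in> K" for k
  proof
    fix \<nu> assume "\<nu> \<in> R k"
    then have "\<nu> d < b k d" for d by (auto simp: R_def rectangle_def Pi_iff)
    then show "\<nu> \<in> points" using ab(2)[OF that] less_trans unfolding points_iff by blast
  qed
  have \<tau>_points: "\<tau> k \<in> points" if "k \<in> K" for k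
    using ab[OF that] by (simp add: \<tau>_def corner_def points_iff)
  have J_R: "J k \<subseteq> R k" for k unfolding J_def R_def by (rule endpoint_parts_subset)
  have M1: "1 \<le> M" using M[of undefined 0] two_le[of undefined 0] by simp
  have same_J: "\<mu> \<in> J k"
    if "\<nu> \<in> J k" "level (\<tau> k) \<nu> = n" "\<And>d. \<mu> d = \<nu> d \<or> \<mu> d div dir.P d (n d - 1) = \<nu> d div dir.P d (n d - 1)"
    for \<nu> \<mu> k n
  proof -
    have "\<mu> d \<in> dir.endpoint_part d (c d) (a k d) (b k d)" for d
    proof (rule endpoint_parts_closed)
      show "\<nu> d \<in> dir.endpoint_part d (c d) (a k d) (b k d)"
        using that(1) unfolding J_def endpoint_parts_def by (rule PiE) simp_all
      show "\<mu> d = \<nu> d \<or> \<mu> d div dir.P d (level (corner c (a k) (b k)) \<nu> d - 1)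
          = \<nu> d div dir.P d (level (corner c (a k) (b k)) \<nu> d - 1)"
        using that(3)[of d] unfolding that(2)[symmetric] \<tau>_def .
    qed
    then show ?thesis by (simp add: J_def endpoint_parts_def)
  qed
  have F_sum: "grid_poly (cf k) (J k) x = (\<Sum>n\<in>levels. F (k, n) x)" if "k \<in> K" for k x
  proof -
    have "finite (J k)" using finite_subset[OF J_R] by (simp add: R_def finite_rectangle)
    moreover have "level (\<tau> k) ` J k \<subseteq> levels"
      using J_R R_points[OF that] \<tau>_points[OF that] by (auto intro!: level_in_levels)
    ultimately show ?thesis
      unfolding grid_poly_def F_def fst_conv snd_conv by (intro sum.group[symmetric] finite_levels)
  qed
  have "(\<Sum>x\<in>points. cmod (\<Sum>i\<in>?I. F i x) powr p)
    \<le> 9 * (2 ^ CARD('d) * (2 * real M ^ CARD('d))) ^ CARD('d) / (1 - 2 powr - p)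
      * (\<Sum>x\<in>points. (\<Sum>i\<in>?I. (cmod (G i x))\<^sup>2) powr (p / 2))"
  proof (rule square_function_bound[where lev = snd])
    show "finite ?I" using K finite_levels by simp
    show "1 \<le> real M ^ CARD('d)" using M1 by simp
  next
    fix i x assume "i \<in> ?I" and x: "x \<in> points"
    then have "snd i d \<le> N" for d by (auto simp: levels_def)
    from card_cell_parent_le[OF M this x]
    have "real (card (cell (\<lambda>d. snd i d - 1) x)) \<le> real (M ^ CARD('d) * card (cell (snd i) x))"
      by (simp only: of_nat_le_iff)
    then show "real (card (cell (\<lambda>d. snd i d - 1) x)) \<le> real M ^ CARD('d) * real (card (cell (snd i) x))"
      by simp
  next
    fix i x y assume i: "i \<in> ?I" and x: "x \<in> points" and y: "y \<in> cell (snd i) x"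
    obtain k n where kn: "i = (k, n)" by fastforce
    have *: "cmod (G i z) = cmod (\<Sum>\<nu> | \<nu> \<in> R k \<and> level (\<tau> k) \<nu> = n. cf k \<nu> * (grid_charD \<nu> z * cnj (grid_charD (\<tau> k) z)))" for z
    proof -
      have "cmod (G i z) = cmod (G i z * cnj (grid_charD (\<tau> k) z))" by (simp add: norm_mult norm_grid_charD)
      then show ?thesis by (simp add: G_def grid_poly_def kn sum_distrib_right mult.assoc)
    qed
    have "grid_charD \<nu> y * cnj (grid_charD (\<tau> k) y) = grid_charD \<nu> x * cnj (grid_charD (\<tau> k) x)" if "level (\<tau> k) \<nu> = n" for \<nu>
    proof (rule grid_charD_ratio_const)
      show "\<nu> d div dir.P d (n d) = \<tau> k d div dir.P d (n d)" for d
        using dir.depth_le_iff[of d "\<nu> d" "\<tau> k d" "n d"] that[symmetric] by (simp add: level_def)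
      show "y \<in> cell n x" using y kn by simp
    qed
    then have "(\<Sum>\<nu> | \<nu> \<in> R k \<and> level (\<tau> k) \<nu> = n. cf k \<nu> * (grid_charD \<nu> y * cnj (grid_charD (\<tau> k) y)))
      = (\<Sum>\<nu> | \<nu> \<in> R k \<and> level (\<tau> k) \<nu> = n. cf k \<nu> * (grid_charD \<nu> x * cnj (grid_charD (\<tau> k) x)))"
      by (intro sum.cong) auto
    then show "cmod (G i y) = cmod (G i x)" unfolding * by simp
  next
    fix i x assume i: "i \<in> ?I" and x: "x \<in> points"
    obtain k n where kn: "i = (k, n)" "k \<in> K" using i by fastforce
    let ?S = "{\<nu> \<in> J k. level (\<tau> k) \<nu> = n}" and ?T = "{\<nu> \<in> R k - J k. level (\<tau> k) \<nu> = n}"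
    let ?Q = "cell (\<lambda>d. snd i d - 1) x"
    define H where "H = grid_poly (cf k) ?T"
    have sub: "?S \<subseteq> points" "?T \<subseteq> points" using R_points[OF kn(2)] J_R by blast+
    have ne: "\<exists>d. \<nu> d div dir.P d (n d - 1) \<noteq> \<mu> d div dir.P d (n d - 1)" if "\<nu> \<in> ?S" "\<mu> \<in> ?T" for \<nu> \<mu>
    proof (rule ccontr)
      assume "\<not> ?thesis"
      then have "\<mu> d div dir.P d (n d - 1) = \<nu> d div dir.P d (n d - 1)" for d by metis
      with that(1) have "\<nu> \<in> J k" "level (\<tau> k) \<nu> = n"
        "\<And>d. \<mu> d = \<nu> d \<or> \<mu> d div dir.P d (n d - 1) = \<nu> d div dir.P d (n d - 1)" by blast+
      then have "\<mu> \<in> J k" by (rule same_J)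
      then show False using that(2) by simp
    qed
    have FH: "(\<Sum>y\<in>?Q. F i y * cnj (H y)) = 0"
      unfolding F_def H_def kn fst_conv snd_conv by (rule grid_poly_orthogonal[OF sub ne])
    have HF: "(\<Sum>y\<in>?Q. H y * cnj (F i y)) = 0"
      unfolding F_def H_def kn fst_conv snd_conv
    proof (rule grid_poly_orthogonal[OF sub(2,1)])
      fix \<mu> \<nu> assume "\<mu> \<in> ?T" "\<nu> \<in> ?S"
      from ne[OF this(2,1)] obtain d where "\<nu> d div dir.P d (n d - 1) \<noteq> \<mu> d div dir.P d (n d - 1)" ..
      then show "\<exists>d. \<mu> d div dir.P d (n d - 1) \<noteq> \<nu> d div dir.P d (n d - 1)" by (intro exI[of _ d]) (rule not_sym)
    qed
    have G_FH: "G i y = F i y + H y" for y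
    proof -
      have fin: "finite (R k)" by (simp add: R_def finite_rectangle)
      have "{\<nu> \<in> R k. level (\<tau> k) \<nu> = n} = ?S \<union> ?T" using J_R by blast
      then show ?thesis
        unfolding G_def F_def H_def grid_poly_def kn fst_conv snd_conv
        using finite_subset[OF J_R, of k] fin by (simp only:) (rule sum.union_disjoint, auto)
    qed
    let ?f = "\<lambda>t :: bool. if t then F i else H"
    have "(\<Sum>y\<in>?Q. (cmod (\<Sum>t\<in>UNIV. ?f t y))\<^sup>2) = (\<Sum>t\<in>UNIV. \<Sum>y\<in>?Q. (cmod (?f t y))\<^sup>2)"
      using FH HF by (intro norm_sq_sum_orthogonal) auto
    then have "(\<Sum>y\<in>?Q. (cmod (G i y))\<^sup>2) = (\<Sum>y\<in>?Q. (cmod (F i y))\<^sup>2) + (\<Sum>y\<in>?Q. (cmod (H y))\<^sup>2)"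
      by (simp add: UNIV_bool G_FH add.commute)
    then show "(\<Sum>y\<in>?Q. (cmod (F i y))\<^sup>2) \<le> (\<Sum>y\<in>?Q. (cmod (G i y))\<^sup>2)"
      by (simp add: sum_nonneg)
  next
    fix i j x assume ij: "i \<in> ?I" "j \<in> ?I" "i \<noteq> j" and x: "x \<in> points"
    obtain k n l n' where kn: "i = (k, n)" "k \<in> K" "j = (l, n')" "l \<in> K" using ij by fastforce
    let ?mx = "\<lambda>d. max (n d - 1) (n' d - 1)"
    have ne: "\<exists>d. \<nu> d div dir.P d (?mx d) \<noteq> \<mu> d div dir.P d (?mx d)"
      if \<nu>: "\<nu> \<in> J k" "level (\<tau> k) \<nu> = n" and \<mu>: "\<mu> \<in> J l" "level (\<tau> l) \<mu> = n'" for \<nu> \<mu>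
    proof (rule ccontr)
      assume "\<not> ?thesis"
      then have eq: "\<nu> d div dir.P d (?mx d) = \<mu> d div dir.P d (?mx d)" for d by blast
      \<comment> \<open>In each direction the larger of the two generations decides: the frequency of the other piece is taken.\<close>
      define \<kappa> where "\<kappa> d = (if n' d - 1 \<le> n d - 1 then \<mu> d else \<nu> d)" for d
      have "\<kappa> \<in> J k"
      proof (rule same_J[OF \<nu>])
        show "\<kappa> d = \<nu> d \<or> \<kappa> d div dir.P d (n d - 1) = \<nu> d div dir.P d (n d - 1)" for d
          using eq[of d] by (cases "n' d - 1 \<le> n d - 1") (simp_all add: \<kappa>_def max_def)
      qed
      moreover have "\<kappa> \<in> J l"
      proof (rule same_J[OF \<mu>])
        show "\<kappa> d = \<mu> d \<or> \<kappa> d div dir.P d (n' d - 1) = \<mu> d div dir.P d (n' d - 1)" for d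
          using eq[of d] by (cases "n' d - 1 \<le> n d - 1") (simp_all add: \<kappa>_def max_def)
      qed
      ultimately have kl: "k = l" using disj[OF kn(2,4)] J_R unfolding R_def by blast
      \<comment> \<open>For the same rectangle the depths differ in some direction; there only one of the frequencies agrees with the corner from the larger generation minus one upwards.\<close>
      then have "n \<noteq> n'" using ij(3) kn by auto
      then obtain d where d: "n d \<noteq> n' d" by (auto simp: fun_eq_iff)
      have nd: "n d = dir.depth d (\<nu> d) (\<tau> k d)" "n' d = dir.depth d (\<mu> d) (\<tau> k d)"
        using \<nu>(2) \<mu>(2) kl by (auto simp: level_def)
      show False
      proof (cases "n d < n' d")
        case True
        then have "?mx d = n' d - 1" by simp
        then have e: "\<nu> d div dir.P d (n' d - 1) = \<mu> d div dir.P d (n' d - 1)" using eq[of d] by simp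
        have "\<nu> d div dir.P d (n' d - 1) = \<tau> k d div dir.P d (n' d - 1)"
          using True nd(1) by (intro dir.depth_le_iff[THEN iffD1]) simp
        then have "dir.depth d (\<mu> d) (\<tau> k d) \<le> n' d - 1" using e by (simp add: dir.depth_le_iff)
        then show False using nd(2) True by simp
      next
        case False
        then have lt: "n' d < n d" using d by simp
        then have "?mx d = n d - 1" by simp
        then have e: "\<nu> d div dir.P d (n d - 1) = \<mu> d div dir.P d (n d - 1)" using eq[of d] by simp
        have "\<mu> d div dir.P d (n d - 1) = \<tau> k d div dir.P d (n d - 1)"
          using lt nd(2) by (intro dir.depth_le_iff[THEN iffD1]) simp
        then have "dir.depth d (\<nu> d) (\<tau> k d) \<le> n d - 1" using e by (simp add: dir.depth_le_iff)
        then show False using nd(1) lt by simp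
      qed
    qed
    have "(\<Sum>y\<in>cell ?mx x. F i y * cnj (F j y)) = 0"
      unfolding F_def kn fst_conv snd_conv
    proof (rule grid_poly_orthogonal)
      show "{\<nu> \<in> J k. level (\<tau> k) \<nu> = n} \<subseteq> points" "{\<nu> \<in> J l. level (\<tau> l) \<nu> = n'} \<subseteq> points"
        using J_R R_points kn by blast+
    qed (use ne in blast)
    then show "(\<Sum>y\<in>cell (\<lambda>d. max (snd i d - 1) (snd j d - 1)) x. F i y * cnj (F j y)) = 0"
      by (simp add: kn)
  qed (use p in auto)
  moreover have "(\<Sum>i\<in>?I. F i x) = (\<Sum>k\<in>K. grid_poly (cf k) (J k) x)" for x
  proof -
    have "(\<Sum>i\<in>?I. F i x) = (\<Sum>k\<in>K. \<Sum>n\<in>levels. F (k, n) x)" by (simp add: sum.cartesian_product)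
    also have "\<dots> = (\<Sum>k\<in>K. grid_poly (cf k) (J k) x)" by (intro sum.cong refl F_sum[symmetric])
    finally show ?thesis .
  qed
  moreover have "(\<Sum>i\<in>?I. (cmod (G i x))\<^sup>2)
      = (\<Sum>k\<in>K. \<Sum>n\<in>levels. (cmod (grid_poly (cf k) {\<nu> \<in> R k. level (\<tau> k) \<nu> = n} x))\<^sup>2)" for x
    by (simp add: sum.cartesian_product G_def split_beta)
  ultimately show ?thesis by (simp only: J_def R_def \<tau>_def)
qed

text \<open>
  The frequencies are distributed to the corners, and the \<open>p\<close>-th power is subadditive.
\<close>
theorem rectangles_bound:
  fixes a b :: "'k \<Rightarrow> 'd \<Rightarrow> nat" and cf :: "'k \<Rightarrow> ('d \<Rightarrow> nat) \<Rightarrow> complex"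
  assumes p: "0 < p" "p \<le> 1" and M: "\<And>d k. m d k \<le> M" and K: "finite K"
    and ab: "\<And>k. k \<in> K \<Longrightarrow> a k \<in> points" "\<And>k. k \<in> K \<Longrightarrow> b k \<in> points"
    and disj: "\<And>k l. k \<in> K \<Longrightarrow> l \<in> K \<Longrightarrow> k \<noteq> l \<Longrightarrow> rectangle (a k) (b k) \<inter> rectangle (a l) (b l) = {}"
  shows "(\<Sum>x\<in>points. cmod (\<Sum>k\<in>K. grid_poly (cf k) (rectangle (a k) (b k)) x) powr p)
    \<le> 9 * (2 ^ CARD('d) * (2 * real M ^ CARD('d))) ^ CARD('d) / (1 - 2 powr - p)
      * (\<Sum>c\<in>UNIV. \<Sum>x\<in>points. (\<Sum>k\<in>K. \<Sum>n\<in>levels.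
          (cmod (grid_poly (cf k) {\<nu> \<in> rectangle (a k) (b k). level (corner c (a k) (b k)) \<nu> = n} x))\<^sup>2) powr (p / 2))"
proof -
  let ?F = "\<lambda>c x. \<Sum>k\<in>K. grid_poly (cf k) (endpoint_parts c (a k) (b k)) x"
  have "(\<Sum>x\<in>points. cmod (\<Sum>k\<in>K. grid_poly (cf k) (rectangle (a k) (b k)) x) powr p)
      = (\<Sum>x\<in>points. cmod (\<Sum>c\<in>UNIV. ?F c x) powr p)"
    unfolding grid_poly_rectangle by (subst sum.swap) (rule refl)
  also have "\<dots> \<le> (\<Sum>x\<in>points. \<Sum>c\<in>UNIV. cmod (?F c x) powr p)"
    by (intro sum_mono norm_sum_powr_le p)
  also have "\<dots> = (\<Sum>c\<in>UNIV. \<Sum>x\<in>points. cmod (?F c x) powr p)" by (rule sum.swap)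
  also have "\<dots> \<le> (\<Sum>c\<in>UNIV. 9 * (2 ^ CARD('d) * (2 * real M ^ CARD('d))) ^ CARD('d) / (1 - 2 powr - p)
      * (\<Sum>x\<in>points. (\<Sum>k\<in>K. \<Sum>n\<in>levels.
          (cmod (grid_poly (cf k) {\<nu> \<in> rectangle (a k) (b k). level (corner c (a k) (b k)) \<nu> = n} x))\<^sup>2) powr (p / 2)))"
    by (intro sum_mono corner_bound assms)
  finally show ?thesis by (simp only: sum_distrib_left)
qed

end

section \<open>From the grid to the unit cube\<close>

context generators
begin

lemma floor_addr:
  assumes "0 \<le> t" "j \<le> N"
  shows "nat \<lfloor>t * real (P j)\<rfloor> = addr N j (nat \<lfloor>t * real (P N)\<rfloor>)"
proof -
  define R where "R = P N div P j"
  have PN: "P N = P j * R" using P_split[OF assms(2)] by (simp add: R_def)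
  have R: "0 < R" using PN P_pos[of N] by (cases R) auto
  have "\<lfloor>t * real (P j)\<rfloor> = \<lfloor>t * real (P N) / of_int (int R)\<rfloor>"
    using R by (simp add: PN)
  also have "\<dots> = \<lfloor>t * real (P N)\<rfloor> div int R"
    by (rule floor_divide_real_eq_div) simp
  finally show ?thesis
    using assms by (simp add: nat_div_distrib' addr_eq_div R_def)
qed

lemma floor_eq_iff_cell:
  assumes "0 \<le> t"
  shows "nat \<lfloor>t * real (P j)\<rfloor> = l \<longleftrightarrow> real l / real (P j) \<le> t \<and> t < (real l + 1) / real (P j)"
proof -
  have "nat \<lfloor>t * real (P j)\<rfloor> = l \<longleftrightarrow> \<lfloor>t * real (P j)\<rfloor> = int l" using assms by auto
  also have "\<dots> \<longleftrightarrow> real l \<le> t * real (P j) \<and> t * real (P j) < real l + 1"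
    by (simp add: floor_eq_iff)
  also have "\<dots> \<longleftrightarrow> real l / real (P j) \<le> t \<and> t < (real l + 1) / real (P j)"
    using P_pos[of j] by (simp add: pos_divide_le_eq pos_less_divide_eq)
  finally show ?thesis .
qed

lemma vilenkin_eq_grid_char:
  assumes t: "0 \<le> t" "t < 1" and \<nu>: "\<nu> < P N"
  shows "vilenkin m \<nu> t = grid_char N \<nu> (nat \<lfloor>t * real (P N)\<rfloor>)"
proof -
  let ?y = "nat \<lfloor>t * real (P N)\<rfloor>"
  have digit: "vil_nat_digit m \<nu> k = \<nu> div P k mod m k" for k
    by (rule vil_nat_digit_eq(2)[OF two_le])
  have "vilenkin m \<nu> t = (\<Prod>k | vil_nat_digit m \<nu> k \<noteq> 0. unit_root k (vil_digit m t k) ^ (\<nu> div P k mod m k))"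
    by (simp add: vilenkin_def unit_root_def digit)
  also have "\<dots> = (\<Prod>k<N. unit_root k (vil_digit m t k) ^ (\<nu> div P k mod m k))"
  proof (rule prod.mono_neutral_left)
    have zero: "\<nu> div P k = 0" if "N \<le> k" for k
    proof -
      have "P N \<le> P k" using vil_prod_dvd[OF that, of m] P_pos[of k] by (rule dvd_imp_le)
      then show ?thesis using \<nu> by simp
    qed
    show "{k. vil_nat_digit m \<nu> k \<noteq> 0} \<subseteq> {..<N}"
    proof
      fix k assume "k \<in> {k. vil_nat_digit m \<nu> k \<noteq> 0}"
      then have "\<nu> div P k mod m k \<noteq> 0" by (simp add: digit)
      then have "\<not> N \<le> k" using zero by (metis mod_0)
      then show "k \<in> {..<N}" by simp
    qed
  qed (auto simp: digit)
  also have "\<dots> = grid_char N \<nu> ?y"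
    unfolding grid_char_def
  proof (rule prod.cong[OF refl])
    fix k assume "k \<in> {..<N}"
    then have "vil_digit m t k = addr N (Suc k) ?y mod m k"
      using vil_digit_eq(2)[of m t k, OF two_le t] floor_addr[OF t(1), of "Suc k" N] by simp
    then have "unit_root k (vil_digit m t k) = unit_root k (addr N (Suc k) ?y)" by (simp add: unit_root_eq_iff)
    then show "unit_root k (vil_digit m t k) ^ (\<nu> div P k mod m k) = unit_root k (addr N (Suc k) ?y) ^ (\<nu> div P k mod m k)"
      by simp
  qed
  finally show ?thesis .
qed

end

context vilenkin_grid
begin

text \<open>
  The grid point to the lower left of \<open>x\<close>. Characters with frequencies below \<open>P N\<close> depend on
  \<open>x\<close> only through it.
\<close>
definition idx :: "real ^ 'd \<Rightarrow> 'd \<Rightarrow> nat" where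
  "idx x d = nat \<lfloor>x $ d * real (dir.P d N)\<rfloor>"

definition cell_volume :: real where
  "cell_volume = 1 / (\<Prod>d\<in>UNIV. real (dir.P d N))"

lemma cell_volume_pos: "0 < cell_volume"
  unfolding cell_volume_def using dir.P_pos by (simp add: prod_pos)

lemma idx_points: "x \<in> cube \<Longrightarrow> idx x \<in> points"
  unfolding points_iff
proof
  fix d assume "x \<in> cube"
  then have "0 \<le> x $ d" "x $ d < 1" by (auto simp: cube_def)
  then have "x $ d * real (dir.P d N) < real (dir.P d N)" using dir.P_pos[of d N] by simp
  then have "\<lfloor>x $ d * real (dir.P d N)\<rfloor> < int (dir.P d N)" by (simp add: floor_less_iff)
  then show "idx x d < dir.P d N" using dir.P_pos[of d N] by (simp add: idx_def nat_less_iff)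
qed

lemma vil_cell_iff:
  assumes "x \<in> cube" "\<And>d. n d \<le> N"
  shows "x \<in> vil_cell m n l \<longleftrightarrow> (\<forall>d. dir.addr d N (n d) (idx x d) = l d)"
proof -
  have "0 \<le> x $ d" for d using assms(1) by (simp add: cube_def)
  then show ?thesis
    unfolding vil_cell_def mem_Collect_eq idx_def
    by (simp add: dir.floor_eq_iff_cell[symmetric] dir.floor_addr[OF _ assms(2), symmetric])
qed

lemma idx_eq_iff: "x \<in> cube \<Longrightarrow> idx x = y \<longleftrightarrow> x \<in> vil_cell m (\<lambda>_. N) y"
  using dir.P_pos by (subst vil_cell_iff) (auto simp: dir.addr_eq_div fun_eq_iff)

lemma vil_cell_subset_cube:
  assumes "\<And>d. l d < dir.P d (n d)"
  shows "vil_cell m n l \<subseteq> cube"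
proof
  fix x assume x: "x \<in> vil_cell m n l"
  have "0 \<le> x $ d \<and> x $ d < 1" for d
  proof -
    have "0 \<le> real (l d) / real (dir.P d (n d))" by simp
    moreover have "(real (l d) + 1) / real (dir.P d (n d)) \<le> 1" using assms[of d] by simp
    ultimately show ?thesis using x unfolding vil_cell_def mem_Collect_eq by (metis order.trans order_less_le_trans)
  qed
  then show "x \<in> cube" by (simp add: cube_def)
qed

lemma vil_cell_borel: "vil_cell m n l \<in> sets borel"
  unfolding vil_cell_def by measurable

lemma cube_lebesgue: "cube \<in> sets (lebesgue :: (real ^ 'd) measure)"
proof -
  have "cube \<in> sets (borel :: (real ^ 'd) measure)" unfolding cube_def by measurable
  then show ?thesis by simp
qed

lemma vil_cell_sets: "vil_cell m n l \<inter> cube \<in> sets cubeM"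
  using vil_cell_borel[of n l] cube_lebesgue by (simp add: sets_restrict_space_iff sets.Int)

lemma emeasure_vil_cell:
  assumes "y \<in> points"
  shows "emeasure cubeM (vil_cell m (\<lambda>_. N) y) = ennreal cell_volume"
proof -
  let ?a = "\<chi> d. real (y d) / real (dir.P d N)" and ?b = "\<chi> d. (real (y d) + 1) / real (dir.P d N)"
  let ?C = "vil_cell m (\<lambda>_. N) y"
  have sub: "?C \<subseteq> cube" using assms by (intro vil_cell_subset_cube) (simp add: points_iff)
  have Pp: "0 < real (dir.P d N)" for d using dir.P_pos by simp
  have le: "?a $ d \<le> ?b $ d" for d using Pp[of d] by (simp add: divide_right_mono)
  have ne: "cbox ?a ?b \<noteq> {}" using le by (auto simp: interval_ne_empty_cart)
  have c: "measure lborel (cbox ?a ?b) = cell_volume"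
    using Pp by (simp add: content_cbox_cart[OF ne] cell_volume_def prod_dividef diff_divide_distrib[symmetric])
  have "emeasure lborel (cbox ?a ?b) = ennreal cell_volume"
    using c emeasure_eq_ennreal_measure[of lborel "cbox ?a ?b"] emeasure_lborel_cbox_finite[of ?a ?b] by simp
  moreover have "emeasure lborel (box ?a ?b) = emeasure lborel (cbox ?a ?b)"
    by (simp add: emeasure_lborel_box_eq emeasure_lborel_cbox_eq)
  moreover have "emeasure lborel (box ?a ?b) \<le> emeasure lborel ?C"
    using vil_cell_borel by (intro emeasure_mono) (auto simp: mem_box_cart vil_cell_def less_imp_le)
  moreover have "emeasure lborel ?C \<le> emeasure lborel (cbox ?a ?b)"
    by (intro emeasure_mono) (auto simp: mem_box_cart vil_cell_def less_imp_le)
  ultimately have "emeasure lborel ?C = ennreal cell_volume" by (simp add: order.antisym)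
  moreover have "emeasure cubeM ?C = emeasure lborel ?C"
    using cube_lebesgue sub vil_cell_borel by (simp add: emeasure_restrict_space)
  ultimately show ?thesis by simp
qed

lemma idx_measurable: "idx \<in> measurable cubeM (count_space UNIV)"
proof (rule measurable_count_space_eq2_countable[THEN iffD2, rule_format], intro conjI ballI)
  fix y
  have "idx -` {y} \<inter> space cubeM = vil_cell m (\<lambda>_. N) y \<inter> cube"
    using idx_eq_iff by (auto simp: space_restrict_space)
  then show "idx -` {y} \<inter> space cubeM \<in> sets cubeM" using vil_cell_sets by simp
qed auto

lemma idx_measurable': "(\<lambda>x. f (idx x)) \<in> borel_measurable cubeM"
  using measurable_compose[OF idx_measurable, of f borel] by simp

lemma idx_expand:
  fixes f :: "('d \<Rightarrow> nat) \<Rightarrow> 'a::semiring_1"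
  assumes "x \<in> cube"
  shows "f (idx x) = (\<Sum>y\<in>points. f y * indicator (vil_cell m (\<lambda>_. N) y) x)"
proof -
  have "(\<Sum>y\<in>points. f y * indicator (vil_cell m (\<lambda>_. N) y) x) = (\<Sum>y\<in>points. if y = idx x then f y else 0)"
    by (intro sum.cong) (auto simp: indicator_def idx_eq_iff[OF assms, symmetric])
  then show ?thesis using idx_points[OF assms] finite_points by simp
qed

lemma vil_cell_in_sets:
  assumes "y \<in> points"
  shows "vil_cell m (\<lambda>_. N) y \<in> sets cubeM"
proof -
  have "vil_cell m (\<lambda>_. N) y \<subseteq> cube" using assms by (intro vil_cell_subset_cube) (simp add: points_iff)
  then show ?thesis using vil_cell_sets[of "\<lambda>_. N" y] by (simp add: Int_absorb2)
qed

lemma nn_integral_idx: "(\<integral>\<^sup>+x. f (idx x) \<partial>cubeM) = ennreal cell_volume * (\<Sum>y\<in>points. f y)"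
proof -
  have "(\<integral>\<^sup>+x. f (idx x) \<partial>cubeM)
      = (\<integral>\<^sup>+x. (\<Sum>y\<in>points. f y * indicator (vil_cell m (\<lambda>_. N) y) x) \<partial>cubeM)"
    by (intro nn_integral_cong idx_expand) (simp add: space_restrict_space)
  also have "\<dots> = (\<Sum>y\<in>points. \<integral>\<^sup>+x. f y * indicator (vil_cell m (\<lambda>_. N) y) x \<partial>cubeM)"
    by (rule nn_integral_sum) (intro borel_measurable_times_ennreal borel_measurable_const borel_measurable_indicator vil_cell_in_sets)
  also have "\<dots> = (\<Sum>y\<in>points. f y * ennreal cell_volume)"
    by (intro sum.cong refl) (simp add: nn_integral_cmult_indicator vil_cell_in_sets emeasure_vil_cell)
  finally show ?thesis by (simp add: sum_distrib_left mult.commute)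
qed

lemma
  fixes f :: "('d \<Rightarrow> nat) \<Rightarrow> real"
  shows integrable_idx: "integrable cubeM (\<lambda>x. f (idx x))"
    and integral_idx: "(\<integral>x. f (idx x) \<partial>cubeM) = cell_volume * (\<Sum>y\<in>points. f y)"
proof -
  have 1: "has_bochner_integral cubeM (\<lambda>x. f y * indicator (vil_cell m (\<lambda>_. N) y) x) (f y * cell_volume)"
    if "y \<in> points" for y
  proof -
    have "measure cubeM (vil_cell m (\<lambda>_. N) y) = cell_volume"
      using cell_volume_pos by (simp add: measure_def emeasure_vil_cell that)
    then have "has_bochner_integral cubeM (indicator (vil_cell m (\<lambda>_. N) y) :: _ \<Rightarrow> real) cell_volume"
      using has_bochner_integral_real_indicator[of "vil_cell m (\<lambda>_. N) y" cubeM] that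
      by (simp add: vil_cell_in_sets emeasure_vil_cell)
    then show ?thesis by (intro has_bochner_integral_mult_right) auto
  qed
  have "has_bochner_integral cubeM (\<lambda>x. \<Sum>y\<in>points. f y * indicator (vil_cell m (\<lambda>_. N) y) x) (\<Sum>y\<in>points. f y * cell_volume)"
    by (intro has_bochner_integral_sum 1)
  moreover have "has_bochner_integral cubeM (\<lambda>x. \<Sum>y\<in>points. f y * indicator (vil_cell m (\<lambda>_. N) y) x) = has_bochner_integral cubeM (\<lambda>x. f (idx x))"
    by (intro ext has_bochner_integral_cong refl idx_expand[symmetric]) (simp add: space_restrict_space)
  ultimately have *: "has_bochner_integral cubeM (\<lambda>x. f (idx x)) (\<Sum>y\<in>points. f y * cell_volume)" by simp
  show "integrable cubeM (\<lambda>x. f (idx x))" using * by (rule integrable.intros)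
  show "(\<integral>x. f (idx x) \<partial>cubeM) = cell_volume * (\<Sum>y\<in>points. f y)"
    using has_bochner_integral_integral_eq[OF *] by (simp add: sum_distrib_left mult.commute)
qed

lemma finite_measure_cubeM: "finite_measure (cubeM :: (real ^ 'd) measure)"
proof
  have "emeasure (cubeM :: (real ^ 'd) measure) (space cubeM) = (\<integral>\<^sup>+x. (\<lambda>_. 1) (idx x) \<partial>cubeM)" by simp
  also have "\<dots> = ennreal cell_volume * (\<Sum>y\<in>points. 1)" by (rule nn_integral_idx)
  finally show "emeasure (cubeM :: (real ^ 'd) measure) (space cubeM) \<noteq> \<infinity>"
    by (simp add: ennreal_mult_eq_top_iff)
qed

lemma sigma_finite_subalgebra_vil: "sigma_finite_subalgebra cubeM (vil_algebra m n)"
proof -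
  interpret finite_measure "cubeM :: (real ^ 'd) measure" by (rule finite_measure_cubeM)
  have "finite_measure_subalgebra cubeM (vil_algebra m n)"
    by unfold_locales (rule subalgebra_vil_algebra[OF two_le])
  then show ?thesis by (rule finite_measure_subalgebra_is_sigma_finite)
qed

definition cell_address :: "('d \<Rightarrow> nat) \<Rightarrow> ('d \<Rightarrow> nat) \<Rightarrow> 'd \<Rightarrow> nat" where
  "cell_address n y d = dir.addr d N (n d) (y d)"

lemma cell_cell_address: "cell n x = {y \<in> points. cell_address n y = cell_address n x}"
  by (auto simp: slice_def cell_address_def fun_eq_iff)

lemma space_vil_algebra: "space (vil_algebra m n) = cube"
  by (simp add: vil_algebra_def space_measure_of_conv)

lemma sets_vil_algebra:
  "sets (vil_algebra m n) = sigma_sets cube {vil_cell m n l | l. \<forall>d. l d < dir.P d (n d)}"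
  unfolding vil_algebra_def
  by (rule sets_measure_of) (use vil_cell_subset_cube in blast)

text \<open>
  The algebra is generated by a finite partition, hence consists of unions of cells. Stating this through the
  addresses of cells makes the closure under complements and countable unions immediate.
\<close>
lemma vil_algebra_saturated:
  assumes n: "\<And>d. n d \<le> N" and A: "A \<in> sets (vil_algebra m n)"
  obtains L where "A = {x \<in> cube. cell_address n (idx x) \<in> L}"
proof -
  from A have "A \<in> sigma_sets cube {vil_cell m n l | l. \<forall>d. l d < dir.P d (n d)}"
    by (simp add: sets_vil_algebra)
  then have "\<exists>L. A = {x \<in> cube. cell_address n (idx x) \<in> L}"
  proof induction
    case (Basic A)
    then obtain l where l: "A = vil_cell m n l" "\<forall>d. l d < dir.P d (n d)" by blast
    have "A = {x \<in> cube. cell_address n (idx x) \<in> {l}}"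
      using vil_cell_subset_cube[of l n] l vil_cell_iff[OF _ n]
      by (auto simp: cell_address_def fun_eq_iff)
    then show ?case by blast
  next
    case Empty
    show ?case by (rule exI[of _ "{}"]) simp
  next
    case (Compl A)
    then obtain L where "A = {x \<in> cube. cell_address n (idx x) \<in> L}" by blast
    then show ?case by (intro exI[of _ "- L"]) auto
  next
    case (Union A)
    then have "\<forall>i. \<exists>L. A i = {x \<in> cube. cell_address n (idx x) \<in> L}" by blast
    from choice[OF this] obtain L where "\<And>i. A i = {x \<in> cube. cell_address n (idx x) \<in> L i}" by blast
    then show ?case by (intro exI[of _ "\<Union>i. L i"]) auto
  qed
  then show ?thesis using that by blast
qed

lemma vil_algebra_measurable:
  fixes f :: "('d \<Rightarrow> nat) \<Rightarrow> 'a::topological_space"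
  assumes n: "\<And>d. n d \<le> N" and const: "\<And>x y. x \<in> points \<Longrightarrow> y \<in> cell n x \<Longrightarrow> f y = f x"
  shows "(\<lambda>x. f (idx x)) \<in> borel_measurable (vil_algebra m n)"
proof (rule measurableI)
  fix B :: "'a set" assume "B \<in> sets borel"
  define L where "L = cell_address n ` {y \<in> points. f y \<in> B}"
  have fin: "finite L" by (simp add: L_def finite_points)
  have "(\<lambda>x. f (idx x)) -` B \<inter> space (vil_algebra m n) = (\<Union>l\<in>L. vil_cell m n l)"
  proof (intro set_eqI iffI)
    fix x assume "x \<in> (\<lambda>x. f (idx x)) -` B \<inter> space (vil_algebra m n)"
    then have x: "f (idx x) \<in> B" "x \<in> cube" by (auto simp: space_vil_algebra)
    then have "cell_address n (idx x) \<in> L" using idx_points by (auto simp: L_def)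
    moreover have "x \<in> vil_cell m n (cell_address n (idx x))" using vil_cell_iff[OF x(2) n] by (simp add: cell_address_def)
    ultimately show "x \<in> (\<Union>l\<in>L. vil_cell m n l)" by blast
  next
    fix x assume "x \<in> (\<Union>l\<in>L. vil_cell m n l)"
    then obtain y where y: "y \<in> points" "f y \<in> B" "x \<in> vil_cell m n (cell_address n y)" by (auto simp: L_def)
    have "cell_address n y d < dir.P d (n d)" for d using y(1) by (simp add: cell_address_def dir.addr_less points_iff)
    then have x: "x \<in> cube" using vil_cell_subset_cube y(3) by blast
    then have "cell_address n (idx x) = cell_address n y"
      using vil_cell_iff[OF x n, THEN iffD1, OF y(3)] by (intro ext) (simp add: cell_address_def)
    then have "idx x \<in> cell n y" using idx_points[OF x] by (simp add: cell_cell_address)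
    then show "x \<in> (\<lambda>x. f (idx x)) -` B \<inter> space (vil_algebra m n)"
      using const[OF y(1)] y(2) x by (simp add: space_vil_algebra)
  qed
  also have "\<dots> \<in> sets (vil_algebra m n)"
  proof (intro sets.finite_UN fin)
    fix l assume "l \<in> L"
    then obtain y where "y \<in> points" "l = cell_address n y" by (auto simp: L_def)
    then have "\<forall>d. l d < dir.P d (n d)" by (simp add: cell_address_def dir.addr_less points_iff)
    then show "vil_cell m n l \<in> sets (vil_algebra m n)" unfolding sets_vil_algebra by blast
  qed
  finally show "(\<lambda>x. f (idx x)) -` B \<inter> space (vil_algebra m n) \<in> sets (vil_algebra m n)" .
qed simp

text \<open>
  On grid functions the conditional expectation is the averaging over cells: \<open>g\<close> is constant on
  the cells and has the same sum over each of them as \<open>f\<close>.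
\<close>
lemma real_cond_exp_idx:
  fixes f g :: "('d \<Rightarrow> nat) \<Rightarrow> real"
  assumes n: "\<And>d. n d \<le> N" and const: "\<And>x y. x \<in> points \<Longrightarrow> y \<in> cell n x \<Longrightarrow> g y = g x"
    and mean: "\<And>x. x \<in> points \<Longrightarrow> (\<Sum>y\<in>cell n x. f y) = (\<Sum>y\<in>cell n x. g y)"
  shows "AE x in cubeM. real_cond_exp cubeM (vil_algebra m n) (\<lambda>x. f (idx x)) x = g (idx x)"
proof -
  interpret sigma_finite_subalgebra "cubeM :: (real ^ 'd) measure" "vil_algebra m n"
    by (rule sigma_finite_subalgebra_vil)
  show ?thesis
  proof (rule real_cond_exp_charact)
    fix A assume "A \<in> sets (vil_algebra m n)"
    from vil_algebra_saturated[OF n this] obtain L where L: "A = {x \<in> cube. cell_address n (idx x) \<in> L}" .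
    have set_int: "(\<integral>x\<in>A. h (idx x) \<partial>cubeM) = cell_volume * (\<Sum>y\<in>{y \<in> points. cell_address n y \<in> L}. h y)"
      for h :: "('d \<Rightarrow> nat) \<Rightarrow> real"
    proof -
      have "(\<integral>x\<in>A. h (idx x) \<partial>cubeM) = (\<integral>x. (\<lambda>y. if cell_address n y \<in> L then h y else 0) (idx x) \<partial>cubeM)"
        unfolding set_lebesgue_integral_def
        by (intro Bochner_Integration.integral_cong) (auto simp: L space_restrict_space indicator_def)
      also have "\<dots> = cell_volume * (\<Sum>y\<in>points. if cell_address n y \<in> L then h y else 0)" by (rule integral_idx)
      also have "(\<Sum>y\<in>points. if cell_address n y \<in> L then h y else 0) = (\<Sum>y\<in>{y \<in> points. cell_address n y \<in> L}. h y)"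
        by (simp add: sum.inter_filter[symmetric] finite_points)
      finally show ?thesis .
    qed
    let ?X = "{y \<in> points. cell_address n y \<in> L}"
    have "sum h ?X = (\<Sum>B\<in>cell n ` ?X. sum h B)" for h :: "('d \<Rightarrow> nat) \<Rightarrow> real"
      by (rule sum_by_cells) (auto simp: finite_points cell_cell_address)
    moreover have "(\<Sum>B\<in>cell n ` ?X. sum f B) = (\<Sum>B\<in>cell n ` ?X. sum g B)"
      by (rule sum.cong[OF refl]) (use mean in auto)
    ultimately show "(\<integral>x\<in>A. f (idx x) \<partial>cubeM) = (\<integral>x\<in>A. g (idx x) \<partial>cubeM)"
      unfolding set_int by simp
  next
    show "(\<lambda>x. g (idx x)) \<in> borel_measurable (vil_algebra m n)"
      by (rule vil_algebra_measurable[OF n const])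
  qed (rule integrable_idx)+
qed

lemma vil_exp_idx:
  assumes n: "\<And>d. n d \<le> N" and const: "\<And>x y. x \<in> points \<Longrightarrow> y \<in> cell n x \<Longrightarrow> g y = g x"
    and mean: "\<And>x. x \<in> points \<Longrightarrow> (\<Sum>y\<in>cell n x. f y) = (\<Sum>y\<in>cell n x. g y)"
    and h: "h \<in> borel_measurable cubeM" "AE x in cubeM. h x = f (idx x)"
  shows "AE x in cubeM. vil_exp m n h x = g (idx x)"
proof -
  interpret sigma_finite_subalgebra "cubeM :: (real ^ 'd) measure" "vil_algebra m n"
    by (rule sigma_finite_subalgebra_vil)
  have part: "AE x in cubeM. real_cond_exp cubeM (vil_algebra m n) (\<lambda>x. u (h x)) x = u (g (idx x))"
    if u: "u \<in> borel_measurable borel" "\<And>A (F :: ('d \<Rightarrow> nat) \<Rightarrow> complex). u (sum F A) = (\<Sum>y\<in>A. u (F y))" for u :: "complex \<Rightarrow> real"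
  proof -
    have m1: "(\<lambda>x. u (h x)) \<in> borel_measurable cubeM" using u(1) h(1) by simp
    have m2: "(\<lambda>x. u (f (idx x))) \<in> borel_measurable cubeM" by (rule idx_measurable')
    have "AE x in cubeM. u (h x) = u (f (idx x))" using h(2) by eventually_elim simp
    from real_cond_exp_cong[OF this m1 m2]
    have 1: "AE x in cubeM. real_cond_exp cubeM (vil_algebra m n) (\<lambda>x. u (h x)) x
        = real_cond_exp cubeM (vil_algebra m n) (\<lambda>x. u (f (idx x))) x" .
    have 2: "AE x in cubeM. real_cond_exp cubeM (vil_algebra m n) (\<lambda>x. u (f (idx x))) x = u (g (idx x))"
    proof (rule real_cond_exp_idx[OF n])
      show "u (g y) = u (g x)" if "x \<in> points" "y \<in> cell n x" for x y using const[OF that] by simp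
      show "(\<Sum>y\<in>cell n x. u (f y)) = (\<Sum>y\<in>cell n x. u (g y))" if "x \<in> points" for x
        using mean[OF that] u(2)[of f "cell n x"] u(2)[of g "cell n x"] by simp
    qed
    show ?thesis using 1 2 by eventually_elim simp
  qed
  have "AE x in cubeM. real_cond_exp cubeM (vil_algebra m n) (\<lambda>x. Re (h x)) x = Re (g (idx x))"
    by (rule part) auto
  moreover have "AE x in cubeM. real_cond_exp cubeM (vil_algebra m n) (\<lambda>x. Im (h x)) x = Im (g (idx x))"
    by (rule part) auto
  ultimately show ?thesis by eventually_elim (simp add: vil_exp_def)
qed

end

section \<open>Martingale differences of modulated polynomials\<close>

lemma sum_le_infsum_ennreal:
  fixes f :: "'a \<Rightarrow> ennreal"
  assumes "finite F"
  shows "sum f F \<le> infsum f UNIV"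
proof -
  have "infsum f UNIV = (SUP F\<in>{F. finite F \<and> F \<subseteq> UNIV}. sum f F)"
    by (rule nonneg_infsum_complete) simp
  then show ?thesis using assms by (auto intro: SUP_upper)
qed

definition vil_poly ::
  "('d::finite \<Rightarrow> nat \<Rightarrow> nat) \<Rightarrow> (('d \<Rightarrow> nat) \<Rightarrow> complex) \<Rightarrow> ('d \<Rightarrow> nat) set \<Rightarrow> real ^ 'd \<Rightarrow> complex" where
  "vil_poly m c R x = (\<Sum>\<nu>\<in>R. c \<nu> * vilenkinD m \<nu> x)"

text \<open>
  The sum over \<open>n\<close> of the squared moduli of the martingale differences of \<open>v\<^sub>\<tau>\<^sup>-\<^sup>1 f\<close> for the polynomial \<open>f\<close> with
  coefficients \<open>c\<close> and spectrum in \<open>R\<close>, without reference to a grid. Only the finitely many depths that occur in \<open>R\<close> are summed.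
\<close>
definition square_sum ::
  "('d::finite \<Rightarrow> nat \<Rightarrow> nat) \<Rightarrow> (('d \<Rightarrow> nat) \<Rightarrow> complex) \<Rightarrow> ('d \<Rightarrow> nat) \<Rightarrow> ('d \<Rightarrow> nat) set \<Rightarrow> real ^ 'd \<Rightarrow> real" where
  "square_sum m c \<tau> R x = (\<Sum>n\<in>vilenkin_grid.level m \<tau> ` R.
     (cmod (vil_poly m c {\<nu> \<in> R. vilenkin_grid.level m \<tau> \<nu> = n} x))\<^sup>2)"

lemma square_sum_nonneg: "0 \<le> square_sum m c \<tau> R x"
  by (simp add: square_sum_def sum_nonneg)

context vilenkin_grid
begin

lemma vilenkinD_idx:
  assumes "x \<in> cube" "\<nu> \<in> points"
  shows "vilenkinD m \<nu> x = grid_charD \<nu> (idx x)"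
  unfolding vilenkinD_def grid_charD_def idx_def
  using assms by (intro prod.cong refl dir.vilenkin_eq_grid_char) (auto simp: cube_def points_iff)

lemma vil_poly_idx: "x \<in> cube \<Longrightarrow> R \<subseteq> points \<Longrightarrow> vil_poly m c R x = grid_poly c R (idx x)"
  unfolding vil_poly_def grid_poly_def by (intro sum.cong refl) (auto simp: vilenkinD_idx)

lemma square_sum_idx:
  assumes x: "x \<in> cube" and R: "R \<subseteq> points" and \<tau>: "\<tau> \<in> points"
  shows "square_sum m c \<tau> R x = (\<Sum>n\<in>levels. (cmod (grid_poly c {\<nu> \<in> R. level \<tau> \<nu> = n} (idx x)))\<^sup>2)"
proof -
  have "square_sum m c \<tau> R x = (\<Sum>n\<in>level \<tau> ` R. (cmod (grid_poly c {\<nu> \<in> R. level \<tau> \<nu> = n} (idx x)))\<^sup>2)"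
    unfolding square_sum_def
  proof (rule sum.cong[OF refl])
    fix n
    have "{\<nu> \<in> R. level \<tau> \<nu> = n} \<subseteq> points" using R by blast
    then show "(cmod (vil_poly m c {\<nu> \<in> R. level \<tau> \<nu> = n} x))\<^sup>2 = (cmod (grid_poly c {\<nu> \<in> R. level \<tau> \<nu> = n} (idx x)))\<^sup>2"
      by (simp add: vil_poly_idx[OF x])
  qed
  also have "\<dots> = (\<Sum>n\<in>levels. (cmod (grid_poly c {\<nu> \<in> R. level \<tau> \<nu> = n} (idx x)))\<^sup>2)"
  proof (rule sum.mono_neutral_left[OF finite_levels])
    show "level \<tau> ` R \<subseteq> levels" using R level_in_levels[OF _ \<tau>] by blast
    show "\<forall>n\<in>levels - level \<tau> ` R. (cmod (grid_poly c {\<nu> \<in> R. level \<tau> \<nu> = n} (idx x)))\<^sup>2 = 0"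
    proof
      fix n assume "n \<in> levels - level \<tau> ` R"
      then have "{\<nu> \<in> R. level \<tau> \<nu> = n} = {}" by blast
      then show "(cmod (grid_poly c {\<nu> \<in> R. level \<tau> \<nu> = n} (idx x)))\<^sup>2 = 0"
        by (simp only: grid_poly_def) simp
    qed
  qed
  finally show ?thesis .
qed

text \<open>
  After division by \<open>v\<^sub>\<tau>\<close>, a character of depth at most \<open>n\<close> in every direction is constant on the
  cells of generation \<open>n\<close>, and every other character has mean zero on them.
\<close>
lemma vil_exp_modulated:
  assumes n: "\<And>d. n d \<le> N" and R: "R \<subseteq> points" and \<tau>: "\<tau> \<in> points"
    and h: "h \<in> borel_measurable cubeM" "AE x in cubeM. h x = cnj (grid_charD \<tau> (idx x)) * grid_poly c R (idx x)"
  shows "AE x in cubeM. vil_exp m n h x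
    = cnj (grid_charD \<tau> (idx x)) * grid_poly c {\<nu> \<in> R. \<forall>d. level \<tau> \<nu> d \<le> n d} (idx x)"
proof (rule vil_exp_idx[OF n _ _ h])
  let ?L = "{\<nu> \<in> R. \<forall>d. level \<tau> \<nu> d \<le> n d}" and ?H = "{\<nu> \<in> R. \<not> (\<forall>d. level \<tau> \<nu> d \<le> n d)}"
  have fin: "finite R" by (rule finite_subset[OF R finite_points])
  show "cnj (grid_charD \<tau> y) * grid_poly c ?L y = cnj (grid_charD \<tau> x) * grid_poly c ?L x"
    if "x \<in> points" "y \<in> cell n x" for x y
  proof -
    have "cnj (grid_charD \<tau> y) * (c \<nu> * grid_charD \<nu> y) = cnj (grid_charD \<tau> x) * (c \<nu> * grid_charD \<nu> x)" if "\<nu> \<in> ?L" for \<nu>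
    proof -
      have "\<nu> d div dir.P d (n d) = \<tau> d div dir.P d (n d)" for d
        using that dir.depth_le_iff[of d "\<nu> d" "\<tau> d" "n d"] by (simp add: level_def)
      from grid_charD_ratio_const[OF this \<open>y \<in> cell n x\<close>] show ?thesis by (simp add: mult_ac)
    qed
    then show ?thesis unfolding grid_poly_def sum_distrib_left by (rule sum.cong[OF refl])
  qed
  show "(\<Sum>y\<in>cell n x. cnj (grid_charD \<tau> y) * grid_poly c R y) = (\<Sum>y\<in>cell n x. cnj (grid_charD \<tau> y) * grid_poly c ?L y)" for x
  proof -
    have "(\<Sum>y\<in>cell n x. grid_poly c ?H y * cnj (grid_poly (\<lambda>_. 1) {\<tau>} y)) = 0"
    proof (rule grid_poly_orthogonal)
      fix \<nu> \<mu> assume "\<nu> \<in> ?H" "\<mu> \<in> {\<tau>}"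
      then obtain d where "\<not> level \<tau> \<nu> d \<le> n d" "\<mu> = \<tau>" by blast
      then show "\<exists>d. \<nu> d div dir.P d (n d) \<noteq> \<mu> d div dir.P d (n d)"
        using dir.depth_le_iff[of d "\<nu> d" "\<tau> d" "n d"] by (auto simp: level_def)
    qed (use R \<tau> in auto)
    then have zero: "(\<Sum>y\<in>cell n x. cnj (grid_charD \<tau> y) * grid_poly c ?H y) = 0"
      by (simp add: grid_poly_def[of "\<lambda>_. 1"] mult.commute)
    have "grid_poly c R y = grid_poly c ?L y + grid_poly c ?H y" for y
    proof -
      have "?L \<union> ?H = R" by blast
      moreover have "grid_poly c (?L \<union> ?H) y = grid_poly c ?L y + grid_poly c ?H y"
        unfolding grid_poly_def by (rule sum.union_disjoint) (use fin in auto)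
      ultimately show ?thesis by (simp only:)
    qed
    then show ?thesis using zero by (simp add: distrib_left sum.distrib)
  qed
qed

text \<open>
  By inclusion and exclusion over the directions: the coefficient of a character is the product over \<open>d\<close> of
  the differences of the indicators of depth at most \<open>n d\<close> and at most \<open>n d - 1\<close>.
\<close>
lemma vil_diff_modulated:
  assumes n: "n \<in> levels" and R: "R \<subseteq> points" and \<tau>: "\<tau> \<in> points"
    and h: "h \<in> borel_measurable cubeM" "AE x in cubeM. h x = cnj (grid_charD \<tau> (idx x)) * grid_poly c R (idx x)"
  shows "AE x in cubeM. vil_diff m n h x
    = cnj (grid_charD \<tau> (idx x)) * grid_poly c {\<nu> \<in> R. level \<tau> \<nu> = n} (idx x)"
proof -
  define E where "E = (Pi UNIV (\<lambda>_. {0, 1}) :: ('d \<Rightarrow> nat) set)"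
  have finE: "finite E" unfolding E_def PiE_UNIV_domain[symmetric] by (intro finite_PiE) auto
  have finR: "finite R" by (rule finite_subset[OF R finite_points])
  define L where "L e = {\<nu> \<in> R. \<forall>d. level \<tau> \<nu> d \<le> n d - e d}" for e
  have nN: "n d - e d \<le> N" for d e
    using n le_trans[OF diff_le_self] by (auto simp: levels_def)
  have "AE x in cubeM. \<forall>e\<in>E. vil_exp m (\<lambda>d. n d - e d) h x = cnj (grid_charD \<tau> (idx x)) * grid_poly c (L e) (idx x)"
  proof (rule AE_finite_allI[OF finE])
    fix e
    show "AE x in cubeM. vil_exp m (\<lambda>d. n d - e d) h x = cnj (grid_charD \<tau> (idx x)) * grid_poly c (L e) (idx x)"
      unfolding L_def by (rule vil_exp_modulated[OF nN R \<tau> h])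
  qed
  then show ?thesis
  proof eventually_elim
    case (elim x)
    define w :: "('d \<Rightarrow> nat) \<Rightarrow> 'd \<Rightarrow> nat \<Rightarrow> complex" where
      "w \<nu> d i = (if i \<le> n d \<and> level \<tau> \<nu> d \<le> n d - i then (- 1) ^ i else 0)" for \<nu> d i
    have w_sum: "(\<Sum>e\<in>E. \<Prod>d\<in>UNIV. w \<nu> d (e d)) = of_bool (level \<tau> \<nu> = n)" for \<nu>
    proof -
      have "(\<Sum>e\<in>E. \<Prod>d\<in>UNIV. w \<nu> d (e d)) = (\<Prod>d\<in>UNIV. \<Sum>i\<in>{0, 1}. w \<nu> d i)"
        unfolding E_def PiE_UNIV_domain[symmetric] by (rule prod_sum_PiE[symmetric]) auto
      also have "\<dots> = (\<Prod>d\<in>UNIV. of_bool (level \<tau> \<nu> d = n d))"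
        by (intro prod.cong refl) (auto simp: w_def)
      also have "\<dots> = of_bool (\<forall>d. level \<tau> \<nu> d = n d)"
        by (cases "\<forall>d. level \<tau> \<nu> d = n d") (auto intro!: prod_zero)
      finally show ?thesis by (simp add: fun_eq_iff)
    qed
    have w_prod: "(\<Prod>d\<in>UNIV. w \<nu> d (e d)) = (if \<forall>d. e d \<le> n d then (- 1) ^ (\<Sum>d\<in>UNIV. e d) * of_bool (\<nu> \<in> L e) else 0)"
      if "\<nu> \<in> R" for \<nu> e
    proof (cases "\<forall>d. e d \<le> n d \<and> level \<tau> \<nu> d \<le> n d - e d")
      case True
      then show ?thesis using that by (simp add: w_def power_sum L_def)
    next
      case False
      then have "(\<Prod>d\<in>UNIV. w \<nu> d (e d)) = 0" by (intro prod_zero) (auto simp: w_def)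
      then show ?thesis using False that by (auto simp: L_def)
    qed
    have "vil_diff m n h x = (\<Sum>e\<in>E. if \<forall>d. e d \<le> n d
        then (- 1) ^ (\<Sum>d\<in>UNIV. e d) * (cnj (grid_charD \<tau> (idx x)) * grid_poly c (L e) (idx x)) else 0)"
      unfolding vil_diff_def E_def[symmetric] using elim by (intro sum.cong) auto
    also have "\<dots> = (\<Sum>e\<in>E. \<Sum>\<nu>\<in>R. cnj (grid_charD \<tau> (idx x)) * (c \<nu> * grid_charD \<nu> (idx x)) * (\<Prod>d\<in>UNIV. w \<nu> d (e d)))"
    proof (rule sum.cong[OF refl])
      fix e
      have "grid_poly c (L e) (idx x) = (\<Sum>\<nu>\<in>R. of_bool (\<nu> \<in> L e) * (c \<nu> * grid_charD \<nu> (idx x)))"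
        unfolding grid_poly_def using finR by (intro sum.mono_neutral_cong_left) (auto simp: L_def)
      note eq = this
      show "(if \<forall>d. e d \<le> n d then (- 1) ^ (\<Sum>d\<in>UNIV. e d) * (cnj (grid_charD \<tau> (idx x)) * grid_poly c (L e) (idx x)) else 0)
        = (\<Sum>\<nu>\<in>R. cnj (grid_charD \<tau> (idx x)) * (c \<nu> * grid_charD \<nu> (idx x)) * (\<Prod>d\<in>UNIV. w \<nu> d (e d)))"
      proof (cases "\<forall>d. e d \<le> n d")
        case True
        then show ?thesis by (simp add: w_prod eq sum_distrib_left mult_ac)
      next
        case False
        then have "cnj (grid_charD \<tau> (idx x)) * (c \<nu> * grid_charD \<nu> (idx x)) * (\<Prod>d\<in>UNIV. w \<nu> d (e d)) = 0"
          if "\<nu> \<in> R" for \<nu>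
          by (simp only: w_prod[OF that] if_False mult_zero_right)
        with False show ?thesis by (simp only: if_False) (rule sym, rule sum.neutral, blast)
      qed
    qed
    also have "\<dots> = (\<Sum>\<nu>\<in>R. \<Sum>e\<in>E. cnj (grid_charD \<tau> (idx x)) * (c \<nu> * grid_charD \<nu> (idx x)) * (\<Prod>d\<in>UNIV. w \<nu> d (e d)))"
      by (rule sum.swap)
    also have "\<dots> = (\<Sum>\<nu>\<in>R. cnj (grid_charD \<tau> (idx x)) * (c \<nu> * grid_charD \<nu> (idx x)) * of_bool (level \<tau> \<nu> = n))"
      by (simp only: sum_distrib_left[symmetric] w_sum)
    also have "\<dots> = (\<Sum>\<nu>\<in>{\<nu> \<in> R. level \<tau> \<nu> = n}. cnj (grid_charD \<tau> (idx x)) * (c \<nu> * grid_charD \<nu> (idx x)))"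
      using finR by (intro sum.mono_neutral_cong_right) auto
    finally show ?case by (simp add: grid_poly_def sum_distrib_left)
  qed
qed

end

lemma exists_grid:
  fixes m :: "'d::finite \<Rightarrow> nat \<Rightarrow> nat" and S :: "('d \<Rightarrow> nat) set"
  assumes two_le: "\<And>d k. 2 \<le> m d k" and S: "finite S"
  obtains N where "\<And>\<nu> d. \<nu> \<in> S \<Longrightarrow> \<nu> d < vil_prod (m d) N"
proof -
  define N where "N = (\<Sum>\<nu>\<in>S. \<Sum>d\<in>UNIV. \<nu> d)"
  have "\<nu> d < vil_prod (m d) N" if "\<nu> \<in> S" for \<nu> d
  proof -
    have "\<nu> d \<le> (\<Sum>d\<in>UNIV. \<nu> d)" by (rule member_le_sum) auto
    also have "\<dots> \<le> N" unfolding N_def by (rule member_le_sum[OF that _ S]) simp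
    finally have "\<nu> d < 2 ^ N" using less_exp[of N] by linarith
    then show ?thesis using vil_prod_ge[of "m d" N, OF two_le] by linarith
  qed
  then show ?thesis by (rule that)
qed

lemma rectangle_subset_points:
  assumes "vilenkin_grid m" "\<And>d. b d < vil_prod (m d) N"
  shows "rectangle a b \<subseteq> product_cells.points (\<lambda>d. {..<vil_prod (m d) N})"
proof -
  interpret vilenkin_grid m N by (rule assms(1))
  show ?thesis
  proof
    fix \<nu> assume "\<nu> \<in> rectangle a b"
    then have "\<nu> d < b d" for d by (auto simp: rectangle_def Pi_iff)
    then show "\<nu> \<in> points" using assms(2) less_trans unfolding points_iff by blast
  qed
qed

section \<open>Completeness of \<open>L\<^sup>p\<close> and powers of extended numbers\<close>

text \<open>
  Along a subsequence with rapidly decreasing \<open>e\<close>, the sum of the \<open>p\<close>-th powers of the increments is finite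
  almost everywhere. As \<open>p \<le> 1\<close>, the increments are then absolutely summable, which gives a pointwise limit.
  Fatou's lemma bounds the distance to it with the same \<open>e\<close>.
\<close>
lemma Lp_complete:
  fixes s :: "nat \<Rightarrow> 'a \<Rightarrow> real" and e :: "nat \<Rightarrow> ennreal"
  assumes p: "0 < p" "p \<le> 1" and [measurable]: "\<And>n. s n \<in> borel_measurable M"
    and cauchy: "\<And>i j. i \<le> j \<Longrightarrow> (\<integral>\<^sup>+x. ennreal (\<bar>s j x - s i x\<bar> powr p) \<partial>M) \<le> e i"
    and e: "e \<longlonglongrightarrow> 0"
  obtains S where "S \<in> borel_measurable M"
    "\<And>i. (\<integral>\<^sup>+x. ennreal (\<bar>s i x - S x\<bar> powr p) \<partial>M) \<le> e i"
proof -
  have "\<exists>r. \<forall>n. e (r n) \<le> ennreal ((1/2) ^ n) \<and> r n < r (Suc n)"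
  proof (rule dependent_nat_choice)
    have ev: "\<forall>\<^sub>F i in sequentially. e i < ennreal ((1/2) ^ n)" for n
      using e by (rule order_tendstoD) simp
    show "\<exists>i. e i \<le> ennreal ((1/2) ^ 0)"
      using eventually_happens[OF ev[of 0]] less_imp_le by auto
    show "\<exists>j. e j \<le> ennreal ((1/2) ^ Suc n) \<and> i < j" for i n
      using eventually_happens[OF eventually_conj[OF ev[of "Suc n"] eventually_gt_at_top[of i]]]
      using less_imp_le by auto
  qed
  then obtain r where r: "\<And>n. e (r n) \<le> ennreal ((1/2) ^ n)" "\<And>n. r n < r (Suc n)" by blast
  then have mono: "strict_mono r" by (simp add: strict_mono_Suc_iff)
  define S where "S x = lim (\<lambda>n. s (r n) x)" for x
  have S_meas [measurable]: "S \<in> borel_measurable M"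
    unfolding S_def by (rule borel_measurable_lim_metric) simp
  let ?g = "\<lambda>n x. \<bar>s (r (Suc n)) x - s (r n) x\<bar> powr p"
  have "(\<integral>\<^sup>+x. (\<Sum>n. ennreal (?g n x)) \<partial>M) = (\<Sum>n. \<integral>\<^sup>+x. ennreal (?g n x) \<partial>M)"
    by (rule nn_integral_suminf) measurable
  also have "\<dots> \<le> (\<Sum>n. ennreal ((1/2) ^ n))"
    by (intro suminf_le summableI order.trans[OF cauchy r(1)] less_imp_le[OF r(2)])
  also have "\<dots> = ennreal (\<Sum>n. (1/2) ^ n)"
    by (intro suminf_ennreal2) auto
  finally have "(\<integral>\<^sup>+x. (\<Sum>n. ennreal (?g n x)) \<partial>M) \<noteq> \<infinity>"
    by (metis ennreal_neq_top infinity_ennreal_def neq_top_trans)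
  then have "AE x in M. (\<Sum>n. ennreal (?g n x)) \<noteq> \<infinity>"
    by (intro nn_integral_PInf_AE) measurable
  then have conv: "AE x in M. (\<lambda>n. s (r n) x) \<longlonglongrightarrow> S x"
  proof eventually_elim
    case (elim x)
    have summ: "summable (\<lambda>n. ?g n x)" using elim by (intro summable_suminf_not_top) auto
    have "\<forall>\<^sub>F n in sequentially. ?g n x < 1"
      using summable_LIMSEQ_zero[OF summ] by (rule order_tendstoD) simp
    then have "\<forall>\<^sub>F n in sequentially. norm (s (r (Suc n)) x - s (r n) x) \<le> ?g n x"
    proof eventually_elim
      case (elim n)
      let ?u = "\<bar>s (r (Suc n)) x - s (r n) x\<bar>"
      have "?u < 1"
      proof (rule ccontr)
        assume "\<not> ?u < 1"
        then have "1 \<le> ?u powr p" using p by (intro ge_one_powr_ge_zero) auto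
        then show False using elim by simp
      qed
      then have "?u powr 1 \<le> ?u powr p" using p by (intro powr_mono') auto
      then show ?case by simp
    qed
    then have "summable (\<lambda>n. s (r (Suc n)) x - s (r n) x)"
      using summ by (rule summable_comparison_test_ev)
    then have "convergent (\<lambda>n. \<Sum>i<n. s (r (Suc i)) x - s (r i) x)"
      by (simp add: summable_iff_convergent)
    then have "convergent (\<lambda>n. s (r n) x - s (r 0) x)"
      by (simp add: sum_lessThan_telescope[of "\<lambda>i. s (r i) x"])
    then have "convergent (\<lambda>n. s (r n) x)"
      using convergent_add_const_right_iff[of "\<lambda>n. s (r n) x" "- s (r 0) x"] by simp
    then show ?case by (simp add: S_def convergent_LIMSEQ_iff)
  qed
  have "(\<integral>\<^sup>+x. ennreal (\<bar>s i x - S x\<bar> powr p) \<partial>M) \<le> e i" for i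
  proof -
    let ?h = "\<lambda>n x. ennreal (\<bar>s (r n) x - s i x\<bar> powr p)"
    have "(\<integral>\<^sup>+x. ennreal (\<bar>s i x - S x\<bar> powr p) \<partial>M) = (\<integral>\<^sup>+x. liminf (\<lambda>n. ?h n x) \<partial>M)"
    proof (rule nn_integral_cong_AE)
      show "AE x in M. ennreal (\<bar>s i x - S x\<bar> powr p) = liminf (\<lambda>n. ?h n x)"
        using conv
      proof eventually_elim
        case (elim x)
        have "(\<lambda>n. \<bar>s (r n) x - s i x\<bar> powr p) \<longlonglongrightarrow> \<bar>S x - s i x\<bar> powr p"
          using p by (intro tendsto_powr' tendsto_rabs tendsto_diff elim tendsto_const) auto
        then have "(\<lambda>n. ?h n x) \<longlonglongrightarrow> ennreal (\<bar>S x - s i x\<bar> powr p)" by (rule tendsto_ennrealI)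
        then have "liminf (\<lambda>n. ?h n x) = ennreal (\<bar>S x - s i x\<bar> powr p)"
          by (intro lim_imp_Liminf) auto
        then show ?case by (simp add: abs_minus_commute)
      qed
    qed
    also have "\<dots> \<le> liminf (\<lambda>n. \<integral>\<^sup>+x. ?h n x \<partial>M)" by (rule nn_integral_liminf) measurable
    also have "\<dots> \<le> e i"
    proof -
      have "\<forall>\<^sub>F n in sequentially. (\<integral>\<^sup>+x. ?h n x \<partial>M) \<le> e i"
        using eventually_ge_at_top[of i]
      proof eventually_elim
        case (elim n)
        then show ?case using cauchy[of i "r n"] seq_suble[OF mono, of n] by simp
      qed
      then show ?thesis
        using Liminf_mono[of "\<lambda>n. \<integral>\<^sup>+x. ?h n x \<partial>M" "\<lambda>_. e i" sequentially]
        by (simp add: Liminf_const)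
    qed
    finally show ?thesis .
  qed
  then show ?thesis using that S_meas by blast
qed

lemma ennpow_ennreal: "0 \<le> t \<Longrightarrow> ennpow (ennreal t) r = ennreal (t powr r)"
  by (simp add: ennpow_def)

lemma ennpow_mono:
  assumes "0 < r" "s \<le> t"
  shows "ennpow s r \<le> ennpow t r"
proof (cases t)
  case (real t')
  then have "s \<noteq> top" using assms(2) by (auto simp: top_unique)
  then obtain s' where "s = ennreal s'" "0 \<le> s'" by (cases s) auto
  then show ?thesis using real assms by (simp add: ennpow_ennreal powr_mono2)
next
  case top
  then show ?thesis by (simp add: ennpow_def)
qed

lemma ennpow_ennpow: "ennpow (ennpow t r) q = ennpow t (r * q)"
  by (cases t) (auto simp: ennpow_ennreal powr_powr, simp add: ennpow_def)

lemma ennpow_one: "ennpow t 1 = t"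
  by (cases t) (auto simp: ennpow_ennreal, simp add: ennpow_def)

lemma ennpow_mult_ennreal:
  assumes "0 < c"
  shows "ennpow (ennreal c * t) r = ennreal (c powr r) * ennpow t r"
  using assms
  by (cases t) (auto simp: ennpow_ennreal ennreal_mult'[symmetric] powr_mult ennpow_def ennreal_mult_top)

lemma Lp_norm_eq:
  "Lp_norm p (\<lambda>x. ennreal \<bar>u x\<bar>) = ennpow (\<integral>\<^sup>+x. ennreal (\<bar>u x\<bar> powr p) \<partial>cubeM) (1 / p)"
  by (simp add: Lp_norm_def ennpow_ennreal)

lemma ennpow_tendsto_zero:
  fixes f :: "nat \<Rightarrow> ennreal"
  assumes "0 < r" "f \<longlonglongrightarrow> 0"
  shows "(\<lambda>n. ennpow (f n) r) \<longlonglongrightarrow> 0"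
proof -
  have lim: "(\<lambda>n. enn2real (f n)) \<longlonglongrightarrow> 0"
    using tendsto_enn2real[of f 0 sequentially] assms(2) by simp
  then have "(\<lambda>n. enn2real (f n) powr r) \<longlonglongrightarrow> 0 powr r"
    using assms by (intro tendsto_powr' lim tendsto_const) auto
  then have 1: "(\<lambda>n. ennreal (enn2real (f n) powr r)) \<longlonglongrightarrow> 0"
    using tendsto_ennrealI by fastforce
  have "\<forall>\<^sub>F n in sequentially. f n < \<infinity>" using assms(2) by (rule order_tendstoD) simp
  then have "\<forall>\<^sub>F n in sequentially. ennpow (f n) r = ennreal (enn2real (f n) powr r)"
    by eventually_elim (auto simp: ennpow_def)
  then show ?thesis using 1 by (simp add: tendsto_cong)
qed

lemma measurable_ennpow [measurable]:
  assumes "f \<in> borel_measurable M"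
  shows "(\<lambda>x. ennpow (f x) r) \<in> borel_measurable M"
  unfolding ennpow_def using assms by measurable

section \<open>The inequality on the unit cube\<close>

lemma vilenkinD_measurable:
  fixes m :: "'d::finite \<Rightarrow> nat \<Rightarrow> nat"
  assumes "\<And>d k. 2 \<le> m d k"
  shows "vilenkinD m \<nu> \<in> borel_measurable cubeM"
proof -
  obtain N where "\<And>\<mu> d. \<mu> \<in> {\<nu>} \<Longrightarrow> \<mu> d < vil_prod (m d) N"
    using exists_grid[of m "{\<nu>}", OF assms] by auto
  then have N: "\<nu> d < vil_prod (m d) N" for d by blast
  interpret vilenkin_grid m N by unfold_locales (rule assms)
  have "vilenkinD m \<nu> x = grid_charD \<nu> (idx x)" if "x \<in> space cubeM" for x
    using that N by (intro vilenkinD_idx) (auto simp: space_restrict_space points_iff)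
  then show ?thesis using idx_measurable'[of "grid_charD \<nu>"] measurable_cong[of cubeM "vilenkinD m \<nu>" "\<lambda>x. grid_charD \<nu> (idx x)" borel]
    by blast
qed

lemma vil_poly_measurable:
  fixes m :: "'d::finite \<Rightarrow> nat \<Rightarrow> nat"
  assumes "\<And>d k. 2 \<le> m d k"
  shows "vil_poly m c R \<in> borel_measurable cubeM"
  unfolding vil_poly_def[abs_def]
  by (intro borel_measurable_sum borel_measurable_times borel_measurable_const vilenkinD_measurable assms)

lemma square_sum_measurable:
  fixes m :: "'d::finite \<Rightarrow> nat \<Rightarrow> nat"
  assumes "\<And>d k. 2 \<le> m d k"
  shows "square_sum m c \<tau> R \<in> borel_measurable cubeM"
proof -
  have [measurable]: "vil_poly m c S \<in> borel_measurable cubeM" for S by (rule vil_poly_measurable[OF assms])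
  show ?thesis unfolding square_sum_def[abs_def] by measurable
qed

text \<open>
  The grid estimate, multiplied by the volume of a cell. The constant does not depend on the grid, which
  is chosen fine enough for the given rectangles.
\<close>
theorem polynomial_bound:
  fixes m :: "'d::finite \<Rightarrow> nat \<Rightarrow> nat" and a b :: "'k \<Rightarrow> 'd \<Rightarrow> nat" and cf :: "'k \<Rightarrow> ('d \<Rightarrow> nat) \<Rightarrow> complex"
  assumes p: "0 < p" "p \<le> 1" and two_le: "\<And>d k. 2 \<le> m d k" and M: "\<And>d k. m d k \<le> M" and K: "finite K"
    and disj: "\<And>k l. k \<in> K \<Longrightarrow> l \<in> K \<Longrightarrow> k \<noteq> l \<Longrightarrow> rectangle (a k) (b k) \<inter> rectangle (a l) (b l) = {}"
    and C: "C = 9 * (2 ^ CARD('d) * (2 * real M ^ CARD('d))) ^ CARD('d) / (1 - 2 powr - p)"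
  shows "(\<integral>\<^sup>+x. ennreal (cmod (\<Sum>k\<in>K. vil_poly m (cf k) (rectangle (a k) (b k)) x) powr p) \<partial>cubeM)
    \<le> ennreal C * (\<Sum>c\<in>UNIV. \<integral>\<^sup>+x. ennreal ((\<Sum>k\<in>K.
          square_sum m (cf k) (corner c (a k) (b k)) (rectangle (a k) (b k)) x) powr (p / 2)) \<partial>cubeM)"
proof -
  obtain N where N: "\<And>\<nu> d. \<nu> \<in> a ` K \<union> b ` K \<Longrightarrow> \<nu> d < vil_prod (m d) N"
    using exists_grid[of m "a ` K \<union> b ` K", OF two_le] K by auto
  interpret vilenkin_grid m N by unfold_locales (rule two_le)
  have ab: "a k \<in> points" "b k \<in> points" if "k \<in> K" for k
    using N[of "a k"] N[of "b k"] that by (auto simp: points_iff)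
  have R: "rectangle (a k) (b k) \<subseteq> points" if "k \<in> K" for k
    using ab(2)[OF that] by (intro rectangle_subset_points) (auto simp: points_iff intro: vilenkin_grid_axioms)
  have \<tau>: "corner c (a k) (b k) \<in> points" if "k \<in> K" for k c
    using ab[OF that] by (simp add: corner_def points_iff)
  have C0: "0 \<le> C"
  proof -
    have "2 powr - p \<le> 2 powr 0" using p by (intro powr_mono) auto
    then show ?thesis unfolding C by (intro divide_nonneg_nonneg) auto
  qed
  let ?F = "\<lambda>y. cmod (\<Sum>k\<in>K. grid_poly (cf k) (rectangle (a k) (b k)) y) powr p"
  let ?S = "\<lambda>c y. (\<Sum>k\<in>K. \<Sum>n\<in>levels.
     (cmod (grid_poly (cf k) {\<nu> \<in> rectangle (a k) (b k). level (corner c (a k) (b k)) \<nu> = n} y))\<^sup>2) powr (p / 2)"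
  have "(\<integral>\<^sup>+x. ennreal (cmod (\<Sum>k\<in>K. vil_poly m (cf k) (rectangle (a k) (b k)) x) powr p) \<partial>cubeM)
      = (\<integral>\<^sup>+x. ennreal (?F (idx x)) \<partial>cubeM)"
  proof (rule nn_integral_cong)
    fix x :: "real ^ 'd" assume "x \<in> space cubeM"
    then have x: "x \<in> cube" by (simp add: space_restrict_space)
    have "(\<Sum>k\<in>K. vil_poly m (cf k) (rectangle (a k) (b k)) x) = (\<Sum>k\<in>K. grid_poly (cf k) (rectangle (a k) (b k)) (idx x))"
      by (intro sum.cong refl vil_poly_idx x R)
    then show "ennreal (cmod (\<Sum>k\<in>K. vil_poly m (cf k) (rectangle (a k) (b k)) x) powr p) = ennreal (?F (idx x))"
      by (simp only:)
  qed
  also have "\<dots> = ennreal cell_volume * ennreal (\<Sum>y\<in>points. ?F y)"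
    by (simp add: nn_integral_idx[where f = "\<lambda>y. ennreal (?F y)"] sum_ennreal)
  also have "\<dots> \<le> ennreal cell_volume * ennreal (C * (\<Sum>c\<in>UNIV. \<Sum>y\<in>points. ?S c y))"
    unfolding C by (intro mult_left_mono ennreal_leI rectangles_bound p M K ab disj) auto
  also have "\<dots> = ennreal C * (\<Sum>c\<in>UNIV. ennreal cell_volume * (\<Sum>y\<in>points. ennreal (?S c y)))"
    using C0 by (simp add: ennreal_mult' sum_ennreal sum_nonneg sum_distrib_left[symmetric] mult.left_commute)
  also have "\<dots> = ennreal C * (\<Sum>c\<in>UNIV. \<integral>\<^sup>+x. ennreal (?S c (idx x)) \<partial>cubeM)"
    by (simp only: nn_integral_idx[where f = "\<lambda>y. ennreal (?S c y)" for c])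
  also have "\<dots> = ennreal C * (\<Sum>c\<in>UNIV. \<integral>\<^sup>+x. ennreal ((\<Sum>k\<in>K.
          square_sum m (cf k) (corner c (a k) (b k)) (rectangle (a k) (b k)) x) powr (p / 2)) \<partial>cubeM)"
  proof (intro arg_cong2[where f = "(*)"] refl sum.cong nn_integral_cong)
    fix c and x :: "real ^ 'd" assume "x \<in> space cubeM"
    then have x: "x \<in> cube" by (simp add: space_restrict_space)
    have "(\<Sum>k\<in>K. square_sum m (cf k) (corner c (a k) (b k)) (rectangle (a k) (b k)) x)
      = (\<Sum>k\<in>K. \<Sum>n\<in>levels. (cmod (grid_poly (cf k) {\<nu> \<in> rectangle (a k) (b k). level (corner c (a k) (b k)) \<nu> = n} (idx x)))\<^sup>2)"
      by (intro sum.cong refl square_sum_idx x R \<tau>)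
    then show "ennreal (?S c (idx x)) = ennreal ((\<Sum>k\<in>K. square_sum m (cf k) (corner c (a k) (b k)) (rectangle (a k) (b k)) x) powr (p / 2))"
      by (simp only:)
  qed
  finally show ?thesis .
qed

lemma vil_diff_spectrum:
  fixes m :: "'d::finite \<Rightarrow> nat \<Rightarrow> nat" and f :: "real ^ 'd \<Rightarrow> real"
  assumes two_le: "\<And>d k. 2 \<le> m d k" and f: "f \<in> borel_measurable cubeM"
    and eq: "AE x in cubeM. complex_of_real (f x) = vil_poly m cf (rectangle a b) x"
    and R: "R = rectangle a b" and \<tau>: "\<tau> = corner c a b"
  shows "AE x in cubeM. \<forall>n\<in>vilenkin_grid.level m \<tau> ` R.
     cmod (vil_diff m n (\<lambda>x. inverse (vilenkinD m \<tau> x) * complex_of_real (f x)) x)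
     = cmod (vil_poly m cf {\<nu> \<in> R. vilenkin_grid.level m \<tau> \<nu> = n} x)"
proof -
  obtain N where N: "\<And>\<nu> d. \<nu> \<in> {a, b} \<Longrightarrow> \<nu> d < vil_prod (m d) N"
    using exists_grid[of m "{a, b}", OF two_le] by auto
  interpret vilenkin_grid m N by unfold_locales (rule two_le)
  have R_points: "R \<subseteq> points"
    unfolding R using N by (intro rectangle_subset_points) (auto intro: vilenkin_grid_axioms)
  have \<tau>_points: "\<tau> \<in> points" using N by (simp add: \<tau> corner_def points_iff)
  let ?h = "\<lambda>x. inverse (vilenkinD m \<tau> x) * complex_of_real (f x)"
  have meas: "?h \<in> borel_measurable cubeM"
    using f vilenkinD_measurable[of m \<tau>, OF two_le] by simp
  have h: "AE x in cubeM. ?h x = cnj (grid_charD \<tau> (idx x)) * grid_poly cf R (idx x)"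
    using eq AE_space
  proof eventually_elim
    case (elim x)
    then have x: "x \<in> cube" by (simp add: space_restrict_space)
    have "inverse (grid_charD \<tau> (idx x)) = cnj (grid_charD \<tau> (idx x))"
      by (intro inverse_unique) (simp add: complex_norm_square[symmetric] norm_grid_charD)
    then show ?case using elim by (simp add: vilenkinD_idx[OF x \<tau>_points] R[symmetric] vil_poly_idx[OF x R_points])
  qed
  have fin: "finite (level \<tau> ` R)" unfolding R by (intro finite_imageI finite_rectangle)
  show ?thesis
  proof (rule AE_finite_allI[OF fin])
    fix n assume "n \<in> level \<tau> ` R"
    then have n: "n \<in> levels" using R_points level_in_levels[OF _ \<tau>_points] by blast
    show "AE x in cubeM. cmod (vil_diff m n ?h x) = cmod (vil_poly m cf {\<nu> \<in> R. level \<tau> \<nu> = n} x)"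
      using vil_diff_modulated[OF n R_points \<tau>_points meas h] AE_space
    proof eventually_elim
      case (elim x)
      then have x: "x \<in> cube" by (simp add: space_restrict_space)
      have "{\<nu> \<in> R. level \<tau> \<nu> = n} \<subseteq> points" using R_points by blast
      then show ?case using elim by (simp add: norm_mult norm_grid_charD vil_poly_idx[OF x])
    qed
  qed
qed

text \<open>
  Restricting the double series on the right to the depths that occur in the rectangles leaves martingale differences
  that are known explicitly.
\<close>
lemma square_sum_le_hardy_integrand:
  fixes m :: "'d::finite \<Rightarrow> nat \<Rightarrow> nat" and f :: "nat \<Rightarrow> real ^ 'd \<Rightarrow> real"
  assumes two_le: "\<And>d k. 2 \<le> m d k" and f: "\<And>k. f k \<in> borel_measurable cubeM"
    and eq: "\<And>k. AE x in cubeM. complex_of_real (f k x) = vil_poly m (cf k) (rectangle (a k) (b k)) x"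
  shows "AE x in cubeM. (\<Sum>k. ennreal (square_sum m (cf k) (corner c (a k) (b k)) (rectangle (a k) (b k)) x))
    \<le> (\<Sum>\<^sub>\<infinity>n. \<Sum>\<^sub>\<infinity>k. ennreal ((cmod (vil_diff m n (\<lambda>x. inverse (vilenkinD m (corner c (a k) (b k)) x)
          * complex_of_real (f k x)) x))\<^sup>2))"
proof -
  define \<tau> where "\<tau> k = corner c (a k) (b k)" for k
  define R where "R k = rectangle (a k) (b k)" for k
  define S where "S k = vilenkin_grid.level m (\<tau> k) ` R k" for k
  let ?g = "\<lambda>k x. inverse (vilenkinD m (\<tau> k) x) * complex_of_real (f k x)"
  interpret vilenkin_grid m 0 by unfold_locales (rule two_le)
  have fin: "finite (S k)" for k unfolding S_def R_def by (intro finite_imageI finite_rectangle)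
  have "AE x in cubeM. \<forall>k. \<forall>n\<in>S k. cmod (vil_diff m n (?g k) x)
      = cmod (vil_poly m (cf k) {\<nu> \<in> R k. level (\<tau> k) \<nu> = n} x)"
    unfolding AE_all_countable S_def
    using vil_diff_spectrum[OF two_le f eq R_def \<tau>_def] by blast
  then show ?thesis
  proof eventually_elim
    case (elim x)
    let ?u = "\<lambda>n k. ennreal ((cmod (vil_diff m n (?g k) x))\<^sup>2)"
    have sq: "ennreal (square_sum m (cf k) (\<tau> k) (R k) x) = (\<Sum>n\<in>S k. ?u n k)" for k
    proof -
      have "square_sum m (cf k) (\<tau> k) (R k) x = (\<Sum>n\<in>S k. (cmod (vil_diff m n (?g k) x))\<^sup>2)"
        unfolding square_sum_def S_def[symmetric] using elim by (intro sum.cong) auto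
      then show ?thesis by (simp add: sum_ennreal)
    qed
    have "(\<Sum>k. ennreal (square_sum m (cf k) (\<tau> k) (R k) x)) \<le> (\<Sum>\<^sub>\<infinity>n. \<Sum>\<^sub>\<infinity>k. ?u n k)"
    proof (rule suminf_le_const)
      fix K
      let ?S = "\<Union>k<K. S k"
      have "(\<Sum>k<K. ennreal (square_sum m (cf k) (\<tau> k) (R k) x)) \<le> (\<Sum>k<K. \<Sum>n\<in>?S. ?u n k)"
        unfolding sq using fin by (intro sum_mono sum_mono2) auto
      also have "\<dots> = (\<Sum>n\<in>?S. \<Sum>k<K. ?u n k)" by (rule sum.swap)
      also have "\<dots> \<le> (\<Sum>n\<in>?S. \<Sum>\<^sub>\<infinity>k. ?u n k)"
        by (intro sum_mono sum_le_infsum_ennreal) auto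
      also have "\<dots> \<le> (\<Sum>\<^sub>\<infinity>n. \<Sum>\<^sub>\<infinity>k. ?u n k)"
        using fin by (intro sum_le_infsum_ennreal) auto
      finally show "(\<Sum>k<K. ennreal (square_sum m (cf k) (\<tau> k) (R k) x)) \<le> (\<Sum>\<^sub>\<infinity>n. \<Sum>\<^sub>\<infinity>k. ?u n k)" .
    qed simp
    then show ?case by (simp only: \<tau>_def R_def)
  qed
qed

lemma suminf_tail_tendsto_zero:
  fixes f :: "nat \<Rightarrow> real"
  assumes nonneg: "\<And>k. 0 \<le> f k" and fin: "(\<Sum>k. ennreal (f k)) \<noteq> \<infinity>"
  shows "(\<lambda>n. \<Sum>k. ennreal (f (k + n))) \<longlonglongrightarrow> 0"
proof -
  have summ: "summable f" using nonneg fin by (intro summable_suminf_not_top) auto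
  have "(\<lambda>n. suminf f - (\<Sum>i<n. f i)) \<longlonglongrightarrow> suminf f - suminf f"
    by (intro tendsto_diff tendsto_const summable_LIMSEQ summ)
  then have "(\<lambda>n. \<Sum>k. f (k + n)) \<longlonglongrightarrow> 0" by (simp add: suminf_minus_initial_segment[OF summ])
  then have "(\<lambda>n. ennreal (\<Sum>k. f (k + n))) \<longlonglongrightarrow> 0" using tendsto_ennrealI by fastforce
  moreover have "(\<Sum>k. ennreal (f (k + n))) = ennreal (\<Sum>k. f (k + n))" for n
    using summ nonneg by (intro suminf_ennreal2) (auto simp: summable_iff_shift)
  ultimately show ?thesis by simp
qed

lemma suminf_tail_le:
  fixes f :: "nat \<Rightarrow> ennreal"
  shows "(\<Sum>k. f (k + n)) \<le> (\<Sum>k. f k)"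
proof (rule suminf_le_const)
  fix K
  have "(\<Sum>k<K. f (k + n)) = sum f {n..<K + n}"
    using sum.shift_bounds_nat_ivl[of f 0 n K] by (simp add: lessThan_atLeast0)
  also have "\<dots> \<le> suminf f" by (rule sum_le_suminf) auto
  finally show "(\<Sum>k<K. f (k + n)) \<le> suminf f" .
qed simp

text \<open>
  The constant of \<open>polynomial_bound\<close> is multiplied by the number of corners when the \<open>p\<close>-th powers of the Hardy
  norms are each estimated by that of their sum; the \<open>p\<close>-th root of the result is the constant.
\<close>
theorem theorem7:
  fixes m :: "'d::finite \<Rightarrow> nat \<Rightarrow> nat" and p :: real
  assumes "0 < p" and "p \<le> 1"
    and "\<And>d. bounded_generators (m d)"
  shows "\<exists>C::real. 0 < C \<and>
    (\<forall>(a :: nat \<Rightarrow> 'd \<Rightarrow> nat) (b :: nat \<Rightarrow> 'd \<Rightarrow> nat) (f :: nat \<Rightarrow> real ^ 'd \<Rightarrow> real).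
       disjoint_family (\<lambda>k. rectangle (a k) (b k)) \<longrightarrow>
       (\<forall>k. spectrum_in m (rectangle (a k) (b k)) (f k)) \<longrightarrow>
       (let RHS = (\<Sum>c\<in>(UNIV :: ('d \<Rightarrow> bool) set).
                     hardy_norm m p (\<lambda>k x. inverse (vilenkinD m (corner c (a k) (b k)) x)
                                              * complex_of_real (f k x)))
        in RHS < \<infinity> \<longrightarrow>
           (\<exists>S. Lp_sums p f S \<and> Lp_norm p (\<lambda>x. ennreal \<bar>S x\<bar>) \<le> ennreal C * RHS)))"
proof -
  note p = assms(1,2)
  have two_le: "2 \<le> m d k" for d k using assms(3) by (simp add: bounded_generators_def)
  obtain M where M: "\<And>d k. m d k \<le> M"
  proof -
    have "\<forall>d. \<exists>B. \<forall>k. m d k \<le> B" using assms(3) by (auto simp: bounded_generators_def bdd_above_def)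
    from choice[OF this] obtain B where B: "\<And>d k. m d k \<le> B d" by blast
    have "m d k \<le> (\<Sum>d\<in>UNIV. B d)" for d k
      using B[of d k] member_le_sum[of d UNIV B] by simp
    then show ?thesis by (rule that)
  qed
  define C where "C = 9 * (2 ^ CARD('d) * (2 * real M ^ CARD('d))) ^ CARD('d) / (1 - 2 powr - p)"
  have C: "0 < C"
  proof -
    have "2 powr - p < 2 powr 0" using p by (intro powr_less_mono) auto
    moreover have "0 < real M" using M[of undefined 0] two_le[of undefined 0] by simp
    ultimately show ?thesis unfolding C_def by (intro divide_pos_pos mult_pos_pos zero_less_power) auto
  qed
  define n2 where "n2 = real CARD('d \<Rightarrow> bool)"
  have n2: "0 < n2" unfolding n2_def by (simp only: of_nat_0_less_iff zero_less_card_finite)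
  show ?thesis
  proof (intro exI[of _ "(C * n2) powr (1 / p)"] conjI allI impI)
    show "0 < (C * n2) powr (1 / p)" using C n2 by simp
  next
    fix a b :: "nat \<Rightarrow> 'd \<Rightarrow> nat" and f :: "nat \<Rightarrow> real ^ 'd \<Rightarrow> real"
    assume disj: "disjoint_family (\<lambda>k. rectangle (a k) (b k))"
      and spec: "\<forall>k. spectrum_in m (rectangle (a k) (b k)) (f k)"
    define h where "h c = hardy_norm m p (\<lambda>k x. inverse (vilenkinD m (corner c (a k) (b k)) x) * complex_of_real (f k x))" for c
    define RHS where "RHS = (\<Sum>c\<in>UNIV. h c)"
    have "\<exists>S. Lp_sums p f S \<and> Lp_norm p (\<lambda>x. ennreal \<bar>S x\<bar>) \<le> ennreal ((C * n2) powr (1 / p)) * RHS"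
      if fin: "RHS < \<infinity>"
    proof -
      define cf where "cf k \<nu> = L2_inner (\<lambda>y. complex_of_real (f k y)) (vilenkinD m \<nu>)" for k \<nu>
      define T where "T k = vil_poly m (cf k) (rectangle (a k) (b k))" for k
      have f_meas [measurable]: "f k \<in> borel_measurable cubeM" for k
        using spec by (simp add: spectrum_in_def)
      have f_eq: "AE x in cubeM. complex_of_real (f k x) = T k x" for k
        using spec by (simp add: spectrum_in_def T_def vil_poly_def cf_def)
      define sq where "sq c k = square_sum m (cf k) (corner c (a k) (b k)) (rectangle (a k) (b k))" for c k
      have sq_nonneg: "0 \<le> sq c k x" for c k x by (simp add: sq_def square_sum_nonneg)
      have sq_meas [measurable]: "sq c k \<in> borel_measurable cubeM" for c k
        unfolding sq_def by (rule square_sum_measurable[OF two_le])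
      \<comment> \<open>The tails of the square function of a corner, and the resulting Cauchy bound \<open>e\<close> for the partial sums.\<close>
      define H where "H c n x = (\<Sum>k. ennreal (sq c (k + n) x))" for c n x
      have H_meas [measurable]: "H c n \<in> borel_measurable cubeM" for c n
        unfolding H_def[abs_def] by measurable
      define I where "I c n = (\<integral>\<^sup>+x. ennpow (H c n x) (p / 2) \<partial>cubeM)" for c n
      have H_hardy: "ennpow (I c 0) (1 / p) \<le> h c" for c
      proof -
        let ?V = "\<lambda>x. \<Sum>\<^sub>\<infinity>n. \<Sum>\<^sub>\<infinity>k. ennreal ((cmod (vil_diff m n (\<lambda>x. inverse (vilenkinD m (corner c (a k) (b k)) x)
          * complex_of_real (f k x)) x))\<^sup>2)"
        have "AE x in cubeM. H c 0 x \<le> ?V x"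
          using square_sum_le_hardy_integrand[of m f cf a b c, OF two_le f_meas] f_eq
          by (simp add: H_def sq_def T_def)
        then have "AE x in cubeM. ennpow (H c 0 x) (p / 2) \<le> ennpow (ennpow (?V x) (1 / 2)) p"
        proof eventually_elim
          case (elim x)
          then show ?case using p ennpow_mono[of "p / 2" "H c 0 x" "?V x"] by (simp add: ennpow_ennpow)
        qed
        then have "I c 0 \<le> (\<integral>\<^sup>+x. ennpow (ennpow (?V x) (1 / 2)) p \<partial>cubeM)"
          unfolding I_def by (rule nn_integral_mono_AE)
        then show ?thesis
          unfolding h_def hardy_norm_def Lp_norm_def using p by (intro ennpow_mono) auto
      qed
      have h_le: "h c \<le> RHS" for c unfolding RHS_def by (rule member_le_sum) auto
      have I_le: "I c 0 \<le> ennpow RHS p" for c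
      proof -
        have "ennpow (ennpow (I c 0) (1 / p)) p \<le> ennpow RHS p"
          using p H_hardy[of c] h_le[of c] by (intro ennpow_mono) (auto intro: order.trans)
        then show ?thesis using p by (simp add: ennpow_ennpow ennpow_one)
      qed
      have I_fin: "I c 0 < \<infinity>" for c
      proof -
        have "ennpow RHS p < \<infinity>" using fin by (cases RHS) (auto simp: ennpow_ennreal)
        then show ?thesis using I_le[of c] by (rule le_less_trans[rotated])
      qed
      have I_lim: "(\<lambda>n. I c n) \<longlonglongrightarrow> 0" for c
      proof -
        have "(\<lambda>n. \<integral>\<^sup>+x. ennpow (H c n x) (p / 2) \<partial>cubeM) \<longlonglongrightarrow> (\<integral>\<^sup>+x. 0 \<partial>(cubeM :: (real ^ 'd) measure))"
        proof (rule nn_integral_dominated_convergence)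
          show "AE x in cubeM. ennpow (H c n x) (p / 2) \<le> ennpow (H c 0 x) (p / 2)" for n
            using p suminf_tail_le[of "\<lambda>k. ennreal (sq c k x)" n for x]
            by (intro AE_I2 ennpow_mono) (auto simp: H_def)
          show "(\<integral>\<^sup>+x. ennpow (H c 0 x) (p / 2) \<partial>cubeM) < \<infinity>" using I_fin[of c] by (simp add: I_def)
          have "AE x in cubeM. ennpow (H c 0 x) (p / 2) \<noteq> \<infinity>"
            using I_fin[of c] by (intro nn_integral_PInf_AE) (auto simp: I_def)
          then show "AE x in cubeM. (\<lambda>n. ennpow (H c n x) (p / 2)) \<longlonglongrightarrow> 0"
          proof eventually_elim
            case (elim x)
            then have "(\<Sum>k. ennreal (sq c k x)) \<noteq> \<infinity>" by (auto simp: H_def ennpow_def)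
            from suminf_tail_tendsto_zero[OF sq_nonneg this] show ?case
              using p unfolding H_def by (intro ennpow_tendsto_zero) auto
          qed
        qed measurable
        then show ?thesis by (simp add: I_def)
      qed
      define s where "s n x = (\<Sum>k<n. f k x)" for n x
      define e where "e n = ennreal C * (\<Sum>c\<in>UNIV. I c n)" for n
      have s_meas [measurable]: "s n \<in> borel_measurable cubeM" for n
        unfolding s_def[abs_def] by measurable
      have e_lim: "e \<longlonglongrightarrow> 0"
      proof -
        have "(\<lambda>n. \<Sum>c\<in>UNIV. I c n) \<longlonglongrightarrow> (\<Sum>c\<in>(UNIV :: ('d \<Rightarrow> bool) set). 0)"
          by (intro tendsto_sum I_lim)
        then have "(\<lambda>n. ennreal C * (\<Sum>c\<in>UNIV. I c n)) \<longlonglongrightarrow> ennreal C * 0"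
          by (intro ennreal_tendsto_cmult) auto
        then show ?thesis by (simp add: e_def[abs_def])
      qed
      have cauchy: "(\<integral>\<^sup>+x. ennreal (\<bar>s j x - s i x\<bar> powr p) \<partial>cubeM) \<le> e i" if ij: "i \<le> j" for i j
      proof -
        have "AE x in cubeM. \<forall>k. complex_of_real (f k x) = T k x"
          using f_eq by (simp add: AE_all_countable)
        then have "AE x in cubeM. ennreal (\<bar>s j x - s i x\<bar> powr p) = ennreal (cmod (\<Sum>k\<in>{i..<j}. T k x) powr p)"
        proof eventually_elim
          case (elim x)
          have "s j x - s i x = (\<Sum>k\<in>{i..<j}. f k x)"
            using ij sum_diff_nat_ivl[of 0 i j "\<lambda>k. f k x"] by (simp add: s_def lessThan_atLeast0)
          then have "complex_of_real (s j x - s i x) = (\<Sum>k\<in>{i..<j}. T k x)" using elim by simp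
          then have "cmod (\<Sum>k\<in>{i..<j}. T k x) = \<bar>s j x - s i x\<bar>" by (metis norm_of_real)
          then show ?case by simp
        qed
        then have "(\<integral>\<^sup>+x. ennreal (\<bar>s j x - s i x\<bar> powr p) \<partial>cubeM)
            = (\<integral>\<^sup>+x. ennreal (cmod (\<Sum>k\<in>{i..<j}. T k x) powr p) \<partial>cubeM)"
          by (rule nn_integral_cong_AE)
        also have "\<dots> \<le> ennreal C * (\<Sum>c\<in>UNIV. \<integral>\<^sup>+x. ennreal ((\<Sum>k\<in>{i..<j}. sq c k x) powr (p / 2)) \<partial>cubeM)"
          unfolding T_def sq_def using disj
          by (intro polynomial_bound[OF p two_le M _ _ C_def]) (auto simp: disjoint_family_on_def)
        also have "\<dots> \<le> e i"
          unfolding e_def I_def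
        proof (intro mult_left_mono sum_mono nn_integral_mono)
          fix c :: "'d \<Rightarrow> bool" and x :: "real ^ 'd"
          have "ennreal (\<Sum>k\<in>{i..<j}. sq c k x) = (\<Sum>k\<in>{i..<j}. ennreal (sq c k x))"
            by (simp add: sum_ennreal sq_nonneg)
          also have "\<dots> = (\<Sum>k<j - i. ennreal (sq c (k + i) x))"
            using sum.shift_bounds_nat_ivl[of "\<lambda>k. ennreal (sq c k x)" 0 i "j - i"] ij
            by (simp add: lessThan_atLeast0)
          also have "\<dots> \<le> H c i x" unfolding H_def by (rule sum_le_suminf) auto
          finally have "ennpow (ennreal (\<Sum>k\<in>{i..<j}. sq c k x)) (p / 2) \<le> ennpow (H c i x) (p / 2)"
            using p by (intro ennpow_mono) auto
          then show "ennreal ((\<Sum>k\<in>{i..<j}. sq c k x) powr (p / 2)) \<le> ennpow (H c i x) (p / 2)"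
            by (simp add: ennpow_ennreal sum_nonneg sq_nonneg)
        qed auto
        finally show ?thesis .
      qed
      obtain S where S [measurable]: "S \<in> borel_measurable cubeM"
        and S_le: "\<And>i. (\<integral>\<^sup>+x. ennreal (\<bar>s i x - S x\<bar> powr p) \<partial>cubeM) \<le> e i"
        using Lp_complete[OF p s_meas cauchy e_lim] by blast
      have bound: "Lp_norm p (\<lambda>x. ennreal \<bar>S x\<bar>) \<le> ennreal ((C * n2) powr (1 / p)) * RHS"
      proof -
        have "(\<integral>\<^sup>+x. ennreal (\<bar>S x\<bar> powr p) \<partial>cubeM) \<le> e 0" using S_le[of 0] by (simp add: s_def)
        also have "\<dots> \<le> ennreal C * (\<Sum>c\<in>(UNIV :: ('d \<Rightarrow> bool) set). ennpow RHS p)"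
          unfolding e_def by (intro mult_left_mono sum_mono I_le) auto
        also have "\<dots> = ennreal (C * n2) * ennpow RHS p"
          using C by (simp add: n2_def ennreal_mult' ennreal_of_nat_eq_real_of_nat mult.assoc del: card_fun)
        finally have "Lp_norm p (\<lambda>x. ennreal \<bar>S x\<bar>) \<le> ennpow (ennreal (C * n2) * ennpow RHS p) (1 / p)"
          unfolding Lp_norm_eq using p by (intro ennpow_mono) auto
        also have "\<dots> = ennreal ((C * n2) powr (1 / p)) * RHS"
          using p C n2 by (simp add: ennpow_mult_ennreal ennpow_ennpow ennpow_one)
        finally show ?thesis .
      qed
      have "Lp_sums p f S"
        unfolding Lp_sums_def
      proof (intro conjI S)
        have "ennreal ((C * n2) powr (1 / p)) * RHS < \<infinity>" using fin by (simp add: ennreal_mult_less_top)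
        with bound show "Lp_norm p (\<lambda>x. ennreal \<bar>S x\<bar>) < \<infinity>" by (rule le_less_trans)
        show "(\<lambda>N. Lp_norm p (\<lambda>x. ennreal \<bar>(\<Sum>k<N. f k x) - S x\<bar>)) \<longlonglongrightarrow> 0"
        proof (rule tendsto_sandwich[OF _ _ tendsto_const])
          show "(\<lambda>N. ennpow (e N) (1 / p)) \<longlonglongrightarrow> 0" using p e_lim by (intro ennpow_tendsto_zero) auto
          show "\<forall>\<^sub>F N in sequentially. Lp_norm p (\<lambda>x. ennreal \<bar>(\<Sum>k<N. f k x) - S x\<bar>) \<le> ennpow (e N) (1 / p)"
            unfolding Lp_norm_eq using p S_le by (intro always_eventually allI ennpow_mono) (auto simp: s_def)
        qed simp
      qed
      then show ?thesis using bound by blast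
    qed
    then show "let RHS = (\<Sum>c\<in>(UNIV :: ('d \<Rightarrow> bool) set).
                     hardy_norm m p (\<lambda>k x. inverse (vilenkinD m (corner c (a k) (b k)) x)
                                              * complex_of_real (f k x)))
        in RHS < \<infinity> \<longrightarrow>
           (\<exists>S. Lp_sums p f S \<and> Lp_norm p (\<lambda>x. ennreal \<bar>S x\<bar>) \<le> ennreal ((C * n2) powr (1 / p)) * RHS)"
      unfolding Let_def RHS_def h_def by (rule impI)
  qed
qed

end
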